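(* Let $(\Omega,\mathcal{F},\mathbb{P})$ and $\{\tau_y\}_{y\in\mathbb{R}^d}$ be as in the context, and let $H$ satisfy the standing assumptions (i)--(iv) of the context. Assume furthermore the following: for every Hamiltonian $\hat{H}:\mathbb{R}^d\times\mathbb{R}^d\times\Omega\to\mathbb{R}$ that satisfies (i)--(iv) (with $\hat H$ in place of $H$) and is convex in the gradient variable outside a bounded set, in the sense that there exist $R_0>0$ and $\tilde{H}:\mathbb{R}^d\times\mathbb{R}^d\times\Omega\to\mathbb{R}$ satisfying (i)--(iv), with $\tilde{H}=\hat{H}$ on $(\mathbb{R}^d\setminus B_{R_0})\times\mathbb{R}^d\times\Omega$ and with $p\mapsto\tilde{H}(p,y,\omega)$ convex for each $y\in\mathbb{R}^d$ and $\omega\in\Omega$, there exists a subset $\Omega_8=\Omega_8(\hat{H})\subset\Omega$ of full probability such that, for every $\omega\in\Omega_8$ and $p\in\mathbb{R}^d$, with $\hat{v}^\delta$ the solution of $\delta\hat{v}^\delta+\hat{H}(p+D\hat{v}^\delta,y,\omega)=0$ on $\mathbb{R}^d$, the limit $\lim_{\delta\to0}-\delta\hat{v}^\delta(0,\omega)$ exists. Then there exists a subset $\Omega_9\subset\Omega$ of full probability such that, for every $\omega\in\Omega_9$, $p\in\mathbb{R}^d$ and $R>0$, with $v^\delta$ the solution of $\delta v^\delta+H(p+Dv^\delta,x,\omega)=0$ on $\mathbb{R}^d$ corresponding to $p$, $$\lim_{\delta\rightarrow 0}\ \sup_{x\in B_{R/\delta}}\left|\overline{H}(p)+\delta v^\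delta(x,\omega)\right|=0.$$
   Context: Setting. $(\Omega,\mathcal{F},\mathbb{P})$ is a probability space equipped with a group $\{\tau_y\}_{y\in\mathbb{R}^d}$ of transformations $\tau_y:\Omega\to\Omega$ (so $\tau_{y+z}=\tau_y\tau_z$) which are measure-preserving and ergodic, the latter meaning that if $E\in\mathcal{F}$ satisfies $\tau_y(E)=E$ for every $y\in\mathbb{R}^d$ then $\mathbb{P}(E)\in\{0,1\}$. "Full probability" means probability one. $B_R$ is the open ball of radius $R$ centered at $0$ in $\mathbb{R}^d$. All partial differential equations and inequalities are understood in the viscosity sense. Standing assumptions on $H:\mathbb{R}^d\times\mathbb{R}^d\times\Omega\to\mathbb{R}$, $(p,y,\omega)\mapsto H(p,y,\omega)$ (measurable in $\omega$ for fixed $(p,y)$): (i) for each $p$, $(y,\omega)\mapsto H(p,y,\omega)$ is stationary: $H(p,y+z,\omega)=H(p,y,\tau_z\omega)$ for all $y,z\in\mathbb{R}^d$, $\omega\in\Omega$; (ii) $\lim_{|p|\to\infty}\inf_{(y,\omega)\in\mathbb{R}^d\times\Omega}H(p,y,\omega)=+\infty$; (iii) for each $R>0$ there is $C=C(R)>0$ with $|H(p,y,\omega)|\le C$ for all $p\in B_R$, $y\in\mathbb{R}^d$, $\omega\in\Omega$; (iv) for each $R>0$ there is $C=C(R)>0$ with $|H(p_1,y_1,\omega)-H(p_2,y_2,\omega)|\le C(|p_1-p_2|+|y_1-y_2|)$ for all $p_1,p_2\in B_R$, $y_1,y_2\in\mathbb{R}^d$, $\omega\in\Omega$. Approximate macroscopic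 problem. For any Hamiltonian satisfying (i)--(iv), in particular for $H$, and for $p\in\mathbb{R}^d$, $\delta>0$, $\omega\in\Omega$, $v^\delta=v^\delta(\cdot,\omega)$ (corresponding to $p$) is the unique bounded Lipschitz viscosity solution of $\delta v^\delta+H(p+Dv^\delta,x,\omega)=0$ on $\mathbb{R}^d$; $\hat v^\delta$ is the analogous solution for $\hat H$. Effective Hamiltonian. There is a set $\Omega_1\subset\Omega$ of full probability such that for each $p\in\mathbb{R}^d$ the quantity $\limsup_{\delta\to0}-\delta v^\delta(0,\omega)$ takes the same value for every $\omega\in\Omega_1$; this value is denoted $\overline{H}(p)$, defining $\overline{H}:\mathbb{R}^d\to\mathbb{R}$. *)

theory Defs
  imports "HOL-Probability.Probability"
begin

section \<open>Viscosity solutions of first-order equations\<close>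

text \<open>
  The equation \<open>F(Du, x, u) = 0\<close> on the whole space is given by a function \<open>F q x r\<close> of the
  gradient \<open>q\<close>, the point \<open>x\<close> and the value \<open>r\<close>. Test functions are continuously differentiable on
  the whole space and touch \<open>u\<close> locally.
\<close>

definition C1_with_gradient :: "(real^'d \<Rightarrow> real) \<Rightarrow> (real^'d \<Rightarrow> real^'d) \<Rightarrow> bool" where
  "C1_with_gradient \<phi> G \<longleftrightarrow> (\<forall>x. GDERIV \<phi> x :> G x) \<and> continuous_on UNIV G"

definition local_max_at :: "(real^'d \<Rightarrow> real) \<Rightarrow> real^'d \<Rightarrow> bool" where
  "local_max_at f x \<longleftrightarrow> (\<exists>\<epsilon>>0. \<forall>y\<in>ball x \<epsilon>. f y \<le> f x)"

definition local_min_at :: "(real^'d \<Rightarrow> real) \<Rightarrow> real^'d \<Rightarrow> bool" where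
  "local_min_at f x \<longleftrightarrow> (\<exists>\<epsilon>>0. \<forall>y\<in>ball x \<epsilon>. f x \<le> f y)"

definition viscosity_subsolution ::
    "(real^'d \<Rightarrow> real^'d \<Rightarrow> real \<Rightarrow> real) \<Rightarrow> (real^'d \<Rightarrow> real) \<Rightarrow> bool" where
  "viscosity_subsolution F u \<longleftrightarrow> continuous_on UNIV u \<and>
     (\<forall>\<phi> G x. C1_with_gradient \<phi> G \<and> local_max_at (\<lambda>y. u y - \<phi> y) x \<longrightarrow> F (G x) x (u x) \<le> 0)"

definition viscosity_supersolution ::
    "(real^'d \<Rightarrow> real^'d \<Rightarrow> real \<Rightarrow> real) \<Rightarrow> (real^'d \<Rightarrow> real) \<Rightarrow> bool" where
  "viscosity_supersolution F u \<longleftrightarrow> continuous_on UNIV u \<and>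
     (\<forall>\<phi> G x. C1_with_gradient \<phi> G \<and> local_min_at (\<lambda>y. u y - \<phi> y) x \<longrightarrow> 0 \<le> F (G x) x (u x))"

definition viscosity_solution ::
    "(real^'d \<Rightarrow> real^'d \<Rightarrow> real \<Rightarrow> real) \<Rightarrow> (real^'d \<Rightarrow> real) \<Rightarrow> bool" where
  "viscosity_solution F u \<longleftrightarrow> viscosity_subsolution F u \<and> viscosity_supersolution F u"

section \<open>The stationary ergodic environment\<close>

locale ergodic_environment = prob_space M
  for M :: "'a measure" +
  fixes \<tau> :: "real^'d \<Rightarrow> 'a \<Rightarrow> 'a"
  assumes group_zero: "\<And>\<omega>. \<omega> \<in> space M \<Longrightarrow> \<tau> 0 \<omega> = \<omega>"
    and group_add: "\<And>y z \<omega>. \<omega> \<in> space M \<Longrightarrow> \<tau> (y + z) \<omega> = \<tau> y (\<tau> z \<omega>)"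
    and measurable_shift: "\<And>y. \<tau> y \<in> measurable M M"
    and measure_preserving: "\<And>y. distr M M (\<tau> y) = M"
    and ergodic: "\<And>E. E \<in> sets M \<Longrightarrow> (\<forall>y. \<tau> y ` E = E) \<Longrightarrow> measure M E = 0 \<or> measure M E = 1"

definition full_probability :: "'a measure \<Rightarrow> 'a set \<Rightarrow> bool" where
  "full_probability M A \<longleftrightarrow> A \<in> sets M \<and> measure M A = 1"

section \<open>Hamiltonians\<close>

text \<open>
  A Hamiltonian is written \<open>H p y \<omega>\<close>; only its values for \<open>\<omega> \<in> space M\<close> matter. The infimum in the
  coercivity condition is taken in the extended reals.
\<close>

locale stationary_hamiltonian =
  fixes M :: "'a measure"
    and \<tau> :: "real^'d \<Rightarrow> 'a \<Rightarrow> 'a"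
    and H :: "real^'d \<Rightarrow> real^'d \<Rightarrow> 'a \<Rightarrow> real"
  assumes measurable_H: "\<And>p y. (\<lambda>\<omega>. H p y \<omega>) \<in> borel_measurable M"
    and stationary: "\<And>p y z \<omega>. \<omega> \<in> space M \<Longrightarrow> H p (y + z) \<omega> = H p y (\<tau> z \<omega>)"
    and coercive:
      "((\<lambda>p. INF (y, \<omega>)\<in>UNIV \<times> space M. ereal (H p y \<omega>)) \<longlongrightarrow> \<infinity>) at_infinity"
    and locally_bounded:
      "\<And>R. R > 0 \<Longrightarrow> \<exists>C>0. \<forall>p\<in>ball 0 R. \<forall>y. \<forall>\<omega>\<in>space M. \<bar>H p y \<omega>\<bar> \<le> C"
    and locally_Lipschitz:
      "\<And>R. R > 0 \<Longrightarrow> \<exists>C>0. \<forall>p1\<in>ball 0 R. \<forall>p2\<in>ball 0 R. \<forall>y1 y2. \<forall>\<omega>\<in>space M.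
         \<bar>H p1 y1 \<omega> - H p2 y2 \<omega>\<bar> \<le> C * (norm (p1 - p2) + norm (y1 - y2))"

definition convex_outside_bounded_set ::
    "'a measure \<Rightarrow> (real^'d \<Rightarrow> 'a \<Rightarrow> 'a) \<Rightarrow> (real^'d \<Rightarrow> real^'d \<Rightarrow> 'a \<Rightarrow> real) \<Rightarrow> bool" where
  "convex_outside_bounded_set M \<tau> H \<longleftrightarrow>
     (\<exists>R0>0. \<exists>H'. stationary_hamiltonian M \<tau> H' \<and>
        (\<forall>p y. \<forall>\<omega>\<in>space M. p \<notin> ball 0 R0 \<longrightarrow> H' p y \<omega> = H p y \<omega>) \<and>
        (\<forall>y. \<forall>\<omega>\<in>space M. convex_on UNIV (\<lambda>p. H' p y \<omega>)))"

section \<open>The approximate macroscopic problem and the effective Hamiltonian\<close>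

definition is_macro_solution ::
    "(real^'d \<Rightarrow> real^'d \<Rightarrow> 'a \<Rightarrow> real) \<Rightarrow> real^'d \<Rightarrow> real \<Rightarrow> 'a \<Rightarrow> (real^'d \<Rightarrow> real) \<Rightarrow> bool" where
  "is_macro_solution H p \<delta> \<omega> v \<longleftrightarrow>
     bounded (range v) \<and> (\<exists>L. L-lipschitz_on UNIV v) \<and>
     viscosity_solution (\<lambda>q x r. \<delta> * r + H (p + q) x \<omega>) v"

text \<open>
  For a Hamiltonian satisfying the axioms of \<^locale>\<open>stationary_hamiltonian\<close>, \<open>\<delta> > 0\<close> and
  \<open>\<omega> \<in> space M\<close>, there is exactly one solution in the sense of \<^const>\<open>is_macro_solution\<close>; no other
  case of the following definite description is used.
\<close>

definition macro_solution ::
    "(real^'d \<Rightarrow> real^'d \<Rightarrow> 'a \<Rightarrow> real) \<Rightarrow> real^'d \<Rightarrow> real \<Rightarrow> 'a \<Rightarrow> real^'d \<Rightarrow> real" where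
  "macro_solution H p \<delta> \<omega> = (THE v. is_macro_solution H p \<delta> \<omega> v)"

text \<open>
  In an ergodic environment there is a set of full probability on which, for every \<open>p\<close>, the upper
  limit of \<open>-\<delta> v\<^sup>\<delta>(0, \<omega>)\<close> is finite and does not depend on \<open>\<omega>\<close>; two such sets intersect, so its value
  is uniquely determined.
\<close>

definition effective_hamiltonian ::
    "'a measure \<Rightarrow> (real^'d \<Rightarrow> real^'d \<Rightarrow> 'a \<Rightarrow> real) \<Rightarrow> real^'d \<Rightarrow> real" where
  "effective_hamiltonian M H =
     (THE h. \<exists>\<Omega>1. full_probability M \<Omega>1 \<and>
        (\<forall>p. \<forall>\<omega>\<in>\<Omega>1.
           Limsup (at_right 0) (\<lambda>\<delta>. ereal (- \<delta> * macro_solution H p \<delta> \<omega> 0)) = ereal (h p)))"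

end

theory Submission
  imports Defs
begin

text \<open>
  The proof reduces the uniform statement on \<open>B\<^bsub>R/\<delta>\<^esub>\<close> to the existence of the limit at the origin,
  which the hypothesis supplies for Hamiltonians that are convex outside a bounded set.

  \<^emph>\<open>Removing convexity at infinity.\<close> Coercivity bounds the gradient of every solution corresponding to
  \<open>\<bar>p\<bar> \<le> P\<close> by a constant independent of \<open>\<delta>\<close> and \<open>\<omega>\<close>. Such a solution sees the Hamiltonian only on a
  large ball, and \<open>H\<close> can be changed outside this ball so that it is eventually a shifted norm, which is convex. Applied to
  \<open>P = 1, 2, \<dots>\<close> the hypothesis yields the limit at the origin for \<open>H\<close> itself, almost surely and for all
  \<open>p\<close> at once (\<open>AE_limit_exists\<close>).

  \<^emph>\<open>The limit is deterministic.\<close> Stationarity turns a shift of the environment into a shift of the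
  solution, and \<open>\<delta> v\<^sup>\<delta>\<close> has Lipschitz constant of order \<open>\<delta>\<close>, so the upper limit is exactly invariant
  under the group. Ergodicity makes it constant, and Lipschitz dependence on \<open>p\<close> passes from
  countably many \<open>p\<close> to all (\<open>AE_tendsto_Hbar_all\<close>, \<open>effective_hamiltonian_eq\<close>). Ergodicity speaks only
  of measurable events, so the solution has to be measurable in \<open>\<omega>\<close>. Both this and its existence come
  from a monotone Lax--Friedrichs scheme, whose iterates are built from finitely many
  evaluations of \<open>H\<close> and which converges by the comparison principle (\<open>lf_convergence\<close>, \<open>macro_solution_exists\<close>).

  \<^emph>\<open>From the origin to large balls.\<close> After rescaling, the functions \<open>y \<mapsto> \<delta> v\<^sup>\<delta>(y/\<delta>, \<omega>)\<close> are equi-Lipschitz,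
  so it suffices to treat a dense set of directions \<open>e\<close>. For fixed \<open>e\<close>, the event that the convergence at
  the origin is still bad beyond the scale \<open>n\<close> has small probability for large \<open>n\<close>. By the maximal
  ergodic inequality for the single measure-preserving map \<open>\<tau>\<^sub>e\<close>, almost every environment visits this
  event along \<open>0, e, 2e, \<dots>\<close> with small density. Hence close to \<open>N e\<close>, relative to \<open>N\<close>, there is a point
  \<open>j e\<close> at which the environment is good, and the Lipschitz bound transports the convergence from
  \<open>j e\<close> to \<open>N e\<close> (\<open>rescaled_limit\<close>).
\<close>

section \<open>Test functions and Lipschitz bounds\<close>

lemma local_max_atI: "(\<And>y. f y \<le> f x) \<Longrightarrow> local_max_at f x"
  unfolding local_max_at_def by (auto intro: exI[of _ 1])

lemma local_min_at_uminus: "local_min_at f x \<longleftrightarrow> local_max_at (\<lambda>y. - f y) x"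
  unfolding local_max_at_def local_min_at_def by auto

lemma C1_add:
  "C1_with_gradient f F \<Longrightarrow> C1_with_gradient g G \<Longrightarrow> C1_with_gradient (\<lambda>x. f x + g x) (\<lambda>x. F x + G x)"
  unfolding C1_with_gradient_def by (auto intro!: GDERIV_add continuous_intros)

lemma C1_scale:
  "C1_with_gradient f F \<Longrightarrow> C1_with_gradient (\<lambda>x. c * f x) (\<lambda>x. c *\<^sub>R F x)"
  unfolding C1_with_gradient_def gderiv_def
  by (auto intro!: derivative_eq_intros continuous_intros)

lemma C1_uminus:
  "C1_with_gradient f F \<Longrightarrow> C1_with_gradient (\<lambda>x. - f x) (\<lambda>x. - F x)"
  using C1_scale[of f F "-1"] by simp

lemma C1_square_distance:
  fixes y :: "real^'d"
  shows "C1_with_gradient (\<lambda>x. (norm (x - y))\<^sup>2) (\<lambda>x. 2 *\<^sub>R (x - y))"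
  unfolding C1_with_gradient_def gderiv_def power2_norm_eq_inner
  by (auto intro!: derivative_eq_intros continuous_intros simp: inner_commute algebra_simps)

text \<open>
  Test functions have to be differentiable everywhere, so the distance to a point enters only through
  this smoothing of it.
\<close>

lemma C1_smoothed_distance:
  fixes y :: "real^'d"
  assumes "s > 0"
  shows "C1_with_gradient (\<lambda>x. sqrt (s\<^sup>2 + (norm (x - y))\<^sup>2))
           (\<lambda>x. (1 / sqrt (s\<^sup>2 + (norm (x - y))\<^sup>2)) *\<^sub>R (x - y))"
proof -
  have pos: "s\<^sup>2 + (norm (x - y))\<^sup>2 > 0" for x
    using assms by (simp add: add_pos_nonneg)
  have 1: "((\<lambda>x. s\<^sup>2 + (norm (x - y))\<^sup>2) has_derivative (\<lambda>h. h \<bullet> (2 *\<^sub>R (x - y)))) (at x)" for x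
    using has_derivative_add[OF has_derivative_const[of "s\<^sup>2"], of "\<lambda>x. (norm (x - y))\<^sup>2"]
      C1_square_distance[of y] unfolding C1_with_gradient_def gderiv_def by auto
  have "((\<lambda>x. sqrt (s\<^sup>2 + (norm (x - y))\<^sup>2)) has_derivative
       (\<lambda>h. h \<bullet> ((1 / sqrt (s\<^sup>2 + (norm (x - y))\<^sup>2)) *\<^sub>R (x - y)))) (at x)" for x
    by (rule has_derivative_eq_rhs[OF has_derivative_real_sqrt[OF pos 1[of x]]])
       (simp add: fun_eq_iff inner_diff_right inverse_eq_divide diff_divide_distrib algebra_simps)
  moreover have "sqrt (s\<^sup>2 + (norm (x - y))\<^sup>2) \<noteq> 0" for x
    using pos[of x] by (metis less_irrefl real_sqrt_eq_zero_cancel_iff)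
  ultimately show ?thesis
    unfolding C1_with_gradient_def gderiv_def
    by (auto intro!: continuous_intros)
qed

lemma lipschitz_of_difference:
  fixes u :: "'b::real_normed_vector \<Rightarrow> real"
  assumes "\<And>x y. u x - u y \<le> L * norm (x - y)" "L \<ge> 0"
  shows "L-lipschitz_on UNIV u"
proof (rule lipschitz_onI)
  fix x y
  show "dist (u x) (u y) \<le> L * dist x y"
    using assms(1)[of x y] assms(1)[of y x]
    by (simp add: dist_real_def dist_norm abs_le_iff norm_minus_commute)
qed fact

text \<open>
  Walk from the touching point against the gradient: the test function falls at the rate \<open>\<bar>D\<phi>\<bar>\<^sup>2\<close> per unit
  of time and \<open>u - \<phi>\<close> does not increase, whereas \<open>u\<close> falls at most at the rate \<open>L \<bar>D\<phi>\<bar>\<close>.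
\<close>

lemma test_gradient_bound:
  fixes u :: "real^'d \<Rightarrow> real"
  assumes lip: "L-lipschitz_on UNIV u" and C1: "C1_with_gradient \<phi> G"
    and max: "local_max_at (\<lambda>y. u y - \<phi> y) x"
  shows "norm (G x) \<le> L"
proof (cases "G x = 0")
  case True
  then show ?thesis using lipschitz_on_nonneg[OF lip] by simp
next
  case False
  obtain e where e: "e > 0" "\<And>y. dist x y < e \<Longrightarrow> u y - \<phi> y \<le> u x - \<phi> x"
    using max unfolding local_max_at_def by auto
  have d: "(\<phi> has_derivative (\<lambda>h. h \<bullet> G x)) (at x)"
    using C1 unfolding C1_with_gradient_def gderiv_def by auto
  have d2: "((\<lambda>t. x - t *\<^sub>R G x) has_derivative (\<lambda>t. - (t *\<^sub>R G x))) (at (0::real))"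
    by (auto intro!: derivative_eq_intros)
  have "((\<lambda>t. \<phi> (x - t *\<^sub>R G x)) has_derivative (\<lambda>t. - (t *\<^sub>R G x) \<bullet> G x)) (at 0)"
    using has_derivative_compose[OF d2, of \<phi> "\<lambda>h. h \<bullet> G x"] d by simp
  moreover have "(\<lambda>t. - (t *\<^sub>R G x) \<bullet> G x) = (*) (- (norm (G x))\<^sup>2)"
    by (auto simp: power2_norm_eq_inner)
  ultimately have "((\<lambda>t. \<phi> (x - t *\<^sub>R G x)) has_field_derivative - (norm (G x))\<^sup>2) (at 0)"
    unfolding has_field_derivative_def by simp
  then have lim: "((\<lambda>t. (\<phi> (x - t *\<^sub>R G x) - \<phi> x) / t) \<longlongrightarrow> - (norm (G x))\<^sup>2) (at_right 0)"
    unfolding has_field_derivative_iff by (auto intro: tendsto_mono[OF at_le])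
  have "eventually (\<lambda>t. - L * norm (G x) \<le> (\<phi> (x - t *\<^sub>R G x) - \<phi> x) / t) (at_right (0::real))"
    unfolding eventually_at_right_field
  proof (intro exI conjI allI impI)
    show "e / norm (G x) > 0" using e False by simp
    fix t :: real assume t: "0 < t" "t < e / norm (G x)"
    have "dist x (x - t *\<^sub>R G x) < e"
      using t False by (simp add: dist_norm field_simps)
    from e(2)[OF this] have "\<phi> (x - t *\<^sub>R G x) - \<phi> x \<ge> u (x - t *\<^sub>R G x) - u x" by simp
    moreover have "\<bar>u (x - t *\<^sub>R G x) - u x\<bar> \<le> L * (t * norm (G x))"
      using lipschitz_onD[OF lip, of "x - t *\<^sub>R G x" x] t by (simp add: dist_norm)
    ultimately have "- L * (t * norm (G x)) \<le> \<phi> (x - t *\<^sub>R G x) - \<phi> x" by simp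
    then show "- L * norm (G x) \<le> (\<phi> (x - t *\<^sub>R G x) - \<phi> x) / t"
      using t by (simp add: field_simps)
  qed
  from tendsto_lowerbound[OF lim this] have "(norm (G x))\<^sup>2 \<le> L * norm (G x)" by simp
  then show ?thesis using False by (simp add: power2_eq_square)
qed

lemma test_gradient_bound_min:
  fixes u :: "real^'d \<Rightarrow> real"
  assumes lip: "L-lipschitz_on UNIV u" and C1: "C1_with_gradient \<phi> G"
    and min: "local_min_at (\<lambda>y. u y - \<phi> y) x"
  shows "norm (G x) \<le> L"
proof -
  have "L-lipschitz_on UNIV (\<lambda>x. - u x)" using lip by (simp add: lipschitz_on_def dist_real_def abs_minus_commute)
  moreover have "local_max_at (\<lambda>y. - u y - (- \<phi> y)) x"
    using min by (simp add: local_min_at_uminus algebra_simps)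
  ultimately show ?thesis
    using test_gradient_bound[of L "\<lambda>x. - u x" "\<lambda>x. - \<phi> x" "\<lambda>x. - G x" x] C1_uminus[OF C1] by simp
qed

text \<open>Compactness on the whole space: outside a large ball the value at the origin is already at least as good.\<close>

lemma attains_global_max:
  fixes f :: "'b::{real_normed_vector, heine_borel} \<Rightarrow> real"
  assumes cont: "continuous_on UNIV f" and far: "\<And>x. norm x > R \<Longrightarrow> f x \<le> f 0"
  obtains x0 where "\<And>x. f x \<le> f x0"
proof -
  have "compact (cball (0::'b) \<bar>R\<bar>)" by simp
  moreover have "continuous_on (cball 0 \<bar>R\<bar>) f" using cont continuous_on_subset by blast
  ultimately obtain x0 where x0: "\<And>x. x \<in> cball 0 \<bar>R\<bar> \<Longrightarrow> f x \<le> f x0"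
    using continuous_attains_sup[of "cball (0::'b) \<bar>R\<bar>" f] by fastforce
  have "f x \<le> f x0" for x
  proof (cases "norm x \<le> \<bar>R\<bar>")
    case False
    then have "f x \<le> f 0" using far by auto
    also have "\<dots> \<le> f x0" using x0 by simp
    finally show ?thesis .
  qed (simp add: x0)
  then show ?thesis using that by blast
qed

lemma norm_le_smoothed: "norm x \<le> sqrt (s\<^sup>2 + (norm x)\<^sup>2)"
  by (rule real_le_rsqrt) simp

text \<open>
  The converse of \<open>test_gradient_bound\<close>, and the way in which coercivity controls a solution. Maximise
  \<open>u - K \<psi>\<close>, where \<open>\<psi>\<close> is the distance to \<open>y\<close> smoothed at the scale \<open>s\<close> and \<open>K > L\<close>. The gradient of \<open>K \<psi>\<close> is
  at most \<open>L\<close> only within a distance of order \<open>s\<close> from \<open>y\<close>, so the maximum lies there, and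
  \<open>s \<rightarrow> 0\<close> gives \<open>u(x) - u(y) \<le> K \<bar>x - y\<bar>\<close>.
\<close>

lemma lipschitz_of_test_gradients:
  fixes u :: "real^'d \<Rightarrow> real"
  assumes cont: "continuous_on UNIV u" and bdd: "bounded (range u)" and L: "L \<ge> 0"
    and grad: "\<And>\<phi> G x. C1_with_gradient \<phi> G \<Longrightarrow> local_max_at (\<lambda>y. u y - \<phi> y) x \<Longrightarrow> norm (G x) \<le> L"
  shows "L-lipschitz_on UNIV u"
proof -
  obtain A where A: "\<And>x. \<bar>u x\<bar> \<le> A"
    using bdd unfolding bounded_iff by auto
  have step: "u x - u y \<le> K * norm (x - y)" if K: "K > L" for x y K
  proof -
    have Kpos: "K > 0" using K L by simp
    \<comment> \<open>\<open>K t \<le> L sqrt (s\<^sup>2 + t\<^sup>2)\<close> holds exactly for \<open>t \<le> C s\<close>.\<close>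
    define C where "C = L / sqrt (K\<^sup>2 - L\<^sup>2)"
    have KL: "K\<^sup>2 - L\<^sup>2 > 0" using K L by (simp add: power_strict_mono)
    have C: "C \<ge> 0" unfolding C_def using L KL by simp
    have near: "\<exists>x0. norm (x0 - y) \<le> C * s \<and> u x - K * sqrt (s\<^sup>2 + (norm (x - y))\<^sup>2) \<le> u x0"
      if s: "s > 0" for s
    proof -
      define \<psi> where "\<psi> = (\<lambda>x. K * sqrt (s\<^sup>2 + (norm (x - y))\<^sup>2))"
      have c\<psi>: "continuous_on UNIV \<psi>" unfolding \<psi>_def by (intro continuous_intros)
      obtain x0 where x0: "\<And>x. u x - \<psi> x \<le> u x0 - \<psi> x0"
      proof (rule attains_global_max)
        show "continuous_on UNIV (\<lambda>x. u x - \<psi> x)" using cont c\<psi> by (intro continuous_intros)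
        fix z :: "real^'d" assume z: "norm z > (2 * A + \<psi> 0) / K + norm y"
        have "norm (z - y) > (2 * A + \<psi> 0) / K" using z norm_triangle_ineq2[of z y] by linarith
        then have "K * norm (z - y) > 2 * A + \<psi> 0" using Kpos by (simp add: field_simps)
        moreover have "K * norm (z - y) \<le> \<psi> z" unfolding \<psi>_def
          using norm_le_smoothed Kpos by (simp)
        ultimately show "u z - \<psi> z \<le> u 0 - \<psi> 0" using A[of z] A[of 0] by linarith
      qed blast
      have "local_max_at (\<lambda>x. u x - \<psi> x) x0" using x0 by (rule local_max_atI)
      moreover have C1: "C1_with_gradient \<psi> (\<lambda>x. K *\<^sub>R ((1 / sqrt (s\<^sup>2 + (norm (x - y))\<^sup>2)) *\<^sub>R (x - y)))"
        unfolding \<psi>_def by (rule C1_scale[OF C1_smoothed_distance[OF s]])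
      ultimately have "norm (K *\<^sub>R ((1 / sqrt (s\<^sup>2 + (norm (x0 - y))\<^sup>2)) *\<^sub>R (x0 - y))) \<le> L"
        using grad by blast
      moreover have pos: "s\<^sup>2 + (norm (x0 - y))\<^sup>2 > 0" using s by (simp add: add_pos_nonneg)
      ultimately have "K * norm (x0 - y) \<le> L * sqrt (s\<^sup>2 + (norm (x0 - y))\<^sup>2)"
        using Kpos by (simp add: pos_divide_le_eq del: scaleR_scaleR scaleR_diff_right)
      then have "(K * norm (x0 - y))\<^sup>2 \<le> (L * sqrt (s\<^sup>2 + (norm (x0 - y))\<^sup>2))\<^sup>2"
        using Kpos by (intro power_mono) auto
      then have "(K\<^sup>2 - L\<^sup>2) * (norm (x0 - y))\<^sup>2 \<le> L\<^sup>2 * s\<^sup>2"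
        using pos by (simp add: power_mult_distrib algebra_simps)
      then have "(norm (x0 - y))\<^sup>2 \<le> L\<^sup>2 * s\<^sup>2 / (K\<^sup>2 - L\<^sup>2)"
        using KL by (simp only: pos_le_divide_eq mult.commute)
      also have "\<dots> = (C * s)\<^sup>2"
        using KL by (simp add: C_def power_mult_distrib power_divide)
      finally have "(norm (x0 - y))\<^sup>2 \<le> (C * s)\<^sup>2" .
      then have "norm (x0 - y) \<le> C * s" using C s by (auto intro: power2_le_imp_le)
      moreover have "u x - \<psi> x \<le> u x0" using x0[of x] Kpos unfolding \<psi>_def by (smt (verit) mult_nonneg_nonneg real_sqrt_ge_zero zero_le_power2)
      ultimately show ?thesis unfolding \<psi>_def by blast
    qed
    have "\<exists>x0. \<forall>n. norm (x0 n - y) \<le> C * (1 / Suc n) \<and> u x - K * sqrt ((1 / Suc n)\<^sup>2 + (norm (x - y))\<^sup>2) \<le> u (x0 n)"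
      by (rule choice, rule allI, rule near) simp
    then obtain x0 where x0: "\<And>n. norm (x0 n - y) \<le> C * (1 / Suc n)"
      and x0': "\<And>n. u x - K * sqrt ((1 / Suc n)\<^sup>2 + (norm (x - y))\<^sup>2) \<le> u (x0 n)" by blast
    have inv: "(\<lambda>n. 1 / real (Suc n)) \<longlonglongrightarrow> 0" using LIMSEQ_inverse_real_of_nat by (simp add: inverse_eq_divide)
    have "(\<lambda>n. C * (1 / Suc n)) \<longlonglongrightarrow> 0" using tendsto_mult_right[OF inv, of C] by simp
    then have "(\<lambda>n. x0 n - y) \<longlonglongrightarrow> 0"
      by (rule Lim_null_comparison[OF always_eventually, rotated]) (use x0 in blast)
    then have "x0 \<longlonglongrightarrow> y" by (simp add: LIM_zero_cancel)
    then have lim1: "(\<lambda>n. u (x0 n)) \<longlonglongrightarrow> u y"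
      using cont by (metis UNIV_I continuous_on_tendsto_compose eventually_sequentiallyI)
    have "(\<lambda>n. u x - K * sqrt ((1 / Suc n)\<^sup>2 + (norm (x - y))\<^sup>2)) \<longlonglongrightarrow> u x - K * sqrt (0\<^sup>2 + (norm (x - y))\<^sup>2)"
      by (intro tendsto_intros inv)
    then have "u x - K * sqrt (0\<^sup>2 + (norm (x - y))\<^sup>2) \<le> u y"
      using LIMSEQ_le[OF _ lim1] x0' by blast
    then show ?thesis by simp
  qed
  have "u x - u y \<le> L * norm (x - y)" for x y
  proof (rule field_le_epsilon)
    fix e :: real assume "e > 0"
    then have *: "L + e / (norm (x - y) + 1) > L" by (simp add: add_nonneg_pos)
    have "u x - u y \<le> (L + e / (norm (x - y) + 1)) * norm (x - y)" by (rule step[OF *])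
    also have "\<dots> \<le> L * norm (x - y) + e"
    proof -
      have "0 < norm (x - y) + 1" by (simp add: add_nonneg_pos)
      then have "e / (norm (x - y) + 1) * norm (x - y) \<le> e"
        using \<open>e > 0\<close> by (simp add: divide_le_eq algebra_simps)
      then show ?thesis by (simp add: algebra_simps)
    qed
    finally show "u x - u y \<le> L * norm (x - y) + e" .
  qed
  then show ?thesis using L by (rule lipschitz_of_difference)
qed

section \<open>The comparison principle\<close>

text \<open>
  Doubling of variables. The quadratic penalty keeps the two points close, and a small multiple of
  the smoothed norm \<open>N\<close> makes the maximum exist. Since \<open>v\<close> is \<open>L\<close>-Lipschitz, the common gradient \<open>q\<close> has norm
  at most \<open>L\<close> and the points are within \<open>L \<beta>\<close> of each other, so a Hamiltonian that is Lipschitz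
  only for bounded gradients suffices. Allowing \<open>F\<close> and \<open>G\<close> to differ by \<open>m\<close> makes the same lemma give
  uniqueness as well as the dependence on \<open>p\<close> and \<open>\<delta>\<close>.
\<close>

lemma comparison:
  fixes u v :: "real^'d \<Rightarrow> real"
  assumes \<delta>: "\<delta> > 0"
    and sub: "viscosity_subsolution (\<lambda>q x r. \<delta> * r + F q x) u"
    and super: "viscosity_supersolution (\<lambda>q x r. \<delta> * r + G q x) v"
    and bdd: "bounded (range u)" "bounded (range v)"
    and lip: "L-lipschitz_on UNIV v"
    and F: "\<And>q q' x x'. norm q \<le> L + 1 \<Longrightarrow> norm q' \<le> L + 1 \<Longrightarrow>
                F q x - F q' x' \<le> C * (norm (q - q') + norm (x - x'))"
    and G: "\<And>q x. norm q \<le> L \<Longrightarrow> G q x \<le> F q x + m"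
  shows "\<delta> * (u x - v x) \<le> m"
proof -
  have L: "L \<ge> 0" using lip lipschitz_on_nonneg by blast
  have C: "C \<ge> 0"
  proof -
    define e :: "real^'d" where "e = axis undefined 1"
    have "norm e = 1" unfolding e_def by simp
    then show ?thesis using F[of 0 0 e 0] F[of 0 0 0 e] L by simp
  qed
  have cont: "continuous_on UNIV u" "continuous_on UNIV v"
    using sub super unfolding viscosity_subsolution_def viscosity_supersolution_def by auto
  obtain A1 where A1: "\<And>x. \<bar>u x\<bar> \<le> A1" using bdd(1) unfolding bounded_iff by auto
  obtain A2 where A2: "\<And>x. \<bar>v x\<bar> \<le> A2" using bdd(2) unfolding bounded_iff by auto
  define N where "N = (\<lambda>x::real^'d. sqrt (1\<^sup>2 + (norm (x - 0))\<^sup>2))"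
  have N: "norm x \<le> N x" "N x \<ge> 1" for x
    unfolding N_def using norm_le_smoothed[of x 1] by (auto simp: real_le_rsqrt)
  \<comment> \<open>One parameter \<open>\<beta>\<close> serves both as the scale of the quadratic penalty and as the weight of \<open>N\<close>.\<close>
  have main: "\<delta> * (u x - v x - \<beta> * N x) \<le> m + C * (\<beta> + L * \<beta>)"
    if \<beta>: "0 < \<beta>" "\<beta> \<le> 1" for x \<beta>
  proof -
    define \<Phi> where "\<Phi> = (\<lambda>(x, y). u x - v y - (norm (x - y))\<^sup>2 / (2 * \<beta>) - \<beta> * N x)"
    have \<Phi>: "\<Phi> (x, y) = u x - v y - (norm (x - y))\<^sup>2 / (2 * \<beta>) - \<beta> * N x" for x y
      unfolding \<Phi>_def by simp
    obtain z0 where z0: "\<And>z. \<Phi> z \<le> \<Phi> z0"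
    proof (rule attains_global_max)
      have "continuous_on UNIV N" unfolding N_def by (intro continuous_intros)
      then have cN: "continuous_on UNIV (\<lambda>z. N (fst z :: real^'d))"
        by (rule continuous_on_compose2) (auto intro: continuous_intros)
      have cu: "continuous_on UNIV (\<lambda>z. u (fst z :: real^'d))"
        by (rule continuous_on_compose2[OF cont(1)]) (auto intro: continuous_intros)
      have cv: "continuous_on UNIV (\<lambda>z. v (snd z :: real^'d))"
        by (rule continuous_on_compose2[OF cont(2)]) (auto intro: continuous_intros)
      show "continuous_on UNIV \<Phi>" unfolding \<Phi>_def split_beta using \<beta>
        by (intro continuous_intros cN cu cv) auto
      define K where "K = 2 * (A1 + A2) + \<beta> * N 0"
      have K: "K \<ge> 0" unfolding K_def using A1[of 0] A2[of 0] N(2)[of 0] \<beta> by auto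
      fix z :: "(real^'d) \<times> (real^'d)"
      assume z: "norm z > K / \<beta> + (K / \<beta> + (2 * \<beta> * K + 1))"
      obtain a b where ab: "z = (a, b)" by force
      have "norm z \<le> norm a + norm b" unfolding ab by (rule norm_Pair_le)
      moreover have "norm b \<le> norm a + norm (a - b)" using norm_triangle_ineq4[of a "a - b"] by simp
      ultimately have or: "norm a > K / \<beta> \<or> norm (a - b) > 2 * \<beta> * K + 1" using z by linarith
      have "(norm (a - b))\<^sup>2 / (2 * \<beta>) + \<beta> * N a \<ge> K"
        using or
      proof
        assume "norm a > K / \<beta>"
        then have "\<beta> * norm a > K" using \<beta> by (simp add: field_simps)
        then have "\<beta> * N a > K" using N(1)[of a] \<beta> by (smt (verit) mult_left_mono)
        then show ?thesis using \<beta> by (smt (verit) divide_nonneg_pos zero_le_power2)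
      next
        assume a: "norm (a - b) > 2 * \<beta> * K + 1"
        have nn: "2 * \<beta> * K \<ge> 0" using \<beta> K by simp
        then have "norm (a - b) \<ge> 1" using a by linarith
        then have "norm (a - b) * 1 \<le> norm (a - b) * norm (a - b)" by (intro mult_left_mono) auto
        then have "(norm (a - b))\<^sup>2 \<ge> 2 * \<beta> * K" using a by (simp add: power2_eq_square)
        then have "(norm (a - b))\<^sup>2 / (2 * \<beta>) \<ge> K" using \<beta> by (simp add: field_simps)
        moreover have "\<beta> * N a \<ge> 0" using N(2)[of a] \<beta> by simp
        ultimately show ?thesis by simp
      qed
      then show "\<Phi> z \<le> \<Phi> 0"
        using A1[of a] A2[of b] A1[of 0] A2[of 0] unfolding ab zero_prod_def \<Phi> K_def by simp
    qed blast
    obtain x0 y0 where xy: "z0 = (x0, y0)" by force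
    define q where "q = (1 / \<beta>) *\<^sub>R (x0 - y0)"
    define e where "e = (1 / N x0) *\<^sub>R x0"
    have e: "norm e \<le> 1" unfolding e_def using N[of x0] by (simp add: field_simps)
    have "C1_with_gradient (\<lambda>x. (1 / (2 * \<beta>)) * (norm (x - y0))\<^sup>2 + \<beta> * N x)
        (\<lambda>x. (1 / (2 * \<beta>)) *\<^sub>R (2 *\<^sub>R (x - y0)) + \<beta> *\<^sub>R ((1 / sqrt (1\<^sup>2 + (norm (x - 0))\<^sup>2)) *\<^sub>R (x - 0)))"
      unfolding N_def
      by (intro C1_add C1_scale C1_square_distance C1_smoothed_distance) simp
    moreover have "local_max_at (\<lambda>x. u x - ((1 / (2 * \<beta>)) * (norm (x - y0))\<^sup>2 + \<beta> * N x)) x0"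
    proof (rule local_max_atI)
      fix y show "u y - ((1 / (2 * \<beta>)) * (norm (y - y0))\<^sup>2 + \<beta> * N y)
          \<le> u x0 - ((1 / (2 * \<beta>)) * (norm (x0 - y0))\<^sup>2 + \<beta> * N x0)"
        using z0[of "(y, y0)"] unfolding xy \<Phi> by simp
    qed
    ultimately have s1: "\<delta> * u x0 + F ((1 / (2 * \<beta>)) *\<^sub>R (2 *\<^sub>R (x0 - y0)) + \<beta> *\<^sub>R ((1 / sqrt (1\<^sup>2 + (norm (x0 - 0))\<^sup>2)) *\<^sub>R (x0 - 0))) x0 \<le> 0"
      using sub unfolding viscosity_subsolution_def by blast
    have "(1 / (2 * \<beta>)) *\<^sub>R (2 *\<^sub>R (x0 - y0)) + \<beta> *\<^sub>R ((1 / sqrt (1\<^sup>2 + (norm (x0 - 0))\<^sup>2)) *\<^sub>R (x0 - 0)) = q + \<beta> *\<^sub>R e"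
      unfolding q_def e_def N_def using \<beta> by simp
    with s1 have s1: "\<delta> * u x0 + F (q + \<beta> *\<^sub>R e) x0 \<le> 0" by simp
    have C1: "C1_with_gradient (\<lambda>y. (- 1 / (2 * \<beta>)) * (norm (y - x0))\<^sup>2) (\<lambda>y. (- 1 / (2 * \<beta>)) *\<^sub>R (2 *\<^sub>R (y - x0)))"
      by (intro C1_scale C1_square_distance)
    have "local_max_at (\<lambda>y. - (v y - (- 1 / (2 * \<beta>)) * (norm (y - x0))\<^sup>2)) y0"
    proof (rule local_max_atI)
      fix y show "- (v y - (- 1 / (2 * \<beta>)) * (norm (y - x0))\<^sup>2)
          \<le> - (v y0 - (- 1 / (2 * \<beta>)) * (norm (y0 - x0))\<^sup>2)"
        using z0[of "(x0, y)"] unfolding xy \<Phi> by (simp add: norm_minus_commute)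
    qed
    then have mn: "local_min_at (\<lambda>y. v y - (- 1 / (2 * \<beta>)) * (norm (y - x0))\<^sup>2) y0"
      by (simp only: local_min_at_uminus)
    have qeq: "(- 1 / (2 * \<beta>)) *\<^sub>R (2 *\<^sub>R (y0 - x0)) = q"
      unfolding q_def using \<beta> by (simp add: scaleR_diff_right)
    have s2: "0 \<le> \<delta> * v y0 + G q y0"
      using super C1 mn unfolding viscosity_supersolution_def qeq[symmetric] by blast
    have q: "norm q \<le> L" using test_gradient_bound_min[OF lip C1 mn] unfolding qeq .
    have "norm (x0 - y0) = \<beta> * norm q" unfolding q_def using \<beta> by simp
    then have dist: "norm (y0 - x0) \<le> L * \<beta>" using q \<beta> by (simp add: norm_minus_commute mult.commute)
    have be: "norm (\<beta> *\<^sub>R e) \<le> \<beta>" using e \<beta> by (simp add: mult_left_le)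
    have qe: "norm (q + \<beta> *\<^sub>R e) \<le> L + 1"
      using norm_triangle_ineq[of q "\<beta> *\<^sub>R e"] q be \<beta> by linarith
    have "F q y0 - F (q + \<beta> *\<^sub>R e) x0 \<le> C * (norm (q - (q + \<beta> *\<^sub>R e)) + norm (y0 - x0))"
      by (rule F) (use q qe in auto)
    also have "\<dots> \<le> C * (\<beta> + L * \<beta>)" using be dist C by (intro mult_left_mono) auto
    finally have "\<delta> * (u x0 - v y0) \<le> m + C * (\<beta> + L * \<beta>)"
      using s1 s2 G[OF q, of y0] by (simp add: algebra_simps)
    moreover have "u x - v x - \<beta> * N x \<le> u x0 - v y0"
    proof -
      have "(norm (x0 - y0))\<^sup>2 / (2 * \<beta>) \<ge> 0" "\<beta> * N x0 \<ge> 0" using \<beta> N(2)[of x0] by auto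
      then show ?thesis using z0[of "(x, x)"] unfolding xy \<Phi> by simp
    qed
    ultimately show ?thesis using \<delta> by (smt (verit) mult_left_mono)
  qed
  have inv: "(\<lambda>n. 1 / real (Suc n)) \<longlonglongrightarrow> 0" using LIMSEQ_inverse_real_of_nat by (simp add: inverse_eq_divide)
  have step: "\<delta> * (u x - v x - (1 / Suc n) * N x) \<le> m + C * (1 / Suc n + L * (1 / Suc n))" for n
    by (rule main) auto
  have "(\<lambda>n. \<delta> * (u x - v x - (1 / Suc n) * N x)) \<longlonglongrightarrow> \<delta> * (u x - v x - 0 * N x)"
    by (intro tendsto_intros inv)
  moreover have "(\<lambda>n. m + C * (1 / Suc n + L * (1 / Suc n))) \<longlonglongrightarrow> m + C * (0 + L * 0)"
    by (intro tendsto_intros inv)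
  ultimately have "\<delta> * (u x - v x - 0 * N x) \<le> m + C * (0 + L * 0)"
    by (rule LIMSEQ_le) (use step in blast)
  then show ?thesis by simp
qed

text \<open>An \<open>L\<close>-Lipschitz solution cannot detect the Hamiltonian at gradients larger than \<open>L\<close>.\<close>

lemma viscosity_solution_cong_gradient:
  fixes v :: "real^'d \<Rightarrow> real"
  assumes sol: "viscosity_solution (\<lambda>q x r. \<delta> * r + F q x) v" and lip: "L-lipschitz_on UNIV v"
    and eq: "\<And>q x. norm q \<le> L \<Longrightarrow> F q x = G q x"
  shows "viscosity_solution (\<lambda>q x r. \<delta> * r + G q x) v"
  unfolding viscosity_solution_def viscosity_subsolution_def viscosity_supersolution_def
proof (intro conjI allI impI)
  show "continuous_on UNIV v" "continuous_on UNIV v"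
    using sol unfolding viscosity_solution_def viscosity_subsolution_def by auto
next
  fix \<phi> :: "real^'d \<Rightarrow> real" and D x
  assume *: "C1_with_gradient \<phi> D \<and> local_max_at (\<lambda>y. v y - \<phi> y) x"
  then have "norm (D x) \<le> L" using test_gradient_bound[OF lip] by blast
  moreover have "\<delta> * v x + F (D x) x \<le> 0"
    using sol * unfolding viscosity_solution_def viscosity_subsolution_def by blast
  ultimately show "\<delta> * v x + G (D x) x \<le> 0" by (simp add: eq)
next
  fix \<phi> :: "real^'d \<Rightarrow> real" and D x
  assume *: "C1_with_gradient \<phi> D \<and> local_min_at (\<lambda>y. v y - \<phi> y) x"
  then have "norm (D x) \<le> L" using test_gradient_bound_min[OF lip] by blast
  moreover have "0 \<le> \<delta> * v x + F (D x) x"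
    using sol * unfolding viscosity_solution_def viscosity_supersolution_def by blast
  ultimately show "0 \<le> \<delta> * v x + G (D x) x" by (simp add: eq)
qed

section \<open>A monotone scheme and its limit\<close>

definition central_gradient :: "real \<Rightarrow> (real^'d \<Rightarrow> real) \<Rightarrow> real^'d \<Rightarrow> real^'d" where
  "central_gradient h u x = (\<chi> i. (u (x + h *\<^sub>R axis i 1) - u (x - h *\<^sub>R axis i 1)) / (2 * h))"

definition neighbour_sum :: "real \<Rightarrow> (real^'d \<Rightarrow> real) \<Rightarrow> real^'d \<Rightarrow> real" where
  "neighbour_sum h u x = (\<Sum>i\<in>UNIV. u (x + h *\<^sub>R axis i 1) + u (x - h *\<^sub>R axis i 1))"

text \<open>
  The Lax--Friedrichs discretisation of \<open>\<delta> u + F (Du, x) = 0\<close> with numerical viscosity \<open>B\<close>, solved for the value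
  at the centre: fixed points satisfy
  \<open>\<delta> u(x) + F (D\<^sub>h u(x), x) = (B/h) \<Sum>\<^sub>i (u(x + h e\<^sub>i) + u(x - h e\<^sub>i) - 2 u(x))\<close>.
  The scheme acts on functions on the whole space and not on a grid, so translations commute with it.
\<close>

definition lf_step ::
    "(real^'d \<Rightarrow> real^'d \<Rightarrow> real) \<Rightarrow> real \<Rightarrow> real \<Rightarrow> real \<Rightarrow> (real^'d \<Rightarrow> real) \<Rightarrow> real^'d \<Rightarrow> real" where
  "lf_step F B \<delta> h u x =
     (B / h * neighbour_sum h u x - F (central_gradient h u x) x) / (\<delta> + 2 * real CARD('d) * B / h)"

text \<open>The iteration starts from the constant \<open>-C/\<delta>\<close>, a discrete subsolution, and therefore increases.\<close>

definition lf_iterate ::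
    "(real^'d \<Rightarrow> real^'d \<Rightarrow> real) \<Rightarrow> real \<Rightarrow> real \<Rightarrow> real \<Rightarrow> real \<Rightarrow> nat \<Rightarrow> real^'d \<Rightarrow> real" where
  "lf_iterate F B \<delta> C h k = (lf_step F B \<delta> h ^^ k) (\<lambda>_. - C / \<delta>)"

definition lf_solution ::
    "(real^'d \<Rightarrow> real^'d \<Rightarrow> real) \<Rightarrow> real \<Rightarrow> real \<Rightarrow> real \<Rightarrow> real \<Rightarrow> real^'d \<Rightarrow> real" where
  "lf_solution F B \<delta> C h x = lim (\<lambda>k. lf_iterate F B \<delta> C h k x)"

lemma central_gradient_add_const: "central_gradient h (\<lambda>y. u y + c) = central_gradient h u"
  unfolding central_gradient_def by simp

lemma central_gradient_translate:
  "central_gradient h (\<lambda>y. u (y + z)) x = central_gradient h u (x + z)"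
  unfolding central_gradient_def by (simp add: algebra_simps)

lemma central_gradient_uminus: "central_gradient h (\<lambda>y. - u y) x = - central_gradient h u x"
  unfolding central_gradient_def vec_eq_iff by (simp add: minus_divide_left)

lemma neighbour_sum_add_const:
  "neighbour_sum h (\<lambda>y. u y + c) (x::real^'d) = neighbour_sum h u x + 2 * real CARD('d) * c"
proof -
  have "neighbour_sum h (\<lambda>y. u y + c) x
      = (\<Sum>i\<in>UNIV. (u (x + h *\<^sub>R axis i 1) + u (x - h *\<^sub>R axis i 1)) + 2 * c)"
    unfolding neighbour_sum_def by (intro sum.cong) auto
  then show ?thesis unfolding neighbour_sum_def sum.distrib by simp
qed

lemma neighbour_sum_translate:
  "neighbour_sum h (\<lambda>y. u (y + z)) x = neighbour_sum h u (x + z)"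
  unfolding neighbour_sum_def by (simp add: algebra_simps)

lemma neighbour_sum_uminus: "neighbour_sum h (\<lambda>y. - u y) x = - neighbour_sum h u x"
  unfolding neighbour_sum_def by (simp add: sum_negf[symmetric] algebra_simps)

text \<open>
  The numerical viscosity dominates: replacing \<open>u\<close> by a larger \<open>v\<close> changes \<open>F\<close> by at most \<open>B\<close> times the
  change of the difference quotient, which is at most the increase of the neighbour sum divided by \<open>h\<close>.
\<close>

lemma lf_monotone:
  fixes F :: "real^'d \<Rightarrow> real^'d \<Rightarrow> real"
  assumes B: "B > 0" and h: "h > 0"
    and F: "\<And>q q'. F q x - F q' x \<le> B * norm (q - q')"
    and le: "\<And>i. u (x + h *\<^sub>R axis i 1) \<le> v (x + h *\<^sub>R axis i 1)"
      "\<And>i. u (x - h *\<^sub>R axis i 1) \<le> v (x - h *\<^sub>R axis i 1)"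
  shows "B / h * neighbour_sum h u x - F (central_gradient h u x) x
       \<le> B / h * neighbour_sum h v x - F (central_gradient h v x) x"
proof -
  define w where "w = (\<lambda>y. v y - u y)"
  have w: "w (x + h *\<^sub>R axis i 1) \<ge> 0" "w (x - h *\<^sub>R axis i 1) \<ge> 0" for i
    unfolding w_def using le[of i] by auto
  have pos: "neighbour_sum h w x \<ge> 0" unfolding neighbour_sum_def by (intro sum_nonneg add_nonneg_nonneg w)
  have comp: "(central_gradient h v x - central_gradient h u x) $ i
      = (w (x + h *\<^sub>R axis i 1) - w (x - h *\<^sub>R axis i 1)) / (2 * h)" for i
    unfolding central_gradient_def w_def by (simp add: diff_divide_distrib[symmetric] algebra_simps)
  have "norm (central_gradient h v x - central_gradient h u x)
      \<le> (\<Sum>i\<in>UNIV. \<bar>(w (x + h *\<^sub>R axis i 1) - w (x - h *\<^sub>R axis i 1)) / (2 * h)\<bar>)"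
    using norm_le_l1_cart[of "central_gradient h v x - central_gradient h u x"] unfolding comp .
  also have "\<dots> \<le> (\<Sum>i\<in>UNIV. (w (x + h *\<^sub>R axis i 1) + w (x - h *\<^sub>R axis i 1)) / h)"
  proof (rule sum_mono)
    fix i
    have "\<bar>w (x + h *\<^sub>R axis i 1) - w (x - h *\<^sub>R axis i 1)\<bar> \<le> 2 * (w (x + h *\<^sub>R axis i 1) + w (x - h *\<^sub>R axis i 1))"
      using w[of i] by auto
    then have "\<bar>w (x + h *\<^sub>R axis i 1) - w (x - h *\<^sub>R axis i 1)\<bar> / (2 * h)
        \<le> 2 * (w (x + h *\<^sub>R axis i 1) + w (x - h *\<^sub>R axis i 1)) / (2 * h)"
      using h by (intro divide_right_mono) auto
    also have "\<dots> = (w (x + h *\<^sub>R axis i 1) + w (x - h *\<^sub>R axis i 1)) / h"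
      by (rule mult_divide_mult_cancel_left) simp
    finally show "\<bar>(w (x + h *\<^sub>R axis i 1) - w (x - h *\<^sub>R axis i 1)) / (2 * h)\<bar>
        \<le> (w (x + h *\<^sub>R axis i 1) + w (x - h *\<^sub>R axis i 1)) / h"
      using h by (simp add: abs_divide)
  qed
  also have "\<dots> = neighbour_sum h w x / h"
    unfolding neighbour_sum_def by (simp add: sum_divide_distrib)
  finally have "B * norm (central_gradient h v x - central_gradient h u x) \<le> B * (neighbour_sum h w x / h)"
    using B by (intro mult_left_mono) auto
  then have "F (central_gradient h v x) x - F (central_gradient h u x) x \<le> B / h * neighbour_sum h w x"
    using F[of "central_gradient h v x" "central_gradient h u x"] by simp
  moreover have "neighbour_sum h w x = neighbour_sum h v x - neighbour_sum h u x"
    unfolding neighbour_sum_def w_def sum_subtractf[symmetric] by (intro sum.cong) auto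
  ultimately show ?thesis by (simp add: algebra_simps)
qed

text \<open>
  Equi-Lipschitz functions converge uniformly on compact sets once they converge on a dense set. The
  one-sided form is what an upper limit provides.
\<close>

lemma eventually_uniformly_below:
  fixes f :: "nat \<Rightarrow> 'b::real_normed_vector \<Rightarrow> real"
  assumes f: "\<And>n. L-lipschitz_on UNIV (f n)" and g: "L-lipschitz_on UNIV g"
    and D: "closure D = UNIV" and K: "compact K" and e: "e > 0"
    and below: "\<And>x e. x \<in> D \<Longrightarrow> e > 0 \<Longrightarrow> eventually (\<lambda>n. f n x < g x + e) sequentially"
  shows "eventually (\<lambda>n. \<forall>x\<in>K. f n x < g x + e) sequentially"
proof -
  have L: "L \<ge> 0" using g lipschitz_on_nonneg by blast
  define r where "r = e / (8 * (L + 1))"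
  have r: "r > 0" "8 * (L * r) < e" unfolding r_def using e L by (auto simp: field_simps)
  obtain k where k: "finite k" "K \<subseteq> (\<Union>x\<in>k. ball x r)"
    using K r(1) unfolding compact_eq_totally_bounded by blast
  have "\<exists>d\<in>D. dist d x < r" for x
    using D closure_approachable r(1) by blast
  then obtain d where d: "\<And>x. d x \<in> D" "\<And>x. dist (d x) x < r" by metis
  have "eventually (\<lambda>n. \<forall>x\<in>k. f n (d x) < g (d x) + e / 2) sequentially"
    using k(1) below[OF d(1), of "e / 2"] e by (simp add: eventually_ball_finite_distrib)
  then show ?thesis
  proof (rule eventually_mono, intro ballI)
    fix n x assume n: "\<forall>x\<in>k. f n (d x) < g (d x) + e / 2" and "x \<in> K"
    then obtain c where c: "c \<in> k" "dist c x < r" using k(2) by auto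
    have "dist x (d c) \<le> 2 * r" using c(2) d(2)[of c] dist_triangle[of x "d c" c]
      by (simp add: dist_commute)
    then have *: "L * dist x (d c) \<le> L * (2 * r)" using L by (rule mult_left_mono)
    have "\<bar>f n x - f n (d c)\<bar> \<le> L * dist x (d c)"
      using lipschitz_onD[OF f, of x "d c" n] by (simp add: dist_real_def)
    moreover have "\<bar>g x - g (d c)\<bar> \<le> L * dist x (d c)"
      using lipschitz_onD[OF g, of x "d c"] by (simp add: dist_real_def)
    moreover have "f n (d c) < g (d c) + e / 2" using n c by blast
    ultimately show "f n x < g x + e" using * r(2) by (simp add: abs_le_iff)
  qed
qed

lemma C1_linear_approximation:
  fixes \<psi> :: "real^'d \<Rightarrow> real"
  assumes C1: "C1_with_gradient \<psi> P" and P: "\<And>y. y \<in> cball x0 r \<Longrightarrow> norm (P y - p) \<le> e"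
    and "x \<in> cball x0 r" "y \<in> cball x0 r"
  shows "\<bar>\<psi> y - \<psi> x - (y - x) \<bullet> p\<bar> \<le> e * norm (y - x)"
proof -
  have "norm ((\<psi> y - y \<bullet> p) - (\<psi> x - x \<bullet> p)) \<le> e * norm (y - x)"
  proof (rule differentiable_bound[of "cball x0 r" _ "\<lambda>y h. h \<bullet> (P y - p)"])
    fix y assume y: "y \<in> cball x0 r"
    have "(\<psi> has_derivative (\<lambda>h. h \<bullet> P y)) (at y)"
      using C1 unfolding C1_with_gradient_def gderiv_def by auto
    then have "((\<lambda>y. \<psi> y - y \<bullet> p) has_derivative (\<lambda>h. h \<bullet> (P y - p))) (at y)"
      unfolding inner_diff_right by (intro derivative_intros)
    then show "((\<lambda>y. \<psi> y - y \<bullet> p) has_derivative (\<lambda>h. h \<bullet> (P y - p))) (at y within cball x0 r)"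
      by (rule has_derivative_at_withinI)
    show "onorm (\<lambda>h. h \<bullet> (P y - p)) \<le> e"
    proof (rule onorm_le)
      fix h show "norm (h \<bullet> (P y - p)) \<le> e * norm h"
        using Cauchy_Schwarz_ineq2[of h "P y - p"] P[OF y]
        by (smt (verit) mult.commute mult_right_mono norm_ge_zero real_norm_def)
    qed
  qed (use assms in auto)
  then show ?thesis by (simp add: inner_diff_left algebra_simps)
qed

text \<open>The real upper limit as a relation, in the form in which its two halves are applied.\<close>

definition is_limsup :: "(nat \<Rightarrow> real) \<Rightarrow> real \<Rightarrow> bool" where
  "is_limsup a l \<longleftrightarrow> (\<forall>e>0. eventually (\<lambda>n. a n < l + e) sequentially) \<and>
                    (\<forall>e>0. frequently (\<lambda>n. a n > l - e) sequentially)"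

lemma is_limsup_exists:
  assumes "\<And>n. \<bar>a n\<bar> \<le> (C::real)"
  shows "\<exists>l. is_limsup a l"
proof -
  have le: "limsup (\<lambda>n. ereal (a n)) \<le> ereal C"
    by (rule Limsup_bounded) (use assms in \<open>auto simp: abs_le_iff\<close>)
  have "a n \<ge> - C" for n using assms[of n] by simp
  then have "liminf (\<lambda>n. ereal (a n)) \<ge> ereal (- C)"
    by (intro Liminf_bounded) auto
  then have ge: "limsup (\<lambda>n. ereal (a n)) \<ge> ereal (- C)"
    using Liminf_le_Limsup[of sequentially "\<lambda>n. ereal (a n)"] by (simp add: order_trans)
  obtain l where l: "limsup (\<lambda>n. ereal (a n)) = ereal l"
    using le ge by (cases "limsup (\<lambda>n. ereal (a n))") auto
  have "eventually (\<lambda>n. a n < l + e) sequentially" if "e > 0" for e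
  proof -
    have "limsup (\<lambda>n. ereal (a n)) < ereal (l + e)" using l that by simp
    from Limsup_lessD[OF this] show ?thesis by simp
  qed
  moreover have "frequently (\<lambda>n. a n > l - e) sequentially" if "e > 0" for e
  proof (rule ccontr)
    assume "\<not> ?thesis"
    then have "eventually (\<lambda>n. ereal (a n) \<le> ereal (l - e)) sequentially"
      by (simp add: frequently_def not_less)
    then have "limsup (\<lambda>n. ereal (a n)) \<le> ereal (l - e)" by (rule Limsup_bounded)
    then show False using l that by simp
  qed
  ultimately show ?thesis unfolding is_limsup_def by blast
qed

lemma is_limsup_lipschitz:
  fixes U :: "nat \<Rightarrow> 'b::real_normed_vector \<Rightarrow> real"
  assumes U: "\<And>n. L-lipschitz_on UNIV (U n)" and lim: "\<And>x. is_limsup (\<lambda>n. U n x) (w x)"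
  shows "L-lipschitz_on UNIV w"
proof (rule lipschitz_of_difference)
  show "L \<ge> 0" using U lipschitz_on_nonneg by blast
  fix x y
  show "w x - w y \<le> L * norm (x - y)"
  proof (rule field_le_epsilon)
    fix e :: real assume "e > 0"
    then have 1: "frequently (\<lambda>n. U n x > w x - e / 2) sequentially"
      and 2: "eventually (\<lambda>n. U n y < w y + e / 2) sequentially"
      using lim[of x] lim[of y] unfolding is_limsup_def by auto
    obtain n where n: "U n x > w x - e / 2" "U n y < w y + e / 2"
      using frequently_ex[OF frequently_eventually_frequently[OF 1 2]] by auto
    have "\<bar>U n x - U n y\<bar> \<le> L * norm (x - y)"
      using lipschitz_onD[OF U, of x y n] by (simp add: dist_real_def dist_norm)
    then show "w x - w y \<le> L * norm (x - y) + e" using n by (simp add: abs_le_iff)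
  qed
qed

text \<open>
  Monotone consistent schemes converge to subsolutions, by the argument of Barles and Souganidis. Because the
  discrete functions are equi-Lipschitz, the pointwise upper limit already equals the relaxed one. Adding
  \<open>\<bar>x - x0\<bar>\<^sup>2\<close> to the test function makes the maximum strict, so the discrete functions touch a translate of the
  test function from below close to \<open>x0\<close>. Monotonicity puts the test function into the scheme, where the
  viscosity term vanishes as \<open>h \<rightarrow> 0\<close> because first-order differences on both sides of a point cancel.
\<close>

lemma lf_limsup_subsolution:
  fixes F :: "real^'d \<Rightarrow> real^'d \<Rightarrow> real" and U :: "nat \<Rightarrow> real^'d \<Rightarrow> real"
  assumes B: "B > 0" and \<delta>: "\<delta> > 0"
    and F: "\<And>q q' x x'. F q x - F q' x' \<le> B * (norm (q - q') + norm (x - x'))"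
    and h: "\<And>n. h n > 0" "h \<longlonglongrightarrow> 0"
    and U: "\<And>n. L-lipschitz_on UNIV (U n)"
    and scheme: "\<And>n x. (\<delta> + 2 * real CARD('d) * B / h n) * U n x
        \<le> B / h n * neighbour_sum (h n) (U n) x - F (central_gradient (h n) (U n) x) x"
    and lim: "\<And>x. is_limsup (\<lambda>n. U n x) (w x)"
  shows "viscosity_subsolution (\<lambda>q x r. \<delta> * r + F q x) w"
  unfolding viscosity_subsolution_def
proof (intro conjI allI impI)
  have wL: "L-lipschitz_on UNIV w" using is_limsup_lipschitz[OF U lim] .
  then show "continuous_on UNIV w" by (rule lipschitz_on_continuous_on)
  have L: "L \<ge> 0" using wL lipschitz_on_nonneg by blast
  fix \<phi> G x0 assume "C1_with_gradient \<phi> G \<and> local_max_at (\<lambda>y. w y - \<phi> y) x0"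
  then have C1\<phi>: "C1_with_gradient \<phi> G" and mx: "local_max_at (\<lambda>y. w y - \<phi> y) x0" by auto
  obtain e0 where e0: "e0 > 0" "\<And>y. dist x0 y < e0 \<Longrightarrow> w y - \<phi> y \<le> w x0 - \<phi> x0"
    using mx unfolding local_max_at_def by auto
  define \<psi> where "\<psi> = (\<lambda>x. \<phi> x + (norm (x - x0))\<^sup>2)"
  define P where "P = (\<lambda>x. G x + 2 *\<^sub>R (x - x0))"
  have C1: "C1_with_gradient \<psi> P" unfolding \<psi>_def P_def by (intro C1_add C1\<phi> C1_square_distance)
  have Px0: "P x0 = G x0" unfolding P_def by simp
  have cP: "isCont P x0" and c\<psi>: "continuous_on UNIV \<psi>"
    using C1 unfolding C1_with_gradient_def gderiv_def
    by (auto simp: continuous_on_eq_continuous_at intro: has_derivative_continuous)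
  define d where "d = real CARD('d)"
  have bound: "\<delta> * w x0 + F (G x0) x0 \<le> (\<delta> * (1 + L) + B * (d + 1) + 2 * B * d) * \<eta>" if \<eta>: "\<eta> > 0" for \<eta>
  proof -
    obtain s where s: "s > 0" "\<And>y. dist y x0 < s \<Longrightarrow> norm (P y - P x0) < \<eta>"
      using cP \<eta> unfolding continuous_at_eps_delta dist_norm by blast
    define r where "r = min \<eta> (min (s / 2) (e0 / 2))"
    have r: "r > 0" "r \<le> \<eta>" "r < s" "r < e0" unfolding r_def using \<eta> s e0 by auto
    have Pr: "norm (P y - P x0) \<le> \<eta>" if "y \<in> cball x0 r" for y
      using s(2)[of y] that r by (simp add: dist_commute less_imp_le)
    \<comment> \<open>An error \<open>\<mu>\<close> at the centre and on the ball confines the discrete maximum to the ball of radius \<open>r/2\<close>,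
      which leaves room for the neighbours at distance \<open>h n < r/2\<close>.\<close>
    define \<mu> where "\<mu> = min \<eta> (r\<^sup>2 / 12)"
    have \<mu>: "\<mu> > 0" "\<mu> \<le> \<eta>" "\<mu> \<le> r\<^sup>2 / 12" unfolding \<mu>_def using \<eta> r by auto
    have "eventually (\<lambda>n. \<forall>x\<in>cball x0 r. U n x < w x + \<mu>) sequentially"
      by (rule eventually_uniformly_below[OF U wL, of UNIV])
         (use lim \<mu> in \<open>auto simp: is_limsup_def\<close>)
    moreover have "eventually (\<lambda>n. h n < r / 2) sequentially"
      using order_tendstoD(2)[OF h(2), of "r / 2"] r by simp
    ultimately have ev: "eventually (\<lambda>n. (\<forall>x\<in>cball x0 r. U n x < w x + \<mu>) \<and> h n < r / 2) sequentially"
      by (rule eventually_conj)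
    have "frequently (\<lambda>n. U n x0 > w x0 - \<mu>) sequentially"
      using lim \<mu> unfolding is_limsup_def by blast
    from frequently_ex[OF frequently_eventually_frequently[OF this ev]]
    obtain n where n1: "U n x0 > w x0 - \<mu>" and n2: "\<And>x. x \<in> cball x0 r \<Longrightarrow> U n x < w x + \<mu>"
      and n3: "h n < r / 2" by auto
    have "continuous_on (cball x0 r) (\<lambda>y. U n y - \<psi> y)"
      using lipschitz_on_continuous_on[OF U] c\<psi>
      by (intro continuous_on_diff) (auto intro: continuous_on_subset)
    then obtain x where x: "x \<in> cball x0 r" "\<And>y. y \<in> cball x0 r \<Longrightarrow> U n y - \<psi> y \<le> U n x - \<psi> x"
      using continuous_attains_sup[of "cball x0 r" "\<lambda>y. U n y - \<psi> y"] r by auto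
    have "w x - \<phi> x \<le> w x0 - \<phi> x0" using e0(2)[of x] x(1) r by simp
    moreover have "U n x0 - \<psi> x0 \<le> U n x - \<psi> x" using x(2) r by simp
    moreover have "U n x < w x + \<mu>" using n2 x by simp
    ultimately have "(norm (x - x0))\<^sup>2 < 2 * \<mu>" using n1 unfolding \<psi>_def by simp
    also have "\<dots> \<le> (r / 2)\<^sup>2" using \<mu>(1,3) by (simp add: power_divide)
    finally have xr: "norm (x - x0) < r / 2" by (rule power2_less_imp_less) (use r in simp)
    have nb: "x + h n *\<^sub>R axis i 1 \<in> cball x0 r" "x - h n *\<^sub>R axis i 1 \<in> cball x0 r" for i
    proof -
      have "norm (h n *\<^sub>R axis i (1::real)) \<le> r / 2" using n3 h(1)[of n] by simp
      moreover have "norm (x0 - x) < r / 2" using xr by (simp add: norm_minus_commute)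
      ultimately have "norm ((x0 - x) - h n *\<^sub>R axis i 1) \<le> r" "norm ((x0 - x) + h n *\<^sub>R axis i 1) \<le> r"
        using norm_triangle_ineq[of "x0 - x" "h n *\<^sub>R axis i 1"]
          norm_triangle_ineq4[of "x0 - x" "h n *\<^sub>R axis i 1"] by linarith+
      then show "x + h n *\<^sub>R axis i 1 \<in> cball x0 r" "x - h n *\<^sub>R axis i 1 \<in> cball x0 r"
        unfolding mem_cball dist_norm by (simp_all add: algebra_simps)
    qed
    define H where "H = h n"
    have H: "H > 0" unfolding H_def by (rule h)
    define c where "c = U n x - \<psi> x"
    have "(\<delta> + 2 * real CARD('d) * B / H) * U n x
        \<le> B / H * neighbour_sum H (U n) x - F (central_gradient H (U n) x) x"
      unfolding H_def by (rule scheme)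
    also have "\<dots> \<le> B / H * neighbour_sum H (\<lambda>y. \<psi> y + c) x - F (central_gradient H (\<lambda>y. \<psi> y + c) x) x"
    proof (rule lf_monotone[OF B H])
      show "F q x - F q' x \<le> B * norm (q - q')" for q q' using F[of q x q' x] by simp
      show "U n (x + H *\<^sub>R axis i 1) \<le> \<psi> (x + H *\<^sub>R axis i 1) + c"
        "U n (x - H *\<^sub>R axis i 1) \<le> \<psi> (x - H *\<^sub>R axis i 1) + c" for i
        using x(2)[OF nb(1)[of i]] x(2)[OF nb(2)[of i]] unfolding c_def H_def by auto
    qed
    finally have key: "(\<delta> + 2 * d * B / H) * U n x
        \<le> B / H * (neighbour_sum H \<psi> x + 2 * d * c) - F (central_gradient H \<psi> x) x"
      unfolding neighbour_sum_add_const central_gradient_add_const d_def .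
    have lin: "\<bar>\<psi> y - \<psi> x - (y - x) \<bullet> P x0\<bar> \<le> \<eta> * norm (y - x)" if "y \<in> cball x0 r" for y
      using C1_linear_approximation[OF C1 Pr x(1) that] by simp
    have plus: "\<bar>\<psi> (x + H *\<^sub>R axis i 1) - \<psi> x - H * P x0 $ i\<bar> \<le> \<eta> * H"
      and minus: "\<bar>\<psi> (x - H *\<^sub>R axis i 1) - \<psi> x + H * P x0 $ i\<bar> \<le> \<eta> * H" for i
      using lin[OF nb(1)[of i]] lin[OF nb(2)[of i]] H unfolding H_def[symmetric]
      by (auto simp: inner_axis inner_axis' )
    have "neighbour_sum H \<psi> x \<le> (\<Sum>i\<in>(UNIV::'d set). 2 * \<psi> x + 2 * (\<eta> * H))"
      unfolding neighbour_sum_def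
    proof (rule sum_mono)
      fix i show "\<psi> (x + H *\<^sub>R axis i 1) + \<psi> (x - H *\<^sub>R axis i 1) \<le> 2 * \<psi> x + 2 * (\<eta> * H)"
        using plus[of i] minus[of i] by (simp add: abs_le_iff)
    qed
    then have "neighbour_sum H \<psi> x + 2 * d * c \<le> 2 * d * U n x + 2 * d * \<eta> * H"
      unfolding c_def d_def by (simp add: algebra_simps)
    then have "B / H * (neighbour_sum H \<psi> x + 2 * d * c) \<le> B / H * (2 * d * U n x + 2 * d * \<eta> * H)"
      using B H by (intro mult_left_mono) auto
    also have "\<dots> = 2 * d * B / H * U n x + 2 * B * d * \<eta>" using H by (simp add: field_simps)
    finally have key2: "\<delta> * U n x + F (central_gradient H \<psi> x) x \<le> 2 * B * d * \<eta>"
      using key by (simp add: algebra_simps)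
    have "norm (P x0 - central_gradient H \<psi> x) \<le> (\<Sum>i\<in>UNIV. \<bar>(P x0 - central_gradient H \<psi> x) $ i\<bar>)"
      by (rule norm_le_l1_cart)
    also have "\<dots> \<le> (\<Sum>i\<in>(UNIV::'d set). \<eta>)"
    proof (rule sum_mono)
      fix i
      have "\<bar>2 * H * P x0 $ i - (\<psi> (x + H *\<^sub>R axis i 1) - \<psi> (x - H *\<^sub>R axis i 1))\<bar> \<le> \<eta> * (2 * H)"
        using plus[of i] minus[of i] by (simp add: abs_le_iff)
      moreover have "(P x0 - central_gradient H \<psi> x) $ i
          = (2 * H * P x0 $ i - (\<psi> (x + H *\<^sub>R axis i 1) - \<psi> (x - H *\<^sub>R axis i 1))) / (2 * H)"
        unfolding central_gradient_def using H by (simp add: field_simps)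
      ultimately show "\<bar>(P x0 - central_gradient H \<psi> x) $ i\<bar> \<le> \<eta>"
        using H by (simp only: abs_divide) (simp add: pos_divide_le_eq)
    qed
    finally have "norm (P x0 - central_gradient H \<psi> x) \<le> d * \<eta>" unfolding d_def by simp
    moreover have "norm (x0 - x) \<le> \<eta>" using xr r by (simp add: norm_minus_commute)
    ultimately have "norm (P x0 - central_gradient H \<psi> x) + norm (x0 - x) \<le> (d + 1) * \<eta>"
      by (simp add: algebra_simps)
    then have "B * (norm (P x0 - central_gradient H \<psi> x) + norm (x0 - x)) \<le> B * ((d + 1) * \<eta>)"
      using B by (intro mult_left_mono) auto
    then have Fb: "F (G x0) x0 \<le> F (central_gradient H \<psi> x) x + B * (d + 1) * \<eta>"
      using F[of "P x0" x0 "central_gradient H \<psi> x" x] unfolding Px0 by simp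
    have "\<bar>U n x0 - U n x\<bar> \<le> L * norm (x0 - x)"
      using lipschitz_onD[OF U, of x0 x n] by (simp add: dist_real_def dist_norm)
    also have "\<dots> \<le> L * \<eta>" using L \<open>norm (x0 - x) \<le> \<eta>\<close> by (rule mult_left_mono[rotated])
    finally have "w x0 \<le> U n x + (1 + L) * \<eta>" using n1 \<mu> by (simp add: abs_le_iff algebra_simps)
    then have "\<delta> * w x0 \<le> \<delta> * (U n x + (1 + L) * \<eta>)" using \<delta> by simp
    then show ?thesis using key2 Fb by (simp add: algebra_simps)
  qed
  define K where "K = \<delta> * (1 + L) + B * (d + 1) + 2 * B * d"
  have K: "K > 0" unfolding K_def d_def using \<delta> B L by (simp add: add_pos_nonneg)
  show "\<delta> * w x0 + F (G x0) x0 \<le> 0"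
  proof (rule field_le_epsilon)
    fix e :: real assume "e > 0"
    then show "\<delta> * w x0 + F (G x0) x0 \<le> 0 + e"
      using bound[of "e / K"] K unfolding K_def[symmetric] by simp
  qed
qed

lemma is_limsup_bound:
  assumes lim: "is_limsup a l" and bound: "\<And>n. \<bar>a n\<bar> \<le> C"
  shows "\<bar>l\<bar> \<le> C"
proof -
  have "l \<le> C + e" if "e > 0" for e
  proof -
    have "frequently (\<lambda>n. a n > l - e) sequentially"
      using lim that unfolding is_limsup_def by blast
    then obtain n where "a n > l - e" using frequently_ex by blast
    then show ?thesis using bound[of n] by (simp add: abs_le_iff)
  qed
  moreover have "- C \<le> l + e" if "e > 0" for e
  proof -
    have "eventually (\<lambda>n. a n < l + e) sequentially"
      using lim that unfolding is_limsup_def by blast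
    then obtain n where "a n < l + e" using eventually_happens'[OF sequentially_bot] by blast
    then show ?thesis using bound[of n] by (simp add: abs_le_iff)
  qed
  ultimately have "l \<le> C" "- C \<le> l" by (auto intro: field_le_epsilon)
  then show ?thesis by (simp add: abs_le_iff)
qed

section \<open>Existence by the scheme\<close>

text \<open>A globally Lipschitz Hamiltonian; the truncation of \<open>H\<close> to a ball of gradients will be one.\<close>

locale lipschitz_hamilton_jacobi =
  fixes F :: "real^'d \<Rightarrow> real^'d \<Rightarrow> real" and B \<delta> C :: real
  assumes B: "B > 0" and \<delta>: "\<delta> > 0"
    and F: "\<And>q q' x x'. F q x - F q' x' \<le> B * (norm (q - q') + norm (x - x'))"
    and F0: "\<And>x. \<bar>F 0 x\<bar> \<le> C"
begin

lemma C_nonneg: "C \<ge> 0"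
  using F0[of 0] by linarith

lemma lf_step_mono:
  assumes h: "h > 0" and le: "\<And>y. u y \<le> v y"
  shows "lf_step F B \<delta> h u x \<le> lf_step F B \<delta> h v x"
  unfolding lf_step_def
proof (rule divide_right_mono)
  show "B / h * neighbour_sum h u x - F (central_gradient h u x) x
      \<le> B / h * neighbour_sum h v x - F (central_gradient h v x) x"
  proof (rule lf_monotone[OF B h])
    show "F q x - F q' x \<le> B * norm (q - q')" for q q' using F[of q x q' x] by simp
  qed (simp_all add: le)
  show "0 \<le> \<delta> + 2 * real CARD('d) * B / h" using \<delta> B h by simp
qed

lemma lf_step_add_const:
  assumes h: "h > 0"
  shows "lf_step F B \<delta> h (\<lambda>y. u y + c) x
       = lf_step F B \<delta> h u x + c - \<delta> * c / (\<delta> + 2 * real CARD('d) * B / h)"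
proof -
  define S where "S = \<delta> + 2 * real CARD('d) * B / h"
  have S: "S > 0" unfolding S_def using \<delta> B h by (simp add: add_pos_nonneg)
  have "B / h * (neighbour_sum h u x + 2 * real CARD('d) * c)
      = B / h * neighbour_sum h u x + (S - \<delta>) * c"
    unfolding S_def by (simp add: algebra_simps)
  then show ?thesis
    unfolding lf_step_def neighbour_sum_add_const central_gradient_add_const S_def[symmetric]
    using S by (simp add: diff_divide_distrib add_divide_distrib left_diff_distrib)
qed

lemma lf_step_const:
  assumes h: "h > 0"
  shows "lf_step F B \<delta> h (\<lambda>_. c) x = c - (\<delta> * c + F 0 x) / (\<delta> + 2 * real CARD('d) * B / h)"
proof -
  have "lf_step F B \<delta> h (\<lambda>_. 0) x = - F 0 x / (\<delta> + 2 * real CARD('d) * B / h)"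
    unfolding lf_step_def neighbour_sum_def central_gradient_def by (simp add: zero_vec_def)
  then show ?thesis
    using lf_step_add_const[OF h, of "\<lambda>_. 0" c x] by (simp add: add_divide_distrib)
qed

lemma lf_step_le_const: "h > 0 \<Longrightarrow> lf_step F B \<delta> h (\<lambda>_. C / \<delta>) x \<le> C / \<delta>"
  using F0[of x] \<delta> B by (simp add: lf_step_const abs_le_iff)

lemma lf_step_ge_const: "h > 0 \<Longrightarrow> - C / \<delta> \<le> lf_step F B \<delta> h (\<lambda>_. - C / \<delta>) x"
proof -
  assume h: "h > 0"
  have "(- C + F 0 x) / (\<delta> + 2 * real CARD('d) * B / h) \<le> 0"
    using F0[of x] \<delta> B h by (intro divide_nonpos_nonneg) auto
  then show ?thesis using \<delta> by (simp add: lf_step_const[OF h])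
qed

text \<open>
  Translating \<open>u\<close> by \<open>z\<close> changes it by at most \<open>c = (B/\<delta>) \<bar>z\<bar>\<close> and the equation by at most \<open>B \<bar>z\<bar>\<close>. A step
  contracts the constant \<open>c\<close> by \<open>\<delta> c / S\<close>, which is exactly the second error divided by \<open>S\<close>.
\<close>

lemma lf_step_lipschitz:
  assumes h: "h > 0" and u: "(B / \<delta>)-lipschitz_on UNIV u"
  shows "(B / \<delta>)-lipschitz_on UNIV (lf_step F B \<delta> h u)"
proof (rule lipschitz_of_difference)
  show "B / \<delta> \<ge> 0" using B \<delta> by simp
  fix x y :: "real^'d"
  define S where "S = \<delta> + 2 * real CARD('d) * B / h"
  have S: "S > 0" unfolding S_def using \<delta> B h by (simp add: add_pos_nonneg)
  define z where "z = x - y"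
  define c where "c = B / \<delta> * norm z"
  have x: "x = y + z" unfolding z_def by simp
  define u' where "u' = (\<lambda>t. u (t + z))"
  define q where "q = central_gradient h u' y"
  have "lf_step F B \<delta> h u x = (B / h * neighbour_sum h u' y - F q x) / S"
    unfolding lf_step_def S_def u'_def q_def neighbour_sum_translate central_gradient_translate x by simp
  also have "\<dots> = lf_step F B \<delta> h u' y + (F q y - F q x) / S"
    unfolding lf_step_def S_def q_def by (simp add: diff_divide_distrib)
  also have "\<dots> \<le> lf_step F B \<delta> h u' y + B * norm z / S"
  proof -
    have "F q y - F q x \<le> B * norm z" using F[of q y q x] unfolding z_def by (simp add: norm_minus_commute)
    then show ?thesis using S by (simp add: divide_right_mono)
  qed
  also have "lf_step F B \<delta> h u' y \<le> lf_step F B \<delta> h (\<lambda>t. u t + c) y"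
  proof (rule lf_step_mono[OF h])
    fix t
    have "\<bar>u (t + z) - u t\<bar> \<le> c"
      using lipschitz_onD[OF u, of "t + z" t] unfolding c_def by (simp add: dist_real_def dist_norm)
    then show "u' t \<le> u t + c" unfolding u'_def by simp
  qed
  also have "\<dots> = lf_step F B \<delta> h u y + c - \<delta> * c / S" unfolding S_def by (rule lf_step_add_const[OF h])
  also have "\<delta> * c / S = B * norm z / S" unfolding c_def using \<delta> by simp
  finally show "lf_step F B \<delta> h u x - lf_step F B \<delta> h u y \<le> B / \<delta> * norm (x - y)"
    unfolding c_def z_def by simp
qed

lemma lf_iterate_Suc: "lf_iterate F B \<delta> C h (Suc k) = lf_step F B \<delta> h (lf_iterate F B \<delta> C h k)"
  unfolding lf_iterate_def by simp

lemma lf_iterate_upper: "h > 0 \<Longrightarrow> lf_iterate F B \<delta> C h k x \<le> C / \<delta>"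
proof (induction k arbitrary: x)
  case 0
  then show ?case using C_nonneg \<delta> unfolding lf_iterate_def by (simp add: divide_nonneg_pos)
next
  case (Suc k)
  have "lf_iterate F B \<delta> C h (Suc k) x \<le> lf_step F B \<delta> h (\<lambda>_. C / \<delta>) x"
    unfolding lf_iterate_Suc by (rule lf_step_mono) (use Suc in auto)
  also have "\<dots> \<le> C / \<delta>" by (rule lf_step_le_const) (rule Suc.prems)
  finally show ?case .
qed

lemma lf_iterate_mono_Suc: "h > 0 \<Longrightarrow> lf_iterate F B \<delta> C h k x \<le> lf_iterate F B \<delta> C h (Suc k) x"
proof (induction k arbitrary: x)
  case 0
  then show ?case using lf_step_ge_const unfolding lf_iterate_Suc by (simp add: lf_iterate_def)
next
  case (Suc k)
  then show ?case
    unfolding lf_iterate_Suc[of h "Suc k"] lf_iterate_Suc[of h k]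
    by (intro lf_step_mono) (auto simp: lf_iterate_Suc)
qed

lemma lf_iterate_lower: "h > 0 \<Longrightarrow> - C / \<delta> \<le> lf_iterate F B \<delta> C h k x"
proof (induction k)
  case 0
  then show ?case unfolding lf_iterate_def by simp
next
  case (Suc k)
  then show ?case using lf_iterate_mono_Suc[of h k x] by simp
qed

lemma lf_iterate_lipschitz: "h > 0 \<Longrightarrow> (B / \<delta>)-lipschitz_on UNIV (lf_iterate F B \<delta> C h k)"
proof (induction k)
  case 0
  have "lf_iterate F B \<delta> C h 0 = (\<lambda>_. - C / \<delta>)" unfolding lf_iterate_def by simp
  then show ?case using B \<delta> by (simp add: lipschitz_on_def)
next
  case (Suc k)
  then show ?case unfolding lf_iterate_Suc by (intro lf_step_lipschitz)
qed

lemma lf_iterate_tendsto: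
  assumes h: "h > 0"
  shows "(\<lambda>k. lf_iterate F B \<delta> C h k x) \<longlonglongrightarrow> lf_solution F B \<delta> C h x"
proof -
  have inc: "incseq (\<lambda>k. lf_iterate F B \<delta> C h k x)"
    by (rule incseq_SucI) (rule lf_iterate_mono_Suc[OF h])
  obtain l where "(\<lambda>k. lf_iterate F B \<delta> C h k x) \<longlonglongrightarrow> l"
    by (rule incseq_convergent[OF inc, of "C / \<delta>"]) (use lf_iterate_upper[OF h] in auto)
  then show ?thesis unfolding lf_solution_def by (simp add: limI)
qed

lemma lf_solution_bound:
  assumes h: "h > 0"
  shows "\<bar>lf_solution F B \<delta> C h x\<bar> \<le> C / \<delta>"
proof -
  have "lf_solution F B \<delta> C h x \<le> C / \<delta>"
    by (rule LIMSEQ_le_const2[OF lf_iterate_tendsto[OF h]]) (use lf_iterate_upper[OF h] in blast)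
  moreover have "- C / \<delta> \<le> lf_solution F B \<delta> C h x"
    by (rule LIMSEQ_le_const[OF lf_iterate_tendsto[OF h]]) (use lf_iterate_lower[OF h] in blast)
  ultimately show ?thesis by (simp add: abs_le_iff)
qed

lemma lf_solution_lipschitz:
  assumes h: "h > 0"
  shows "(B / \<delta>)-lipschitz_on UNIV (lf_solution F B \<delta> C h)"
proof (rule lipschitz_of_difference)
  show "B / \<delta> \<ge> 0" using B \<delta> by simp
  fix x y
  have "(\<lambda>k. lf_iterate F B \<delta> C h k x - lf_iterate F B \<delta> C h k y) \<longlonglongrightarrow>
      lf_solution F B \<delta> C h x - lf_solution F B \<delta> C h y"
    by (intro tendsto_diff lf_iterate_tendsto[OF h])
  moreover have "lf_iterate F B \<delta> C h k x - lf_iterate F B \<delta> C h k y \<le> B / \<delta> * norm (x - y)" for k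
    using lipschitz_onD[OF lf_iterate_lipschitz[OF h], of x y k] by (simp add: dist_real_def dist_norm)
  ultimately show "lf_solution F B \<delta> C h x - lf_solution F B \<delta> C h y \<le> B / \<delta> * norm (x - y)"
    by (blast intro: LIMSEQ_le_const2)
qed

lemma continuous_F: "continuous_on UNIV (\<lambda>q. F q x)"
proof (rule lipschitz_on_continuous_on[of B], rule lipschitz_of_difference)
  show "F q x - F q' x \<le> B * norm (q - q')" for q q' using F[of q x q' x] by simp
qed (use B in simp)

lemma lf_solution_fixed_point:
  assumes h: "h > 0"
  shows "(\<delta> + 2 * real CARD('d) * B / h) * lf_solution F B \<delta> C h x
      = B / h * neighbour_sum h (lf_solution F B \<delta> C h) x
        - F (central_gradient h (lf_solution F B \<delta> C h) x) x"
proof -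
  define S where "S = \<delta> + 2 * real CARD('d) * B / h"
  have S: "S > 0" unfolding S_def using \<delta> B h by (simp add: add_pos_nonneg)
  let ?u = "\<lambda>k. lf_iterate F B \<delta> C h k" and ?U = "lf_solution F B \<delta> C h"
  have 1: "(\<lambda>k. neighbour_sum h (?u k) x) \<longlonglongrightarrow> neighbour_sum h ?U x"
    unfolding neighbour_sum_def by (intro tendsto_intros lf_iterate_tendsto[OF h])
  have 2: "(\<lambda>k. central_gradient h (?u k) x) \<longlonglongrightarrow> central_gradient h ?U x"
    unfolding central_gradient_def using h
    by (intro vec_tendstoI) (auto intro!: tendsto_intros lf_iterate_tendsto[OF h])
  have "(\<lambda>k. F (central_gradient h (?u k) x) x) \<longlonglongrightarrow> F (central_gradient h ?U x) x"
    by (rule continuous_on_tendsto_compose[OF continuous_F 2]) auto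
  then have "(\<lambda>k. lf_step F B \<delta> h (?u k) x) \<longlonglongrightarrow> lf_step F B \<delta> h ?U x"
    unfolding lf_step_def S_def[symmetric] using S by (intro tendsto_intros 1) auto
  then have "(\<lambda>k. ?u (Suc k) x) \<longlonglongrightarrow> lf_step F B \<delta> h ?U x" unfolding lf_iterate_Suc .
  moreover have "(\<lambda>k. ?u (Suc k) x) \<longlonglongrightarrow> ?U x"
    using lf_iterate_tendsto[OF h, of x] by (rule LIMSEQ_Suc)
  ultimately have "?U x = lf_step F B \<delta> h ?U x" by (rule LIMSEQ_unique[rotated])
  then show ?thesis unfolding lf_step_def S_def[symmetric] using S by (simp add: field_simps)
qed

text \<open>
  The upper limit is a subsolution. Applied to \<open>-u\<close> and \<open>-F (-q, x)\<close>, the same fact makes the lower limit a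
  supersolution. Comparison then forces the two to agree, so the whole sequence converges, without
  extraction of a subsequence. Convergence of the whole sequence is what makes the limit measurable in a parameter.
\<close>

lemma lf_convergence:
  obtains v where
    "\<And>x. (\<lambda>n. lf_solution F B \<delta> C (1 / real (Suc n)) x) \<longlonglongrightarrow> v x"
    "viscosity_solution (\<lambda>q x r. \<delta> * r + F q x) v"
    "(B / \<delta>)-lipschitz_on UNIV v" "\<And>x. \<bar>\<delta> * v x\<bar> \<le> C"
proof -
  define h where "h = (\<lambda>n. 1 / real (Suc n))"
  define U where "U = (\<lambda>n. lf_solution F B \<delta> C (h n))"
  have h: "h n > 0" for n unfolding h_def by simp
  have h0: "h \<longlonglongrightarrow> 0" unfolding h_def using LIMSEQ_inverse_real_of_nat by (simp add: inverse_eq_divide)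
  have UL: "(B / \<delta>)-lipschitz_on UNIV (U n)" for n
    unfolding U_def by (rule lf_solution_lipschitz[OF h])
  have Ub: "\<bar>U n x\<bar> \<le> C / \<delta>" for n x unfolding U_def by (rule lf_solution_bound[OF h])
  have Ueq: "(\<delta> + 2 * real CARD('d) * B / h n) * U n x
      = B / h n * neighbour_sum (h n) (U n) x - F (central_gradient (h n) (U n) x) x" for n x
    unfolding U_def by (rule lf_solution_fixed_point[OF h])
  define U' where "U' = (\<lambda>n x. - U n x)"
  have UL': "(B / \<delta>)-lipschitz_on UNIV (U' n)" for n
    using UL[of n] unfolding U'_def by (simp add: lipschitz_on_def dist_real_def abs_minus_commute)
  have "\<exists>w. \<forall>x. is_limsup (\<lambda>n. U n x) (w x)"
    using is_limsup_exists[of "\<lambda>n. U n _", OF Ub] by metis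
  then obtain w where w: "\<And>x. is_limsup (\<lambda>n. U n x) (w x)" by blast
  have Ub': "\<bar>U' n x\<bar> \<le> C / \<delta>" for n x using Ub unfolding U'_def by simp
  have "\<exists>w. \<forall>x. is_limsup (\<lambda>n. U' n x) (w x)"
    using is_limsup_exists[of "\<lambda>n. U' n _", OF Ub'] by metis
  then obtain w' where w': "\<And>x. is_limsup (\<lambda>n. U' n x) (w' x)" by blast
  have sub: "viscosity_subsolution (\<lambda>q x r. \<delta> * r + F q x) w"
    by (rule lf_limsup_subsolution[OF B \<delta> F h h0 UL _ w]) (simp add: Ueq)
  have sub': "viscosity_subsolution (\<lambda>q x r. \<delta> * r + (- F (- q) x)) w'"
  proof (rule lf_limsup_subsolution[OF B \<delta> _ h h0 UL' _ w'])
    show "- F (- q) x - - F (- q') x' \<le> B * (norm (q - q') + norm (x - x'))" for q q' x x'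
      using F[of "- q'" x' "- q" x] by (simp add: norm_minus_commute)
    show "(\<delta> + 2 * real CARD('d) * B / h n) * U' n x
        \<le> B / h n * neighbour_sum (h n) (U' n) x - - F (- central_gradient (h n) (U' n) x) x" for n x
      unfolding U'_def neighbour_sum_uminus central_gradient_uminus using Ueq[of n x] by simp
  qed
  have super: "viscosity_supersolution (\<lambda>q x r. \<delta> * r + F q x) (\<lambda>x. - w' x)"
    unfolding viscosity_supersolution_def
  proof (intro conjI allI impI)
    show "continuous_on UNIV (\<lambda>x. - w' x)"
      using sub' unfolding viscosity_subsolution_def by (intro continuous_intros) auto
    fix \<phi> G x assume *: "C1_with_gradient \<phi> G \<and> local_min_at (\<lambda>y. - w' y - \<phi> y) x"
    then have "local_max_at (\<lambda>y. w' y - - \<phi> y) x" by (simp add: local_min_at_uminus add.commute)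
    then have "\<delta> * w' x + (- F (- (- G x)) x) \<le> 0"
      using sub' C1_uminus[of \<phi> G] * unfolding viscosity_subsolution_def by blast
    then show "0 \<le> \<delta> * (- w' x) + F (G x) x" by simp
  qed
  have wB: "\<bar>w x\<bar> \<le> C / \<delta>" "\<bar>w' x\<bar> \<le> C / \<delta>" for x
    using is_limsup_bound[OF w Ub] is_limsup_bound[OF w' Ub'] by blast+
  have bdd: "bounded (range w)" "bounded (range (\<lambda>x. - w' x))"
    using wB by (auto simp: bounded_iff)
  have lip': "(B / \<delta>)-lipschitz_on UNIV (\<lambda>x. - w' x)"
    using is_limsup_lipschitz[OF UL' w'] by (simp add: lipschitz_on_def dist_real_def abs_minus_commute)
  have cmp: "\<delta> * (w x - - w' x) \<le> 0" for x
    by (rule comparison[OF \<delta> sub super bdd lip']) (use F in auto)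
  have le: "w x \<le> - w' x" for x using cmp[of x] \<delta> by (simp add: mult_le_0_iff)
  have conv: "(\<lambda>n. U n x) \<longlonglongrightarrow> w x" and eq: "w x = - w' x" for x
  proof -
    have "eventually (\<lambda>n. U n x < w x + e) sequentially" if "e > 0" for e
      using w[of x] that unfolding is_limsup_def by blast
    moreover have ev': "eventually (\<lambda>n. U n x > - w' x - e) sequentially" if "e > 0" for e
    proof -
      have "eventually (\<lambda>n. U' n x < w' x + e) sequentially"
        using w'[of x] that unfolding is_limsup_def by blast
      then show ?thesis by (rule eventually_mono) (simp add: U'_def)
    qed
    ultimately have "eventually (\<lambda>n. dist (U n x) (w x) < e) sequentially" if "e > 0" for e
      using eventually_conj[of "\<lambda>n. U n x < w x + e" sequentially "\<lambda>n. U n x > - w' x - e"] that le[of x]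
      by (auto simp: dist_real_def elim!: eventually_mono)
    then show conv: "(\<lambda>n. U n x) \<longlonglongrightarrow> w x" by (intro tendstoI)
    have "- w' x \<le> w x"
    proof (rule field_le_epsilon)
      fix e :: real assume "e > 0"
      then have "- w' x - e \<le> w x"
        by (intro tendsto_lowerbound[OF conv]) (auto intro: eventually_mono[OF ev'])
      then show "- w' x \<le> w x + e" by simp
    qed
    then show "w x = - w' x" using le[of x] by simp
  qed
  have minus_w': "(\<lambda>x. - w' x) = w" by (rule ext) (rule eq[symmetric])
  have "viscosity_solution (\<lambda>q x r. \<delta> * r + F q x) w"
    using sub super unfolding viscosity_solution_def minus_w' by blast
  moreover have "\<bar>\<delta> * w x\<bar> \<le> C" for x using wB(1)[of x] \<delta> by (simp add: abs_mult field_simps)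
  ultimately show ?thesis
    using that[of w] conv is_limsup_lipschitz[OF UL w] unfolding U_def h_def by blast
qed

end

section \<open>The approximate macroscopic problem\<close>

lemma caratheodory_measurable:
  fixes F :: "'a \<Rightarrow> 'b::euclidean_space \<Rightarrow> real"
  assumes meas: "\<And>q. (\<lambda>\<omega>. F \<omega> q) \<in> borel_measurable M"
    and cont: "\<And>\<omega>. \<omega> \<in> space M \<Longrightarrow> continuous_on UNIV (F \<omega>)"
    and q: "q \<in> borel_measurable M"
  shows "(\<lambda>\<omega>. F \<omega> (q \<omega>)) \<in> borel_measurable M"
proof -
  obtain s where s: "\<And>i. simple_function M (s i)" "\<And>\<omega>. \<omega> \<in> space M \<Longrightarrow> (\<lambda>i. s i \<omega>) \<longlonglongrightarrow> q \<omega>"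
    using borel_measurable_implies_sequence_metric[OF q, of 0] by blast
  show ?thesis
  proof (rule borel_measurable_LIMSEQ_metric)
    show "(\<lambda>\<omega>. F \<omega> (s i \<omega>)) \<in> borel_measurable M" for i
    proof (rule measurable_compose_countable'[of "s i ` space M" "\<lambda>q \<omega>. F \<omega> q" M borel "s i"])
      show "s i \<in> M \<rightarrow>\<^sub>M count_space (s i ` space M)"
        using s(1)[of i] unfolding simple_function_def by (simp add: measurable_count_space_eq2)
      show "countable (s i ` space M)"
        using s(1)[of i] unfolding simple_function_def by (simp add: countable_finite)
    qed (rule meas)
    show "(\<lambda>i. F \<omega> (s i \<omega>)) \<longlonglongrightarrow> F \<omega> (q \<omega>)" if "\<omega> \<in> space M" for \<omega>
      by (rule continuous_on_tendsto_compose[OF cont[OF that] s(2)[OF that]]) auto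
  qed
qed

lemma borel_measurable_vec_lambda:
  fixes f :: "'a \<Rightarrow> 'd::finite \<Rightarrow> real"
  assumes "\<And>i. (\<lambda>\<omega>. f \<omega> i) \<in> borel_measurable M"
  shows "(\<lambda>\<omega>. (\<chi> i. f \<omega> i) :: real^'d) \<in> borel_measurable M"
  unfolding borel_measurable_euclidean_space[where 'c="real^'d"]
  using assms by (auto simp: Basis_vec_def inner_axis)

lemma lf_iterate_measurable:
  fixes F :: "'a \<Rightarrow> real^'d \<Rightarrow> real^'d \<Rightarrow> real"
  assumes hj: "\<And>\<omega>. \<omega> \<in> space M \<Longrightarrow> lipschitz_hamilton_jacobi (F \<omega>) B \<delta> C"
    and meas: "\<And>q x. (\<lambda>\<omega>. F \<omega> q x) \<in> borel_measurable M"
  shows "(\<lambda>\<omega>. lf_iterate (F \<omega>) B \<delta> C h k x) \<in> borel_measurable M"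
proof (induction k arbitrary: x)
  case 0
  then show ?case unfolding lf_iterate_def by simp
next
  case (Suc k)
  have eq: "lf_iterate (F \<omega>) B \<delta> C h (Suc k) = lf_step (F \<omega>) B \<delta> h (lf_iterate (F \<omega>) B \<delta> C h k)" for \<omega>
    unfolding lf_iterate_def by simp
  have 1: "(\<lambda>\<omega>. neighbour_sum h (lf_iterate (F \<omega>) B \<delta> C h k) x) \<in> borel_measurable M"
    unfolding neighbour_sum_def by (intro borel_measurable_sum borel_measurable_add Suc)
  have 2: "(\<lambda>\<omega>. central_gradient h (lf_iterate (F \<omega>) B \<delta> C h k) x) \<in> borel_measurable M"
    unfolding central_gradient_def
    by (intro borel_measurable_vec_lambda borel_measurable_divide borel_measurable_diff Suc) auto
  have 3: "(\<lambda>\<omega>. F \<omega> (central_gradient h (lf_iterate (F \<omega>) B \<delta> C h k) x) x) \<in> borel_measurable M"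
    by (rule caratheodory_measurable[of "\<lambda>\<omega> q. F \<omega> q x", OF meas _ 2])
       (rule lipschitz_hamilton_jacobi.continuous_F[OF hj])
  show ?case
    unfolding eq lf_step_def
    by (intro borel_measurable_divide borel_measurable_diff borel_measurable_times 1 3) auto
qed

text \<open>Translating the test functions along with the solution.\<close>

lemma viscosity_solution_translate:
  fixes v :: "real^'d \<Rightarrow> real"
  assumes "viscosity_solution F v"
  shows "viscosity_solution (\<lambda>q x. F q (x + z)) (\<lambda>x. v (x + z))"
proof -
  have C1: "C1_with_gradient (\<lambda>y. \<phi> (y - z)) (\<lambda>y. G (y - z))" if "C1_with_gradient \<phi> G" for \<phi> G
  proof -
    have d: "((\<lambda>y. y - z) has_derivative (\<lambda>h. h)) (at y)" for y :: "real^'d"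
      by (auto intro!: derivative_eq_intros)
    have "((\<lambda>y. \<phi> (y - z)) has_derivative (\<lambda>h. h \<bullet> G (y - z))) (at y)" for y
      using has_derivative_compose[OF d, of \<phi> "\<lambda>h. h \<bullet> G (y - z)" y] that
      unfolding C1_with_gradient_def gderiv_def by simp
    moreover have "continuous_on UNIV (\<lambda>y. G (y - z))"
      using that unfolding C1_with_gradient_def
      by (auto intro!: continuous_on_compose2[of UNIV G UNIV "\<lambda>y. y - z"] continuous_on_diff)
    ultimately show ?thesis unfolding C1_with_gradient_def gderiv_def by blast
  qed
  have mx: "local_max_at (\<lambda>y. v y - \<phi> (y - z)) (x + z)"
    if "local_max_at (\<lambda>y. v (y + z) - \<phi> y) x" for \<phi> x
  proof -
    obtain e where e: "e > 0" "\<And>y. y \<in> ball x e \<Longrightarrow> v (y + z) - \<phi> y \<le> v (x + z) - \<phi> x"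
      using \<open>local_max_at (\<lambda>y. v (y + z) - \<phi> y) x\<close> unfolding local_max_at_def by auto
    have "v y - \<phi> (y - z) \<le> v (x + z) - \<phi> (x + z - z)" if "y \<in> ball (x + z) e" for y
    proof -
      have "dist x (y - z) = dist (x + z) y" by (simp add: dist_norm algebra_simps)
      then show ?thesis using e(2)[of "y - z"] that by simp
    qed
    then show ?thesis using e(1) unfolding local_max_at_def by blast
  qed
  have mn: "local_min_at (\<lambda>y. v y - \<phi> (y - z)) (x + z)"
    if "local_min_at (\<lambda>y. v (y + z) - \<phi> y) x" for \<phi> x
  proof -
    obtain e where e: "e > 0" "\<And>y. y \<in> ball x e \<Longrightarrow> v (y + z) - \<phi> y \<ge> v (x + z) - \<phi> x"
      using \<open>local_min_at (\<lambda>y. v (y + z) - \<phi> y) x\<close> unfolding local_min_at_def by auto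
    have "v y - \<phi> (y - z) \<ge> v (x + z) - \<phi> (x + z - z)" if "y \<in> ball (x + z) e" for y
    proof -
      have "dist x (y - z) = dist (x + z) y" by (simp add: dist_norm algebra_simps)
      then show ?thesis using e(2)[of "y - z"] that by simp
    qed
    then show ?thesis using e(1) unfolding local_min_at_def by blast
  qed
  have c: "continuous_on UNIV (\<lambda>x. v (x + z))"
    using assms unfolding viscosity_solution_def viscosity_subsolution_def
    by (auto intro!: continuous_on_compose2[of UNIV v UNIV "\<lambda>x. x + z"] continuous_on_add)
  show ?thesis
    unfolding viscosity_solution_def viscosity_subsolution_def viscosity_supersolution_def
  proof (intro conjI allI impI c)
    fix \<phi> G x assume *: "C1_with_gradient \<phi> G \<and> local_max_at (\<lambda>y. v (y + z) - \<phi> y) x"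
    have "F (G (x + z - z)) (x + z) (v (x + z)) \<le> 0"
      using assms C1[of \<phi> G] mx[of \<phi> x] * unfolding viscosity_solution_def viscosity_subsolution_def by blast
    then show "F (G x) (x + z) (v (x + z)) \<le> 0" by simp
  next
    fix \<phi> G x assume *: "C1_with_gradient \<phi> G \<and> local_min_at (\<lambda>y. v (y + z) - \<phi> y) x"
    have "0 \<le> F (G (x + z - z)) (x + z) (v (x + z))"
      using assms C1[of \<phi> G] mn[of \<phi> x] * unfolding viscosity_solution_def viscosity_supersolution_def by blast
    then show "0 \<le> F (G x) (x + z) (v (x + z))" by simp
  qed
qed

text \<open>
  The projection onto a ball truncates the gradient: it is bounded, nonexpansive, and does not move
  large gradients to small ones, so coercivity survives in the form required.
\<close>

lemma norm_closest_point_cball: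
  fixes y :: "'b::euclidean_space"
  assumes R: "R \<ge> 0"
  shows "norm (closest_point (cball 0 R) y) \<le> R"
    and "norm (closest_point (cball 0 R) y) \<ge> min R (norm y)"
proof -
  have ne: "cball (0::'b) R \<noteq> {}" using R by simp
  show "norm (closest_point (cball 0 R) y) \<le> R"
    using closest_point_in_set[OF closed_cball ne, of y] by simp
  show "norm (closest_point (cball 0 R) y) \<ge> min R (norm y)"
  proof (cases "norm y \<le> R")
    case True
    then show ?thesis by (simp add: closest_point_self)
  next
    case False
    have "dist y (closest_point (cball 0 R) y) \<le> dist y ((R / norm y) *\<^sub>R y)"
      by (rule closest_point_le) (use R False in auto)
    also have "\<dots> = norm ((1 - R / norm y) *\<^sub>R y)" by (simp add: dist_norm algebra_simps)
    also have "\<dots> = \<bar>1 - R / norm y\<bar> * norm y" by simp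
    also have "\<bar>1 - R / norm y\<bar> = 1 - R / norm y" using False R by (simp add: divide_le_eq_1)
    also have "(1 - R / norm y) * norm y = norm y - R"
    proof -
      have "norm y > 0" using False R by linarith
      then show ?thesis by (simp add: left_diff_distrib)
    qed
    finally have "norm y - norm (closest_point (cball 0 R) y) \<le> norm y - R"
      using norm_triangle_ineq2[of y "closest_point (cball 0 R) y"] by (simp add: dist_norm)
    then show ?thesis by simp
  qed
qed

context stationary_hamiltonian
begin

lemma coercive_threshold:
  "\<exists>R0>0. \<forall>p y. \<forall>\<omega>\<in>space M. norm p \<ge> R0 \<longrightarrow> H p y \<omega> > K"
proof -
  have "eventually (\<lambda>p. ereal K < (INF (y, \<omega>)\<in>UNIV \<times> space M. ereal (H p y \<omega>))) at_infinity"
    using coercive unfolding tendsto_PInfty by blast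
  then obtain b where b: "\<And>p. b \<le> norm p \<Longrightarrow> ereal K < (INF (y, \<omega>)\<in>UNIV \<times> space M. ereal (H p y \<omega>))"
    unfolding eventually_at_infinity by blast
  have "H p y \<omega> > K" if "max b 1 \<le> norm p" "\<omega> \<in> space M" for p y \<omega>
  proof -
    have "ereal K < (case (y, \<omega>) of (y, \<omega>) \<Rightarrow> ereal (H p y \<omega>))"
      by (rule less_INF_D[OF b]) (use that in auto)
    then show ?thesis by simp
  qed
  then show ?thesis by (intro exI[of _ "max b 1"]) auto
qed

text \<open>
  The form of the comparison principle shared by uniqueness (\<open>p = p'\<close>, \<open>a = b = 0\<close>), Lipschitz dependence on \<open>p\<close>
  (\<open>a = b = 0\<close>) and dependence on \<open>\<delta>\<close> (\<open>p = p'\<close>, with \<open>a\<close> or \<open>b\<close> absorbing the change of the zeroth-order term).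
\<close>

lemma macro_comparison:
  assumes \<delta>: "\<delta> > 0" and \<omega>: "\<omega> \<in> space M" and K: "K \<ge> 0"
    and HK: "\<And>p1 p2 y1 y2. p1 \<in> ball 0 (P + L + 2) \<Longrightarrow> p2 \<in> ball 0 (P + L + 2) \<Longrightarrow>
        \<bar>H p1 y1 \<omega> - H p2 y2 \<omega>\<bar> \<le> K * (norm (p1 - p2) + norm (y1 - y2))"
    and p: "norm p \<le> P" "norm p' \<le> P"
    and sub: "viscosity_subsolution (\<lambda>q x r. \<delta> * r + (H (p + q) x \<omega> - a)) u"
    and super: "viscosity_supersolution (\<lambda>q x r. \<delta> * r + (H (p' + q) x \<omega> + b)) v"
    and bdd: "bounded (range u)" "bounded (range v)" and lip: "L-lipschitz_on UNIV v"
  shows "\<delta> * (u x - v x) \<le> K * norm (p - p') + a + b"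
proof -
  have in_ball: "p + q \<in> ball 0 (P + L + 2)" "p' + q \<in> ball 0 (P + L + 2)" if "norm q \<le> L + 1" for q
    using norm_triangle_ineq[of p q] norm_triangle_ineq[of p' q] p that by auto
  have "\<delta> * (u x - v x) \<le> K * norm (p - p') + (a + b)"
  proof (rule comparison[OF \<delta> sub super bdd lip, of K])
    fix q q' x x' :: "real^'d" assume q: "norm q \<le> L + 1" "norm q' \<le> L + 1"
    show "H (p + q) x \<omega> - a - (H (p + q') x' \<omega> - a) \<le> K * (norm (q - q') + norm (x - x'))"
      using HK[OF in_ball(1)[OF q(1)] in_ball(1)[OF q(2)], of x x'] by (simp add: abs_le_iff)
  next
    fix q x :: "real^'d" assume q: "norm q \<le> L"
    show "H (p' + q) x \<omega> + b \<le> H (p + q) x \<omega> - a + (K * norm (p - p') + (a + b))"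
      using HK[OF in_ball(2)[of q] in_ball(1)[of q], of x x] q
      by (simp add: abs_le_iff norm_minus_commute)
  qed
  then show ?thesis by simp
qed

lemma macro_solution_unique:
  assumes \<delta>: "\<delta> > 0" and \<omega>: "\<omega> \<in> space M"
    and u: "is_macro_solution H p \<delta> \<omega> u" and v: "is_macro_solution H p \<delta> \<omega> v"
  shows "u = v"
proof -
  have le: "u x \<le> v x" if u: "is_macro_solution H p \<delta> \<omega> u" and v: "is_macro_solution H p \<delta> \<omega> v" for u v x
  proof -
    obtain L where L: "L-lipschitz_on UNIV v" using v unfolding is_macro_solution_def by blast
    have "norm p + L + 2 > 0" using lipschitz_on_nonneg[OF L] by (simp add: add_nonneg_pos)
    from locally_Lipschitz[OF this] obtain K where K: "K > 0"
      "\<And>p1 p2 y1 y2. p1 \<in> ball 0 (norm p + L + 2) \<Longrightarrow> p2 \<in> ball 0 (norm p + L + 2) \<Longrightarrow>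
        \<bar>H p1 y1 \<omega> - H p2 y2 \<omega>\<bar> \<le> K * (norm (p1 - p2) + norm (y1 - y2))"
      using \<omega> by blast
    have "\<delta> * (u x - v x) \<le> K * norm (p - p) + 0 + 0"
      by (rule macro_comparison[OF \<delta> \<omega> _ K(2), where P = "norm p" and L = L and p = p and p' = p])
         (use u v L K(1) in \<open>auto simp: is_macro_solution_def viscosity_solution_def\<close>)
    then show ?thesis using \<delta> by (simp add: mult_le_0_iff)
  qed
  show ?thesis using le[OF u v] le[OF v u] by (auto intro!: ext antisym)
qed

lemma macro_solution_eqI:
  assumes "\<delta> > 0" "\<omega> \<in> space M" "is_macro_solution H p \<delta> \<omega> v"
  shows "macro_solution H p \<delta> \<omega> = v"
  unfolding macro_solution_def using assms macro_solution_unique by (intro the_equality) auto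

text \<open>
  Solve the equation with the gradient projected onto a large ball. By the scheme \<open>\<bar>\<delta> v\<bar> \<le> C\<close>, where \<open>C\<close> bounds
  \<open>\<bar>H p\<bar>\<close>, so every upper test gradient satisfies \<open>H \<le> C\<close> and coercivity bounds it by \<open>L\<close>. This bound lies inside
  the ball, so the truncation is invisible to the solution. Measurability is inherited from the iterates
  through two pointwise limits, first in the number of iterations and then in the mesh size.
\<close>

lemma macro_solution_exists:
  assumes P: "P > 0"
  shows "\<exists>C L. C \<ge> 0 \<and> L \<ge> 0 \<and> (\<forall>p \<delta>. norm p \<le> P \<longrightarrow> \<delta> > 0 \<longrightarrow>
     (\<forall>\<omega>\<in>space M. is_macro_solution H p \<delta> \<omega> (macro_solution H p \<delta> \<omega>)
        \<and> L-lipschitz_on UNIV (macro_solution H p \<delta> \<omega>)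
        \<and> (\<forall>x. \<bar>\<delta> * macro_solution H p \<delta> \<omega> x\<bar> \<le> C)) \<and>
     (\<forall>x. (\<lambda>\<omega>. macro_solution H p \<delta> \<omega> x) \<in> borel_measurable M))"
proof -
  obtain C where C: "C > 0" "\<And>p y \<omega>. p \<in> ball 0 (P + 1) \<Longrightarrow> \<omega> \<in> space M \<Longrightarrow> \<bar>H p y \<omega>\<bar> \<le> C"
    using locally_bounded[of "P + 1"] P by auto
  obtain R0 where R0: "R0 > 0" "\<And>p y \<omega>. \<omega> \<in> space M \<Longrightarrow> norm p \<ge> R0 \<Longrightarrow> H p y \<omega> > C"
    using coercive_threshold[of C] by blast
  define L where "L = R0 + P"
  define R where "R = P + L"
  have LR: "L \<ge> 0" "R \<ge> 0" "R0 \<le> R" "R + 1 > 0" "P \<le> R" unfolding R_def L_def using R0 P by auto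
  obtain B where B: "B > 0" "\<And>p1 p2 y1 y2 \<omega>. p1 \<in> ball 0 (R + 1) \<Longrightarrow> p2 \<in> ball 0 (R + 1) \<Longrightarrow> \<omega> \<in> space M \<Longrightarrow>
        \<bar>H p1 y1 \<omega> - H p2 y2 \<omega>\<bar> \<le> B * (norm (p1 - p2) + norm (y1 - y2))"
    using locally_Lipschitz[OF LR(4)] by blast
  define cp where "cp = closest_point (cball (0::real^'d) R)"
  have cp_le: "norm (cp y) \<le> R" and cp_ge: "norm (cp y) \<ge> min R (norm y)" for y
    unfolding cp_def by (rule norm_closest_point_cball[OF LR(2)])+
  have cp_ball: "cp y \<in> ball 0 (R + 1)" for y using cp_le[of y] by simp
  have cp_id: "cp y = y" if "norm y \<le> R" for y unfolding cp_def using that by (simp add: closest_point_self)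
  have cp_lip: "norm (cp y - cp z) \<le> norm (y - z)" for y z
    using closest_point_lipschitz[of "cball (0::real^'d) R" y z] LR(2) unfolding cp_def dist_norm by simp
  have *: "(\<forall>\<omega>\<in>space M. is_macro_solution H p \<delta> \<omega> (macro_solution H p \<delta> \<omega>)
        \<and> L-lipschitz_on UNIV (macro_solution H p \<delta> \<omega>)
        \<and> (\<forall>x. \<bar>\<delta> * macro_solution H p \<delta> \<omega> x\<bar> \<le> C)) \<and>
     (\<forall>x. (\<lambda>\<omega>. macro_solution H p \<delta> \<omega> x) \<in> borel_measurable M)"
    if p: "norm p \<le> P" and \<delta>: "\<delta> > 0" for p \<delta>
  proof -
    define F where "F = (\<lambda>\<omega> q x. H (cp (p + q)) x \<omega>)"
    have hj: "lipschitz_hamilton_jacobi (F \<omega>) B \<delta> C" if \<omega>: "\<omega> \<in> space M" for \<omega>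
    proof
      show "B > 0" "\<delta> > 0" by fact+
      fix q q' x x' :: "real^'d"
      have "F \<omega> q x - F \<omega> q' x' \<le> B * (norm (cp (p + q) - cp (p + q')) + norm (x - x'))"
        using B(2)[OF cp_ball cp_ball \<omega>, of "p + q" x "p + q'" x'] unfolding F_def by (simp add: abs_le_iff)
      also have "\<dots> \<le> B * (norm (q - q') + norm (x - x'))"
        using cp_lip[of "p + q" "p + q'"] B(1) by (intro mult_left_mono) auto
      finally show "F \<omega> q x - F \<omega> q' x' \<le> B * (norm (q - q') + norm (x - x'))" .
      have "cp p = p" using p LR by (intro cp_id) auto
      then show "\<bar>F \<omega> 0 x\<bar> \<le> C" using C(2)[of p \<omega> x] p \<omega> unfolding F_def by simp
    qed
    have good: "is_macro_solution H p \<delta> \<omega> (macro_solution H p \<delta> \<omega>) \<and>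
        L-lipschitz_on UNIV (macro_solution H p \<delta> \<omega>) \<and> (\<forall>x. \<bar>\<delta> * macro_solution H p \<delta> \<omega> x\<bar> \<le> C) \<and>
        (\<forall>x. (\<lambda>n. lf_solution (F \<omega>) B \<delta> C (1 / real (Suc n)) x) \<longlonglongrightarrow> macro_solution H p \<delta> \<omega> x)"
      if \<omega>: "\<omega> \<in> space M" for \<omega>
    proof -
      from lipschitz_hamilton_jacobi.lf_convergence[OF hj[OF \<omega>]]
      obtain v where v: "\<And>x. (\<lambda>n. lf_solution (F \<omega>) B \<delta> C (1 / real (Suc n)) x) \<longlonglongrightarrow> v x"
        "viscosity_solution (\<lambda>q x r. \<delta> * r + F \<omega> q x) v"
        "(B / \<delta>)-lipschitz_on UNIV v" "\<And>x. \<bar>\<delta> * v x\<bar> \<le> C"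
        by metis
      have bdd: "bounded (range v)"
      proof -
        have "\<bar>v x\<bar> \<le> C / \<delta>" for x using v(4)[of x] \<delta> by (simp add: abs_mult field_simps)
        then show ?thesis by (auto simp: bounded_iff)
      qed
      have lip: "L-lipschitz_on UNIV v"
      proof (rule lipschitz_of_test_gradients[OF _ bdd LR(1)])
        show "continuous_on UNIV v" using v(3) by (rule lipschitz_on_continuous_on)
        fix \<phi> G x assume "C1_with_gradient \<phi> G" "local_max_at (\<lambda>y. v y - \<phi> y) x"
        then have "\<delta> * v x + F \<omega> (G x) x \<le> 0"
          using v(2) unfolding viscosity_solution_def viscosity_subsolution_def by blast
        then have "H (cp (p + G x)) x \<omega> \<le> C" using v(4)[of x] unfolding F_def by (simp add: abs_le_iff)
        then have "norm (cp (p + G x)) < R0" using R0(2)[OF \<omega>] by (meson not_le)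
        then have "norm (p + G x) < R0" using cp_ge[of "p + G x"] LR(3) by linarith
        then show "norm (G x) \<le> L"
          using norm_triangle_ineq4[of "p + G x" p] p unfolding L_def by simp
      qed
      have "viscosity_solution (\<lambda>q x r. \<delta> * r + H (p + q) x \<omega>) v"
      proof (rule viscosity_solution_cong_gradient[OF v(2) lip])
        fix q x :: "real^'d" assume "norm q \<le> L"
        then have "norm (p + q) \<le> R" using norm_triangle_ineq[of p q] p unfolding R_def by linarith
        then show "F \<omega> q x = H (p + q) x \<omega>" unfolding F_def by (simp add: cp_id)
      qed
      then have "is_macro_solution H p \<delta> \<omega> v" unfolding is_macro_solution_def using bdd lip by blast
      moreover from macro_solution_eqI[OF \<delta> \<omega> this] have "macro_solution H p \<delta> \<omega> = v" .
      ultimately show ?thesis using v lip by simp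
    qed
    have "(\<lambda>\<omega>. macro_solution H p \<delta> \<omega> x) \<in> borel_measurable M" for x
    proof (rule borel_measurable_LIMSEQ_metric)
      show "(\<lambda>n. lf_solution (F \<omega>) B \<delta> C (1 / real (Suc n)) x) \<longlonglongrightarrow> macro_solution H p \<delta> \<omega> x"
        if "\<omega> \<in> space M" for \<omega> using good[OF that] by blast
      show "(\<lambda>\<omega>. lf_solution (F \<omega>) B \<delta> C (1 / real (Suc n)) x) \<in> borel_measurable M" for n
      proof (rule borel_measurable_LIMSEQ_metric)
        show "(\<lambda>\<omega>. lf_iterate (F \<omega>) B \<delta> C (1 / real (Suc n)) k x) \<in> borel_measurable M" for k
          by (rule lf_iterate_measurable[OF hj]) (auto simp: F_def measurable_H)
        show "(\<lambda>k. lf_iterate (F \<omega>) B \<delta> C (1 / real (Suc n)) k x) \<longlonglongrightarrow> lf_solution (F \<omega>) B \<delta> C (1 / real (Suc n)) x"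
          if "\<omega> \<in> space M" for \<omega>
          by (rule lipschitz_hamilton_jacobi.lf_iterate_tendsto[OF hj[OF that]]) simp
      qed
    qed
    then show ?thesis using good by blast
  qed
  then show ?thesis using C(1) LR(1) by (intro exI[of _ C] exI[of _ L]) auto
qed

lemma is_macro_solution_macro_solution:
  assumes "\<delta> > 0" "\<omega> \<in> space M"
  shows "is_macro_solution H p \<delta> \<omega> (macro_solution H p \<delta> \<omega>)"
proof -
  have "norm p \<le> norm p + 1" "norm p + 1 > 0" by (auto simp: add_nonneg_pos)
  then show ?thesis using macro_solution_exists[of "norm p + 1"] assms by blast
qed

lemma macro_solution_measurable:
  assumes "\<delta> > 0"
  shows "(\<lambda>\<omega>. macro_solution H p \<delta> \<omega> x) \<in> borel_measurable M"
proof -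
  have "norm p \<le> norm p + 1" "norm p + 1 > 0" by (auto simp: add_nonneg_pos)
  then show ?thesis using macro_solution_exists[of "norm p + 1"] assms by blast
qed

lemma macro_solution_stationary:
  assumes \<delta>: "\<delta> > 0" and \<omega>: "\<omega> \<in> space M" "\<tau> z \<omega> \<in> space M"
  shows "macro_solution H p \<delta> (\<tau> z \<omega>) x = macro_solution H p \<delta> \<omega> (x + z)"
proof -
  let ?v = "macro_solution H p \<delta> \<omega>"
  have v: "is_macro_solution H p \<delta> \<omega> ?v" by (rule is_macro_solution_macro_solution[OF \<delta> \<omega>(1)])
  have "viscosity_solution (\<lambda>q x r. \<delta> * r + H (p + q) (x + z) \<omega>) (\<lambda>x. ?v (x + z))"
    using viscosity_solution_translate[of "\<lambda>q x r. \<delta> * r + H (p + q) x \<omega>" ?v z] v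
    unfolding is_macro_solution_def by blast
  then have "viscosity_solution (\<lambda>q x r. \<delta> * r + H (p + q) x (\<tau> z \<omega>)) (\<lambda>x. ?v (x + z))"
    unfolding stationary[OF \<omega>(1)] .
  moreover have "bounded (range (\<lambda>x. ?v (x + z)))"
    using v unfolding is_macro_solution_def by (auto simp: bounded_iff)
  moreover have "L-lipschitz_on UNIV (\<lambda>x. ?v (x + z))" if "L-lipschitz_on UNIV ?v" for L
    using that unfolding lipschitz_on_def by (auto simp: dist_norm) (metis add_diff_cancel_right)
  ultimately have "is_macro_solution H p \<delta> (\<tau> z \<omega>) (\<lambda>x. ?v (x + z))"
    using v unfolding is_macro_solution_def by blast
  from macro_solution_eqI[OF \<delta> \<omega>(2) this] show ?thesis by simp
qed

text \<open>
  For the dependence on \<open>\<delta>\<close>: the solution \<open>u\<close> for \<open>\<delta>\<close> solves the equation for \<open>\<delta>'\<close> up to the error \<open>(\<delta> - \<delta>') u\<close>, which is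
  at most \<open>C (\<delta> - \<delta>') / \<delta>\<close>. The estimate is small as soon as \<open>\<delta>' / \<delta>\<close> is close to one, which is why the scales
  \<open>1, 1/2, 1/3, \<dots>\<close> will determine the behaviour for all \<open>\<delta>\<close>.
\<close>

lemma macro_solution_bounds:
  assumes P: "P > 0"
  obtains C L K where "C \<ge> 0" "L \<ge> 0" "K \<ge> 0"
    "\<And>p \<delta> \<omega> x. norm p \<le> P \<Longrightarrow> \<delta> > 0 \<Longrightarrow> \<omega> \<in> space M \<Longrightarrow> \<bar>\<delta> * macro_solution H p \<delta> \<omega> x\<bar> \<le> C"
    "\<And>p \<delta> \<omega>. norm p \<le> P \<Longrightarrow> \<delta> > 0 \<Longrightarrow> \<omega> \<in> space M \<Longrightarrow> L-lipschitz_on UNIV (macro_solution H p \<delta> \<omega>)"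
    "\<And>p p' \<delta> \<omega> x. norm p \<le> P \<Longrightarrow> norm p' \<le> P \<Longrightarrow> \<delta> > 0 \<Longrightarrow> \<omega> \<in> space M \<Longrightarrow>
       \<bar>\<delta> * macro_solution H p \<delta> \<omega> x - \<delta> * macro_solution H p' \<delta> \<omega> x\<bar> \<le> K * norm (p - p')"
    "\<And>p \<delta> \<delta>' \<omega> x. norm p \<le> P \<Longrightarrow> 0 < \<delta>' \<Longrightarrow> \<delta>' \<le> \<delta> \<Longrightarrow> \<omega> \<in> space M \<Longrightarrow>
       \<bar>\<delta> * macro_solution H p \<delta> \<omega> x - \<delta>' * macro_solution H p \<delta>' \<omega> x\<bar> \<le> 2 * C * (\<delta> - \<delta>') / \<delta>"
proof -
  obtain C L where CL: "C \<ge> 0" "L \<ge> 0"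
    and all: "\<And>p \<delta> \<omega>. norm p \<le> P \<Longrightarrow> \<delta> > 0 \<Longrightarrow> \<omega> \<in> space M \<Longrightarrow>
        is_macro_solution H p \<delta> \<omega> (macro_solution H p \<delta> \<omega>) \<and>
        L-lipschitz_on UNIV (macro_solution H p \<delta> \<omega>) \<and> (\<forall>x. \<bar>\<delta> * macro_solution H p \<delta> \<omega> x\<bar> \<le> C)"
    using macro_solution_exists[OF P] by blast
  have "P + L + 2 > 0" using P CL by simp
  from locally_Lipschitz[OF this] obtain K where K: "K > 0"
    "\<And>p1 p2 y1 y2 \<omega>. p1 \<in> ball 0 (P + L + 2) \<Longrightarrow> p2 \<in> ball 0 (P + L + 2) \<Longrightarrow> \<omega> \<in> space M \<Longrightarrow>
        \<bar>H p1 y1 \<omega> - H p2 y2 \<omega>\<bar> \<le> K * (norm (p1 - p2) + norm (y1 - y2))"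
    by blast
  have p_le: "\<delta> * (macro_solution H p \<delta> \<omega> x - macro_solution H p' \<delta> \<omega> x) \<le> K * norm (p - p')"
    if p: "norm p \<le> P" "norm p' \<le> P" and \<delta>: "\<delta> > 0" and \<omega>: "\<omega> \<in> space M" for p p' \<delta> \<omega> x
  proof -
    have "\<delta> * (macro_solution H p \<delta> \<omega> x - macro_solution H p' \<delta> \<omega> x) \<le> K * norm (p - p') + 0 + 0"
      by (rule macro_comparison[OF \<delta> \<omega> _ K(2)[OF _ _ \<omega>] p])
         (use all[OF p(1) \<delta> \<omega>] all[OF p(2) \<delta> \<omega>] K(1) in \<open>auto simp: is_macro_solution_def viscosity_solution_def\<close>)
    then show ?thesis by simp
  qed
  have d_le: "\<bar>\<delta> * macro_solution H p \<delta> \<omega> x - \<delta>' * macro_solution H p \<delta>' \<omega> x\<bar> \<le> 2 * C * (\<delta> - \<delta>') / \<delta>"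
    if p: "norm p \<le> P" and \<delta>: "0 < \<delta>'" "\<delta>' \<le> \<delta>" and \<omega>: "\<omega> \<in> space M" for p \<delta> \<delta>' \<omega> x
  proof -
    have \<delta>0: "\<delta> > 0" using \<delta> by simp
    let ?u = "macro_solution H p \<delta> \<omega>" and ?v = "macro_solution H p \<delta>' \<omega>"
    note u = all[OF p \<delta>0 \<omega>] and v = all[OF p \<delta>(1) \<omega>]
    define m where "m = C * (\<delta> - \<delta>') / \<delta>"
    have shift: "\<bar>(\<delta> - \<delta>') * ?u y\<bar> \<le> m" for y
    proof -
      have "\<bar>?u y\<bar> \<le> C / \<delta>" using u \<delta>0 by (simp add: abs_mult field_simps)
      then have "(\<delta> - \<delta>') * \<bar>?u y\<bar> \<le> (\<delta> - \<delta>') * (C / \<delta>)" using \<delta> by (intro mult_left_mono) auto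
      then show ?thesis using \<delta> unfolding m_def by (simp add: abs_mult mult.commute)
    qed
    have usub: "viscosity_subsolution (\<lambda>q x r. \<delta>' * r + (H (p + q) x \<omega> - m)) ?u"
      unfolding viscosity_subsolution_def
    proof (intro conjI allI impI)
      show "continuous_on UNIV ?u" using u lipschitz_on_continuous_on by blast
      fix \<phi> G y assume "C1_with_gradient \<phi> G \<and> local_max_at (\<lambda>y. ?u y - \<phi> y) y"
      then have "\<delta> * ?u y + H (p + G y) y \<omega> \<le> 0"
        using u unfolding is_macro_solution_def viscosity_solution_def viscosity_subsolution_def by blast
      then show "\<delta>' * ?u y + (H (p + G y) y \<omega> - m) \<le> 0"
        using shift[of y] by (simp add: abs_le_iff left_diff_distrib)
    qed
    have usuper: "viscosity_supersolution (\<lambda>q x r. \<delta>' * r + (H (p + q) x \<omega> + m)) ?u"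
      unfolding viscosity_supersolution_def
    proof (intro conjI allI impI)
      show "continuous_on UNIV ?u" using u lipschitz_on_continuous_on by blast
      fix \<phi> G y assume "C1_with_gradient \<phi> G \<and> local_min_at (\<lambda>y. ?u y - \<phi> y) y"
      then have "0 \<le> \<delta> * ?u y + H (p + G y) y \<omega>"
        using u unfolding is_macro_solution_def viscosity_solution_def viscosity_supersolution_def by blast
      then show "0 \<le> \<delta>' * ?u y + (H (p + G y) y \<omega> + m)"
        using shift[of y] by (simp add: abs_le_iff left_diff_distrib)
    qed
    have "\<delta>' * (?u x - ?v x) \<le> K * norm (p - p) + m + 0"
      by (rule macro_comparison[OF \<delta>(1) \<omega> _ K(2)[OF _ _ \<omega>] p p usub])
         (use u v K(1) in \<open>auto simp: is_macro_solution_def viscosity_solution_def\<close>)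
    moreover have "\<delta>' * (?v x - ?u x) \<le> K * norm (p - p) + 0 + m"
      by (rule macro_comparison[OF \<delta>(1) \<omega> _ K(2)[OF _ _ \<omega>] p p _ usuper])
         (use u v K(1) in \<open>auto simp: is_macro_solution_def viscosity_solution_def\<close>)
    ultimately have "\<bar>\<delta> * ?u x - \<delta>' * ?v x\<bar> \<le> 2 * m"
      using shift[of x] by (simp add: abs_le_iff left_diff_distrib right_diff_distrib)
    then show ?thesis unfolding m_def by simp
  qed
  show ?thesis
  proof (rule that[of C L K])
    fix p p' x :: "real^'d" and \<delta> :: real and \<omega>
    assume p: "norm p \<le> P" "norm p' \<le> P" and \<delta>: "\<delta> > 0" and \<omega>: "\<omega> \<in> space M"
    show "\<bar>\<delta> * macro_solution H p \<delta> \<omega> x - \<delta> * macro_solution H p' \<delta> \<omega> x\<bar> \<le> K * norm (p - p')"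
      using p_le[OF p \<delta> \<omega>, of x] p_le[OF p(2,1) \<delta> \<omega>, of x]
      by (simp add: abs_le_iff right_diff_distrib norm_minus_commute)
  qed (use CL K(1) all d_le in auto)
qed

lemma macro_solution_cong_hamiltonian:
  assumes P: "P > 0"
  obtains R where "R > 0"
    "\<And>H' p \<delta> \<omega>. stationary_hamiltonian M \<tau> H' \<Longrightarrow>
       (\<And>q y \<omega>. \<omega> \<in> space M \<Longrightarrow> norm q \<le> R \<Longrightarrow> H' q y \<omega> = H q y \<omega>) \<Longrightarrow>
       norm p \<le> P \<Longrightarrow> \<delta> > 0 \<Longrightarrow> \<omega> \<in> space M \<Longrightarrow> macro_solution H' p \<delta> \<omega> = macro_solution H p \<delta> \<omega>"
proof -
  obtain L where L: "L \<ge> 0"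
    and lip: "\<And>p \<delta> \<omega>. norm p \<le> P \<Longrightarrow> \<delta> > 0 \<Longrightarrow> \<omega> \<in> space M \<Longrightarrow> L-lipschitz_on UNIV (macro_solution H p \<delta> \<omega>)"
    using macro_solution_bounds[OF P] by metis
  show ?thesis
  proof (rule that[of "P + L"])
    show "P + L > 0" using P L by simp
    fix H' :: "real^'d \<Rightarrow> real^'d \<Rightarrow> 'a \<Rightarrow> real" and p :: "real^'d" and \<delta> :: real and \<omega>
    assume H': "stationary_hamiltonian M \<tau> H'"
      and eq: "\<And>q y \<omega>. \<omega> \<in> space M \<Longrightarrow> norm q \<le> P + L \<Longrightarrow> H' q y \<omega> = H q y \<omega>"
      and p: "norm p \<le> P" and \<delta>: "\<delta> > 0" and \<omega>: "\<omega> \<in> space M"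
    let ?v = "macro_solution H p \<delta> \<omega>"
    have v: "is_macro_solution H p \<delta> \<omega> ?v" by (rule is_macro_solution_macro_solution[OF \<delta> \<omega>])
    have "viscosity_solution (\<lambda>q x r. \<delta> * r + H' (p + q) x \<omega>) ?v"
    proof (rule viscosity_solution_cong_gradient[OF _ lip[OF p \<delta> \<omega>]])
      show "viscosity_solution (\<lambda>q x r. \<delta> * r + H (p + q) x \<omega>) ?v"
        using v unfolding is_macro_solution_def by blast
      fix q x :: "real^'d" assume "norm q \<le> L"
      then have "norm (p + q) \<le> P + L" using norm_triangle_ineq[of p q] p by linarith
      then show "H (p + q) x \<omega> = H' (p + q) x \<omega>" using eq[OF \<omega>] by simp
    qed
    then have "is_macro_solution H' p \<delta> \<omega> ?v" using v unfolding is_macro_solution_def by blast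
    then show "macro_solution H' p \<delta> \<omega> = ?v"
      by (rule stationary_hamiltonian.macro_solution_eqI[OF H' \<delta> \<omega>])
  qed
qed

end

section \<open>Modifying the Hamiltonian at infinity\<close>

lemma coercive_if_above_norm:
  fixes G :: "real^'d \<Rightarrow> real^'d \<Rightarrow> 'a \<Rightarrow> real"
  assumes "\<And>p y \<omega>. G p y \<omega> \<ge> norm p - c"
  shows "((\<lambda>p. INF (y, \<omega>)\<in>UNIV \<times> space M. ereal (G p y \<omega>)) \<longlongrightarrow> \<infinity>) at_infinity"
  unfolding tendsto_PInfty eventually_at_infinity
proof (intro allI exI impI)
  fix r :: real and p :: "real^'d" assume p: "r + c + 1 \<le> norm p"
  have "ereal r < ereal (norm p - c)" using p by simp
  also have "\<dots> \<le> (INF (y, \<omega>)\<in>UNIV \<times> space M. ereal (G p y \<omega>))"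
    by (rule INF_greatest) (use assms in auto)
  finally show "ereal r < (INF (y, \<omega>)\<in>UNIV \<times> space M. ereal (G p y \<omega>))" .
qed

lemma stationary_hamiltonian_norm:
  "stationary_hamiltonian M \<tau> (\<lambda>(p::real^'d) y \<omega>. norm p - c)"
proof
  show "((\<lambda>p::real^'d. INF (y::real^'d, \<omega>)\<in>UNIV \<times> space M. ereal (norm p - c)) \<longlongrightarrow> \<infinity>) at_infinity"
    by (rule coercive_if_above_norm[of c "\<lambda>p y \<omega>. norm p - c"]) simp
  fix R :: real assume R: "R > 0"
  have "\<bar>norm p - c\<bar> \<le> R + \<bar>c\<bar>" if "p \<in> ball 0 R" for p :: "real^'d"
    using that norm_ge_zero[of p] unfolding mem_ball dist_0_norm by linarith
  then show "\<exists>C>0. \<forall>p\<in>ball (0::real^'d) R. \<forall>y::real^'d. \<forall>\<omega>\<in>space M. \<bar>norm p - c\<bar> \<le> C"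
    using R by (intro exI[of _ "R + \<bar>c\<bar>"]) auto
  have lip: "\<bar>norm p1 - c - (norm p2 - c)\<bar> \<le> 1 * (norm (p1 - p2) + norm (y1 - y2))" for p1 p2 y1 y2 :: "real^'d"
    using order_trans[OF norm_triangle_ineq3[of p1 p2], of "norm (p1 - p2) + norm (y1 - y2)"] by simp
  show "\<exists>C>0. \<forall>p1\<in>ball (0::real^'d) R. \<forall>p2\<in>ball 0 R. \<forall>(y1::real^'d) (y2::real^'d). \<forall>\<omega>\<in>space M.
      \<bar>norm p1 - c - (norm p2 - c)\<bar> \<le> C * (norm (p1 - p2) + norm (y1 - y2))"
    by (intro exI[of _ 1] conjI ballI allI zero_less_one lip)
qed auto

text \<open>
  Cut \<open>H\<close> off at the height \<open>K\<close> and take the maximum with \<open>\<bar>p\<bar> - c\<close>. On the ball of radius \<open>R\<close> the constant \<open>c\<close> keeps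
  the cone below the lower bound \<open>-A\<close> of \<open>H\<close>, and from \<open>\<bar>p\<bar> = c + K\<close> on the cone exceeds the cut-off.
\<close>

lemma (in stationary_hamiltonian) modification_convex_outside_bounded_set:
  assumes R: "R > 0"
  shows "\<exists>H'. stationary_hamiltonian M \<tau> H' \<and> convex_outside_bounded_set M \<tau> H' \<and>
           (\<forall>q y. \<forall>\<omega>\<in>space M. norm q \<le> R \<longrightarrow> H' q y \<omega> = H q y \<omega>)"
proof -
  obtain R0 where R0: "R0 > 0" "\<And>p y \<omega>. \<omega> \<in> space M \<Longrightarrow> norm p \<ge> R0 \<Longrightarrow> H p y \<omega> > 0"
    using coercive_threshold[of 0] by blast
  obtain A where A: "A > 0" "\<And>p y \<omega>. p \<in> ball 0 R0 \<Longrightarrow> \<omega> \<in> space M \<Longrightarrow> \<bar>H p y \<omega>\<bar> \<le> A"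
    using locally_bounded[OF R0(1)] by blast
  have lower: "H p y \<omega> \<ge> - A" if "\<omega> \<in> space M" for p y \<omega>
  proof (cases "norm p \<ge> R0")
    case True
    then show ?thesis using R0(2)[OF that True, of y] A(1) by simp
  next
    case False
    then show ?thesis using A(2)[of p \<omega> y] that by (simp add: abs_le_iff)
  qed
  have "R + 1 > 0" using R by simp
  from locally_bounded[OF this] obtain K where K: "K > 0"
    "\<And>p y \<omega>. p \<in> ball 0 (R + 1) \<Longrightarrow> \<omega> \<in> space M \<Longrightarrow> \<bar>H p y \<omega>\<bar> \<le> K" by blast
  define c where "c = R + A"
  define H' where "H' = (\<lambda>p y \<omega>. max (min (H p y \<omega>) K) (norm p - c))"
  have 1: "stationary_hamiltonian M \<tau> H'"
  proof
    show "(\<lambda>\<omega>. H' p y \<omega>) \<in> borel_measurable M" for p y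
      unfolding H'_def by (intro borel_measurable_max borel_measurable_min measurable_H) auto
    show "H' p (y + z) \<omega> = H' p y (\<tau> z \<omega>)" if "\<omega> \<in> space M" for p y z \<omega>
      unfolding H'_def stationary[OF that] ..
    show "((\<lambda>p. INF (y, \<omega>)\<in>UNIV \<times> space M. ereal (H' p y \<omega>)) \<longlongrightarrow> \<infinity>) at_infinity"
      by (rule coercive_if_above_norm[of c]) (simp add: H'_def)
    fix r :: real assume r: "r > 0"
    obtain C1 where C1: "C1 > 0" "\<And>p y \<omega>. p \<in> ball 0 r \<Longrightarrow> \<omega> \<in> space M \<Longrightarrow> \<bar>H p y \<omega>\<bar> \<le> C1"
      using locally_bounded[OF r] by blast
    have "\<bar>H' p y \<omega>\<bar> \<le> C1 + K + r + \<bar>c\<bar>" if "p \<in> ball 0 r" "\<omega> \<in> space M" for p y \<omega>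
    proof -
      have "\<bar>max (min a K) b\<bar> \<le> \<bar>a\<bar> + K + \<bar>b\<bar>" for a b using K(1) by (auto simp: max_def min_def)
      from this[of "H p y \<omega>" "norm p - c"] show ?thesis
        using C1(2)[OF that, of y] that(1) norm_ge_zero[of p] unfolding H'_def mem_ball dist_0_norm by linarith
    qed
    then show "\<exists>C>0. \<forall>p\<in>ball 0 r. \<forall>y. \<forall>\<omega>\<in>space M. \<bar>H' p y \<omega>\<bar> \<le> C"
      using C1(1) K(1) r by (intro exI[of _ "C1 + K + r + \<bar>c\<bar>"]) auto
    obtain C2 where C2: "C2 > 0" "\<And>p1 p2 y1 y2 \<omega>. p1 \<in> ball 0 r \<Longrightarrow> p2 \<in> ball 0 r \<Longrightarrow> \<omega> \<in> space M \<Longrightarrow>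
        \<bar>H p1 y1 \<omega> - H p2 y2 \<omega>\<bar> \<le> C2 * (norm (p1 - p2) + norm (y1 - y2))"
      using locally_Lipschitz[OF r] by blast
    have "\<bar>H' p1 y1 \<omega> - H' p2 y2 \<omega>\<bar> \<le> (C2 + 1) * (norm (p1 - p2) + norm (y1 - y2))"
      if "p1 \<in> ball 0 r" "p2 \<in> ball 0 r" "\<omega> \<in> space M" for p1 p2 y1 y2 \<omega>
    proof -
      have "\<bar>max (min a K) s - max (min b K) t\<bar> \<le> \<bar>a - b\<bar> + \<bar>s - t\<bar>" for a b s t
        by (auto simp: max_def min_def)
      from this[of "H p1 y1 \<omega>" "norm p1 - c" "H p2 y2 \<omega>" "norm p2 - c"]
      have "\<bar>H' p1 y1 \<omega> - H' p2 y2 \<omega>\<bar> \<le> \<bar>H p1 y1 \<omega> - H p2 y2 \<omega>\<bar> + \<bar>norm p1 - norm p2\<bar>"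
        unfolding H'_def by simp
      also have "\<dots> \<le> C2 * (norm (p1 - p2) + norm (y1 - y2)) + (norm (p1 - p2) + norm (y1 - y2))"
        using C2(2)[OF that, of y1 y2] norm_triangle_ineq3[of p1 p2] norm_ge_zero[of "y1 - y2"] by linarith
      finally show ?thesis by (simp add: algebra_simps)
    qed
    then show "\<exists>C>0. \<forall>p1\<in>ball 0 r. \<forall>p2\<in>ball 0 r. \<forall>y1 y2. \<forall>\<omega>\<in>space M.
         \<bar>H' p1 y1 \<omega> - H' p2 y2 \<omega>\<bar> \<le> C * (norm (p1 - p2) + norm (y1 - y2))"
      using C2(1) by (intro exI[of _ "C2 + 1"]) auto
  qed
  have "convex_on UNIV (\<lambda>p::real^'d. norm p - c)"
  proof (rule convex_onI)
    fix t :: real and x y :: "real^'d" assume t: "t > 0" "t < 1"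
    have "norm ((1 - t) *\<^sub>R x + t *\<^sub>R y) \<le> (1 - t) * norm x + t * norm y"
      using norm_triangle_ineq[of "(1 - t) *\<^sub>R x" "t *\<^sub>R y"] t by simp
    then show "norm ((1 - t) *\<^sub>R x + t *\<^sub>R y) - c \<le> (1 - t) * (norm x - c) + t * (norm y - c)"
      by (simp add: algebra_simps)
  qed simp
  moreover have "norm p - c = H' p y \<omega>" if "p \<notin> ball 0 (c + K)" for p y \<omega>
    using that unfolding H'_def by auto
  moreover have "c + K > 0" unfolding c_def using R A(1) K(1) by simp
  ultimately have 2: "convex_outside_bounded_set M \<tau> H'"
    unfolding convex_outside_bounded_set_def
    by (intro exI[of _ "c + K"] conjI exI[of _ "\<lambda>p y \<omega>. norm p - c"] stationary_hamiltonian_norm) auto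
  have "H' q y \<omega> = H q y \<omega>" if "norm q \<le> R" "\<omega> \<in> space M" for q y \<omega>
    using K(2)[of q \<omega> y] lower[OF that(2), of q y] that unfolding H'_def c_def by auto
  then show ?thesis using 1 2 by blast
qed

section \<open>Ergodicity and the density of visits\<close>

text \<open>By ergodicity \<open>g\<close> exceeds its mean with probability 0 or 1, and probability 1 would put the mean strictly above
  itself; likewise below.\<close>

lemma (in ergodic_environment) invariant_AE_constant:
  fixes g :: "'a \<Rightarrow> real"
  assumes meas: "g \<in> borel_measurable M" and bound: "\<And>\<omega>. \<omega> \<in> space M \<Longrightarrow> \<bar>g \<omega>\<bar> \<le> C"
    and inv: "\<And>z \<omega>. \<omega> \<in> space M \<Longrightarrow> g (\<tau> z \<omega>) = g \<omega>"
  shows "AE \<omega> in M. g \<omega> = expectation g"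
proof -
  have int: "integrable M g"
    by (rule integrable_const_bound[of _ C]) (use meas bound in auto)
  have in_space: "\<tau> z \<omega> \<in> space M" if "\<omega> \<in> space M" for z \<omega>
    using measurable_space[OF measurable_shift that] .
  have zero_one: "prob {\<omega> \<in> space M. g \<omega> \<in> S} = 0 \<or> prob {\<omega> \<in> space M. g \<omega> \<in> S} = 1"
    if S: "S \<in> sets borel" for S
  proof (rule ergodic)
    show "{\<omega> \<in> space M. g \<omega> \<in> S} \<in> events" using meas S by measurable
    show "\<forall>y. \<tau> y ` {\<omega> \<in> space M. g \<omega> \<in> S} = {\<omega> \<in> space M. g \<omega> \<in> S}"
    proof (intro allI equalityI subsetI)
      fix y \<omega> assume "\<omega> \<in> \<tau> y ` {\<omega> \<in> space M. g \<omega> \<in> S}"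
      then show "\<omega> \<in> {\<omega> \<in> space M. g \<omega> \<in> S}" using inv in_space by auto
    next
      fix y \<omega> assume w: "\<omega> \<in> {\<omega> \<in> space M. g \<omega> \<in> S}"
      have "\<omega> = \<tau> y (\<tau> (- y) \<omega>)" using group_add[of \<omega> y "- y"] group_zero w by simp
      moreover have "\<tau> (- y) \<omega> \<in> {\<omega> \<in> space M. g \<omega> \<in> S}" using inv in_space w by simp
      ultimately show "\<omega> \<in> \<tau> y ` {\<omega> \<in> space M. g \<omega> \<in> S}" by blast
    qed
  qed
  let ?c = "expectation g"
  have "AE \<omega> in M. g \<omega> \<le> ?c"
  proof -
    have s: "{\<omega> \<in> space M. g \<omega> \<in> {?c<..}} \<in> events" using meas by measurable
    have "prob {\<omega> \<in> space M. g \<omega> \<in> {?c<..}} \<noteq> 1"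
    proof
      assume "prob {\<omega> \<in> space M. g \<omega> \<in> {?c<..}} = 1"
      then have "AE \<omega> in M. ?c < g \<omega>" using prob_Collect_eq_1[OF s] by simp
      from expectation_greater[OF int this] show False by simp
    qed
    then have "prob {\<omega> \<in> space M. g \<omega> \<in> {?c<..}} = 0" using zero_one[of "{?c<..}"] by simp
    from prob_eq_0[OF s, THEN iffD1, OF this] show ?thesis
      by (rule AE_mp) (auto intro!: AE_I2)
  qed
  moreover have "AE \<omega> in M. ?c \<le> g \<omega>"
  proof -
    have s: "{\<omega> \<in> space M. g \<omega> \<in> {..<?c}} \<in> events" using meas by measurable
    have "prob {\<omega> \<in> space M. g \<omega> \<in> {..<?c}} \<noteq> 1"
    proof
      assume "prob {\<omega> \<in> space M. g \<omega> \<in> {..<?c}} = 1"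
      then have "AE \<omega> in M. g \<omega> < ?c" using prob_Collect_eq_1[OF s] by simp
      from expectation_less[OF int this] show False by simp
    qed
    then have "prob {\<omega> \<in> space M. g \<omega> \<in> {..<?c}} = 0" using zero_one[of "{..<?c}"] by simp
    from prob_eq_0[OF s, THEN iffD1, OF this] show ?thesis
      by (rule AE_mp) (auto intro!: AE_I2)
  qed
  ultimately show ?thesis by eventually_elim simp
qed

definition visits :: "('a \<Rightarrow> 'a) \<Rightarrow> 'a set \<Rightarrow> nat \<Rightarrow> 'a \<Rightarrow> real" where
  "visits T A k \<omega> = (\<Sum>j<k. indicator A ((T ^^ j) \<omega>))"

text \<open>
  The maximum of \<open>0\<close> and the first \<open>n\<close> partial sums of \<open>f\<close> along the orbit. In this recursive form the identity
  behind the maximal inequality holds by definition.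
\<close>

primrec excess :: "('a \<Rightarrow> 'a) \<Rightarrow> ('a \<Rightarrow> real) \<Rightarrow> nat \<Rightarrow> 'a \<Rightarrow> real" where
  "excess T f 0 = (\<lambda>\<omega>. 0)"
| "excess T f (Suc n) = (\<lambda>\<omega>. max 0 (f \<omega> + excess T f n (T \<omega>)))"

lemma excess_nonneg: "0 \<le> excess T f n \<omega>"
  by (cases n) auto

lemma excess_mono: "excess T f n \<omega> \<le> excess T f (Suc n) \<omega>"
proof (induction n arbitrary: \<omega>)
  case (Suc n)
  have "excess T f (Suc n) \<omega> = max 0 (f \<omega> + excess T f n (T \<omega>))"
    and "excess T f (Suc (Suc n)) \<omega> = max 0 (f \<omega> + excess T f (Suc n) (T \<omega>))"
    by (simp_all only: excess.simps)
  then show ?case using Suc[of "T \<omega>"] by (simp only: max.mono add_left_mono order_refl)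
qed simp

lemma partial_sum_le_excess: "(\<Sum>j<n. f ((T ^^ j) \<omega>)) \<le> excess T f n \<omega>"
proof (induction n arbitrary: \<omega>)
  case (Suc n)
  have "(\<Sum>j<Suc n. f ((T ^^ j) \<omega>)) = f \<omega> + (\<Sum>j<n. f ((T ^^ j) (T \<omega>)))"
    unfolding sum.lessThan_Suc_shift by (simp add: funpow_swap1)
  also have "\<dots> \<le> excess T f (Suc n) \<omega>" using Suc[of "T \<omega>"] by simp
  finally show ?case .
qed simp

lemma excess_le:
  assumes "\<And>\<omega>. f \<omega> \<le> c" "c \<ge> 0"
  shows "excess T f n \<omega> \<le> n * c"
proof (induction n arbitrary: \<omega>)
  case (Suc n)
  show ?case using Suc[of "T \<omega>"] assms(1)[of \<omega>] assms(2) by (simp add: algebra_simps)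
qed simp

context prob_space
begin

lemma excess_measurable:
  assumes T: "T \<in> measurable M M" and f: "f \<in> borel_measurable M"
  shows "excess T f n \<in> borel_measurable M"
proof (induction n)
  case (Suc n)
  have "(\<lambda>\<omega>. excess T f n (T \<omega>)) \<in> borel_measurable M" by (rule measurable_compose[OF T Suc])
  then show ?case unfolding excess.simps using f by (intro borel_measurable_max borel_measurable_add) auto
qed simp

text \<open>
  Garsia's proof of the maximal ergodic inequality. Where the maximum \<open>X n\<close> is positive it equals
  \<open>f + X m \<circ> T \<le> f + X n \<circ> T\<close> with \<open>n = m + 1\<close>, and elsewhere it vanishes while \<open>X n \<circ> T \<ge> 0\<close>. Since \<open>T\<close> preserves the
  measure, integrating gives a nonnegative integral of \<open>f\<close> over the set where \<open>X n\<close> is positive.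
\<close>

lemma maximal_inequality:
  fixes \<theta> :: real
  assumes T: "T \<in> measurable M M" and preserving: "distr M M T = M"
    and A: "A \<in> events" and \<theta>: "\<theta> > 0"
  shows "{\<omega> \<in> space M. \<exists>k. visits T A k \<omega> > \<theta> * k} \<in> events"
    and "prob {\<omega> \<in> space M. \<exists>k. visits T A k \<omega> > \<theta> * k} \<le> prob A / \<theta>"
proof -
  define f where "f = (\<lambda>\<omega>. indicator A \<omega> - \<theta>)"
  define X where "X = excess T f"
  define E where "E = (\<lambda>n. {\<omega> \<in> space M. X n \<omega> > 0})"
  have f_meas: "f \<in> borel_measurable M" 
  proof -
    have "(indicator A :: 'a \<Rightarrow> real) \<in> borel_measurable M" by (rule borel_measurable_indicator[OF A])
    then show ?thesis unfolding f_def by simp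
  qed
  have X_meas: "X n \<in> borel_measurable M" for n unfolding X_def by (rule excess_measurable[OF T f_meas])
  have f_le: "f \<omega> \<le> 1" "\<bar>f \<omega>\<bar> \<le> 1 + \<theta>" for \<omega> unfolding f_def using \<theta> by (auto simp: indicator_def)
  have X_abs: "\<bar>X n \<omega>\<bar> \<le> n" for n \<omega>
    unfolding X_def using excess_le[of f 1 T n \<omega>] f_le excess_nonneg[of T f n \<omega>] by simp
  have E_events: "E n \<in> events" for n unfolding E_def using X_meas[of n] by measurable
  have E_bound: "prob (E n) \<le> prob A / \<theta>" for n
  proof (cases n)
    case 0
    then show ?thesis unfolding E_def X_def using \<theta> by simp
  next
    case (Suc m)
    have XT_meas: "(\<lambda>\<omega>. X n (T \<omega>)) \<in> borel_measurable M" by (rule measurable_compose[OF T X_meas])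
    have intX: "integrable M (X n)"
      by (rule integrable_const_bound[of _ n]) (use X_meas X_abs in auto)
    have intXT: "integrable M (\<lambda>\<omega>. X n (T \<omega>))"
      by (rule integrable_const_bound[of _ n]) (use XT_meas X_abs in auto)
    have intf: "integrable M (\<lambda>\<omega>. indicator (E n) \<omega> * f \<omega>)"
    proof (rule integrable_const_bound[of _ "1 + \<theta>"])
      show "(\<lambda>\<omega>. indicator (E n) \<omega> * f \<omega>) \<in> borel_measurable M" using E_events f_meas by measurable
      show "AE \<omega> in M. norm (indicator (E n) \<omega> * f \<omega>) \<le> 1 + \<theta>"
        using f_le \<theta> by (auto simp: indicator_def)
    qed
    have "expectation (X n) = integral\<^sup>L (distr M M T) (X n)" unfolding preserving ..
    also have "\<dots> = expectation (\<lambda>\<omega>. X n (T \<omega>))" by (rule integral_distr[OF T X_meas])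
    finally have "0 = expectation (\<lambda>\<omega>. X n \<omega> - X n (T \<omega>))" using intX intXT by simp
    also have "\<dots> \<le> expectation (\<lambda>\<omega>. indicator (E n) \<omega> * f \<omega>)"
    proof (rule integral_mono[OF _ intf])
      show "integrable M (\<lambda>\<omega>. X n \<omega> - X n (T \<omega>))" using intX intXT by simp
      fix \<omega> assume \<omega>: "\<omega> \<in> space M"
      show "X n \<omega> - X n (T \<omega>) \<le> indicator (E n) \<omega> * f \<omega>"
      proof (cases "\<omega> \<in> E n")
        case True
        then have "X n \<omega> = f \<omega> + X m (T \<omega>)" unfolding E_def X_def Suc by (auto simp: max_def split: if_splits)
        moreover have "X m (T \<omega>) \<le> X n (T \<omega>)" unfolding X_def Suc by (rule excess_mono)
        ultimately show ?thesis using True by simp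
      next
        case False
        then have "X n \<omega> \<le> 0" using \<omega> unfolding E_def by simp
        then show ?thesis using False excess_nonneg[of T f n "T \<omega>"] unfolding X_def by simp
      qed
    qed
    also have "\<dots> \<le> expectation (\<lambda>\<omega>. indicator A \<omega> - \<theta> * indicator (E n) \<omega>)"
    proof (rule integral_mono[OF intf])
      show "integrable M (\<lambda>\<omega>. indicator A \<omega> - \<theta> * indicator (E n) \<omega>)"
        using A E_events[of n] by (intro Bochner_Integration.integrable_diff integrable_mult_right) (auto simp: less_top[symmetric])
      show "indicator (E n) \<omega> * f \<omega> \<le> indicator A \<omega> - \<theta> * indicator (E n) \<omega>" for \<omega>
        unfolding f_def by (auto simp: indicator_def)
    qed
    also have "\<dots> = prob A - \<theta> * prob (E n)"
      using A E_events[of n] by (subst Bochner_Integration.integral_diff) (auto simp: less_top[symmetric])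
    finally show ?thesis using \<theta> by (simp add: field_simps)
  qed
  have visits_meas: "visits T A k \<in> borel_measurable M" for k
  proof -
    have Tj: "T ^^ j \<in> measurable M M" for j
    proof (induction j)
      case (Suc j)
      then show ?case using measurable_comp[OF Suc T] by (simp add: comp_def)
    qed (simp add: id_def)
    have "(\<lambda>\<omega>. indicator A ((T ^^ j) \<omega>) :: real) \<in> borel_measurable M" for j
      by (rule measurable_compose[OF Tj borel_measurable_indicator[OF A]])
    then show ?thesis unfolding visits_def[abs_def] by (intro borel_measurable_sum) auto
  qed
  let ?W = "{\<omega> \<in> space M. \<exists>k. visits T A k \<omega> > \<theta> * k}"
  show "?W \<in> events" using visits_meas by measurable
  have "incseq E"
  proof (rule incseq_SucI)
    show "E n \<subseteq> E (Suc n)" for n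
      unfolding E_def X_def using excess_mono[of T f n] less_le_trans by blast
  qed
  then have "(\<lambda>n. prob (E n)) \<longlonglongrightarrow> prob (\<Union>n. E n)"
    using E_events by (intro finite_Lim_measure_incseq) auto
  then have "prob (\<Union>n. E n) \<le> prob A / \<theta>"
    by (rule LIMSEQ_le_const2) (use E_bound in blast)
  moreover have "?W \<subseteq> (\<Union>n. E n)"
  proof
    fix \<omega> assume "\<omega> \<in> ?W"
    then obtain k where k: "\<omega> \<in> space M" "visits T A k \<omega> > \<theta> * k" by blast
    have "(\<Sum>j<k. f ((T ^^ j) \<omega>)) = visits T A k \<omega> - \<theta> * k"
      unfolding f_def visits_def sum_subtractf by (simp add: mult.commute)
    then have "X k \<omega> > 0" using partial_sum_le_excess[of f T \<omega> k] k unfolding X_def by simp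
    then show "\<omega> \<in> (\<Union>n. E n)" using k unfolding E_def by blast
  qed
  moreover have "(\<Union>n. E n) \<in> events" using E_events by auto
  ultimately show "prob ?W \<le> prob A / \<theta>"
    using finite_measure_mono[of ?W "\<Union>n. E n"] by linarith
qed

text \<open>
  The events on which some visit frequency to \<open>B n\<close> exceeds \<open>\<theta>\<close> have probability at most \<open>P (B n) / \<theta>\<close>, so almost no
  environment belongs to all of them.
\<close>

lemma AE_rare_visits:
  fixes \<theta> :: real
  assumes T: "T \<in> measurable M M" and preserving: "distr M M T = M"
    and B: "\<And>n. B n \<in> events" "(\<lambda>n. prob (B n)) \<longlonglongrightarrow> 0" and \<theta>: "\<theta> > 0"
  shows "AE \<omega> in M. \<exists>n. \<forall>k. visits T (B n) k \<omega> \<le> \<theta> * k"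
proof -
  define W where "W = (\<lambda>n. {\<omega> \<in> space M. \<exists>k. visits T (B n) k \<omega> > \<theta> * k})"
  have W: "W n \<in> events" "prob (W n) \<le> prob (B n) / \<theta>" for n
    unfolding W_def using maximal_inequality[OF T preserving B(1) \<theta>] by auto
  have INT: "(\<Inter>n. W n) \<in> events" using W(1) by auto
  have "prob (\<Inter>n. W n) \<le> prob (B n) / \<theta>" for n
    using finite_measure_mono[OF _ W(1), of "\<Inter>n. W n" n] W(2)[of n] by (auto intro: order_trans)
  moreover have "(\<lambda>n. prob (B n) / \<theta>) \<longlonglongrightarrow> 0 / \<theta>" using \<theta> by (intro tendsto_divide B(2)) auto
  ultimately have "prob (\<Inter>n. W n) \<le> 0 / \<theta>" by (intro LIMSEQ_le_const[of "\<lambda>n. prob (B n) / \<theta>"]) auto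
  then have "prob (\<Inter>n. W n) = 0" by (simp add: measure_le_0_iff)
  from prob_eq_0[OF INT, THEN iffD1, OF this] show ?thesis
    by (rule AE_mp) (auto intro!: AE_I2 simp: W_def not_less)
qed

end

text \<open>
  A block of more than \<open>2 \<theta> N\<close> consecutive visits after time \<open>N\<close> would violate the frequency bound, since
  \<open>\<theta> \<le> 1/2\<close>.
\<close>

lemma exists_non_visit:
  fixes \<theta> :: real and N :: nat
  assumes rare: "\<And>k. visits T B k \<omega> \<le> \<theta> * k" and \<theta>: "0 < \<theta>" "\<theta> \<le> 1 / 2"
  obtains j where "N \<le> j" "real j \<le> N + 2 * \<theta> * N" "(T ^^ j) \<omega> \<notin> B"
proof -
  define s where "s = nat \<lfloor>2 * \<theta> * N\<rfloor> + 1"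
  have s: "2 * \<theta> * N < s" "real s \<le> 2 * \<theta> * N + 1"
  proof -
    have "2 * \<theta> * N \<ge> 0" using \<theta> by simp
    then show "2 * \<theta> * N < s" "real s \<le> 2 * \<theta> * N + 1" unfolding s_def by linarith+
  qed
  have "\<exists>j. N \<le> j \<and> j < N + s \<and> (T ^^ j) \<omega> \<notin> B"
  proof (rule ccontr)
    assume "\<not> ?thesis"
    then have all: "(T ^^ j) \<omega> \<in> B" if "j \<in> {N..<N + s}" for j using that by auto
    have "real s = (\<Sum>j\<in>{N..<N + s}. indicator B ((T ^^ j) \<omega>))" using all by simp
    also have "\<dots> \<le> visits T B (N + s) \<omega>"
      unfolding visits_def by (rule sum_mono2) auto
    also have "\<dots> \<le> \<theta> * (N + s)" using rare[of "N + s"] by simp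
    also have "\<dots> = \<theta> * N + \<theta> * s" by (simp add: algebra_simps)
    also have "\<dots> \<le> \<theta> * N + 1 / 2 * s" using \<theta> by (intro add_left_mono mult_right_mono) auto
    finally show False using s by simp
  qed
  then obtain j where j: "N \<le> j" "j < N + s" "(T ^^ j) \<omega> \<notin> B" by blast
  then have "j + 1 \<le> N + s" by simp
  then have "real j + 1 \<le> N + s" by linarith
  then have "real j \<le> N + 2 * \<theta> * N" using s(2) by simp
  then show ?thesis using that j by blast
qed

section \<open>The effective Hamiltonian\<close>

locale homogenization_setting =
  ergodic_environment M \<tau> + stationary_hamiltonian M \<tau> H
  for M :: "'a measure" and \<tau> :: "real^'d \<Rightarrow> 'a \<Rightarrow> 'a" and H :: "real^'d \<Rightarrow> real^'d \<Rightarrow> 'a \<Rightarrow> real" +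
  assumes limit_if_convex_outside: "\<And>H' :: real^'d \<Rightarrow> real^'d \<Rightarrow> 'a \<Rightarrow> real.
           stationary_hamiltonian M \<tau> H' \<Longrightarrow> convex_outside_bounded_set M \<tau> H' \<Longrightarrow>
           \<exists>\<Omega>8. full_probability M \<Omega>8 \<and>
             (\<forall>\<omega>\<in>\<Omega>8. \<forall>p. \<exists>L::real.
                ((\<lambda>\<delta>. - \<delta> * macro_solution H' p \<delta> \<omega> 0) \<longlongrightarrow> L) (at_right 0))"
begin

abbreviation v :: "real^'d \<Rightarrow> real \<Rightarrow> 'a \<Rightarrow> real^'d \<Rightarrow> real" where
  "v \<equiv> macro_solution H"

lemma shift_in_space: "\<omega> \<in> space M \<Longrightarrow> \<tau> z \<omega> \<in> space M"
  using measurable_space[OF measurable_shift] .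

lemma AE_of_full_probability:
  assumes "full_probability M A" "\<And>\<omega>. \<omega> \<in> A \<Longrightarrow> P \<omega>"
  shows "AE \<omega> in M. P \<omega>"
proof -
  have "AE \<omega> in M. \<omega> \<in> A"
    using assms(1) AE_in_set_eq_1 unfolding full_probability_def by blast
  then show ?thesis by eventually_elim (rule assms(2))
qed

lemma full_probability_of_AE:
  assumes "AE \<omega> in M. P \<omega>"
  shows "\<exists>A. full_probability M A \<and> (\<forall>\<omega>\<in>A. \<omega> \<in> space M \<and> P \<omega>)"
proof -
  obtain S where "S \<subseteq> {\<omega> \<in> space M. P \<omega>}" "S \<in> events" "prob S = 1"
    using AE_E_prob[OF assms] by blast
  then show ?thesis unfolding full_probability_def by (intro exI[of _ S]) auto
qed

lemma AE_exists: "AE \<omega> in M. P \<omega> \<Longrightarrow> \<exists>\<omega>\<in>space M. P \<omega>"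
proof -
  assume "AE \<omega> in M. P \<omega>"
  then obtain A where A: "full_probability M A" "\<forall>\<omega>\<in>A. \<omega> \<in> space M \<and> P \<omega>"
    using full_probability_of_AE by blast
  then have "A \<noteq> {}" unfolding full_probability_def by auto
  then show ?thesis using A by blast
qed

text \<open>
  The hypothesis for the modifications of \<open>H\<close> that agree with \<open>H\<close> on the gradients reached by solutions
  corresponding to \<open>\<bar>p\<bar> \<le> n + 1\<close>, for all \<open>n\<close>.
\<close>

lemma AE_limit_exists:
  "AE \<omega> in M. \<forall>p. \<exists>L::real. ((\<lambda>\<delta>. - \<delta> * v p \<delta> \<omega> 0) \<longlongrightarrow> L) (at_right 0)"
proof -
  have "AE \<omega> in M. \<forall>p. norm p \<le> real (Suc n) \<longrightarrow> (\<exists>L::real. ((\<lambda>\<delta>. - \<delta> * v p \<delta> \<omega> 0) \<longlongrightarrow> L) (at_right 0))" for n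
  proof -
    have n: "real (Suc n) > 0" by simp
    obtain R where R: "R > 0"
      and eq: "\<And>H' p \<delta> \<omega>. stationary_hamiltonian M \<tau> H' \<Longrightarrow>
       (\<And>q y \<omega>. \<omega> \<in> space M \<Longrightarrow> norm q \<le> R \<Longrightarrow> H' q y \<omega> = H q y \<omega>) \<Longrightarrow>
       norm p \<le> real (Suc n) \<Longrightarrow> \<delta> > 0 \<Longrightarrow> \<omega> \<in> space M \<Longrightarrow> macro_solution H' p \<delta> \<omega> = v p \<delta> \<omega>"
      using macro_solution_cong_hamiltonian[OF n] by blast
    obtain H' where H': "stationary_hamiltonian M \<tau> H'" "convex_outside_bounded_set M \<tau> H'"
      "\<And>q y \<omega>. \<omega> \<in> space M \<Longrightarrow> norm q \<le> R \<Longrightarrow> H' q y \<omega> = H q y \<omega>"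
      using modification_convex_outside_bounded_set[OF R] by blast
    obtain \<Omega>8 where \<Omega>8: "full_probability M \<Omega>8"
      "\<And>\<omega> p. \<omega> \<in> \<Omega>8 \<Longrightarrow> \<exists>L::real. ((\<lambda>\<delta>. - \<delta> * macro_solution H' p \<delta> \<omega> 0) \<longlongrightarrow> L) (at_right 0)"
      using limit_if_convex_outside[OF H'(1,2)] by blast
    show ?thesis
    proof (rule AE_of_full_probability[OF \<Omega>8(1)], intro allI impI)
      fix \<omega> and p :: "real^'d" assume \<omega>: "\<omega> \<in> \<Omega>8" and p: "norm p \<le> real (Suc n)"
      have \<omega>_space: "\<omega> \<in> space M"
        using \<omega> \<Omega>8(1) sets.sets_into_space unfolding full_probability_def by blast
      obtain L where L: "((\<lambda>\<delta>. - \<delta> * macro_solution H' p \<delta> \<omega> 0) \<longlongrightarrow> L) (at_right 0)"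
        using \<Omega>8(2)[OF \<omega>] by blast
      have ev: "eventually (\<lambda>\<delta>. - \<delta> * macro_solution H' p \<delta> \<omega> 0 = - \<delta> * v p \<delta> \<omega> 0) (at_right 0)"
        using eventually_at_right_less[of "0::real"]
        by eventually_elim (simp add: eq[OF H'(1,3) p _ \<omega>_space])
      show "\<exists>L::real. ((\<lambda>\<delta>. - \<delta> * v p \<delta> \<omega> 0) \<longlongrightarrow> L) (at_right 0)"
        using Lim_transform_eventually[OF L ev] by blast
    qed
  qed
  then have "AE \<omega> in M. \<forall>n p. norm p \<le> real (Suc n) \<longrightarrow> (\<exists>L::real. ((\<lambda>\<delta>. - \<delta> * v p \<delta> \<omega> 0) \<longlongrightarrow> L) (at_right 0))"
    by (simp only: AE_all_countable) blast
  then show ?thesis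
  proof eventually_elim
    case (elim \<omega>)
    show ?case
    proof
      fix p :: "real^'d"
      obtain n where "norm p \<le> real n" using real_arch_simple by blast
      then have "norm p \<le> real (Suc n)" by simp
      then show "\<exists>L::real. ((\<lambda>\<delta>. - \<delta> * v p \<delta> \<omega> 0) \<longlongrightarrow> L) (at_right 0)" using elim by blast
    qed
  qed
qed

definition scale :: "nat \<Rightarrow> real" where "scale k = 1 / real (Suc k)"

lemma scale_pos: "scale k > 0"
  unfolding scale_def by simp

lemma scale_tendsto: "scale \<longlonglongrightarrow> 0"
  unfolding scale_def[abs_def] using LIMSEQ_inverse_real_of_nat by (simp add: inverse_eq_divide)

lemma scale_at_right: "filterlim scale (at_right 0) sequentially"
  unfolding filterlim_at using scale_tendsto by (simp add: scale_pos less_imp_neq[OF scale_pos, symmetric])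

lemma norm_plus_one: "norm p \<le> norm p + 1" "norm (p::real^'d) + 1 > 0"
  by (auto simp: add_nonneg_pos)

text \<open>
  Work with the upper limit along \<open>scale\<close>. It is defined and exactly invariant for every environment, as ergodicity
  demands, whereas the limit itself exists only almost surely; where it exists the two agree.
\<close>

lemma limit_deterministic:
  "\<exists>c. AE \<omega> in M. ((\<lambda>\<delta>. - \<delta> * v p \<delta> \<omega> 0) \<longlongrightarrow> c) (at_right 0)"
proof -
  obtain C L where C: "\<And>\<delta> \<omega> x. \<delta> > 0 \<Longrightarrow> \<omega> \<in> space M \<Longrightarrow> \<bar>\<delta> * v p \<delta> \<omega> x\<bar> \<le> C"
    and lip: "\<And>\<delta> \<omega>. \<delta> > 0 \<Longrightarrow> \<omega> \<in> space M \<Longrightarrow> L-lipschitz_on UNIV (v p \<delta> \<omega>)"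
    using macro_solution_bounds[OF norm_plus_one(2)[of p]] norm_plus_one(1)[of p] by metis
  define a where "a = (\<lambda>k \<omega>. - scale k * v p (scale k) \<omega> 0)"
  define l where "l = (\<lambda>\<omega>. limsup (\<lambda>k. ereal (a k \<omega>)))"
  have a_bound: "\<bar>a k \<omega>\<bar> \<le> C" if "\<omega> \<in> space M" for k \<omega>
    using C[OF scale_pos that, of k 0] unfolding a_def by simp
  have a_meas: "a k \<in> borel_measurable M" for k
    unfolding a_def by (intro borel_measurable_times macro_solution_measurable scale_pos) auto
  have l_meas: "l \<in> borel_measurable M"
    unfolding l_def using a_meas by (intro borel_measurable_limsup borel_measurable_ereal) auto
  have l_bound: "ereal (- C) \<le> l \<omega>" "l \<omega> \<le> ereal C" if "\<omega> \<in> space M" for \<omega>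
  proof -
    show "l \<omega> \<le> ereal C" unfolding l_def
      by (rule Limsup_bounded) (use a_bound[OF that] in \<open>auto simp: abs_le_iff\<close>)
    have "- C \<le> a k \<omega>" for k using a_bound[OF that, of k] by simp
    then have "liminf (\<lambda>k. ereal (a k \<omega>)) \<ge> ereal (- C)"
      by (intro Liminf_bounded) auto
    then show "ereal (- C) \<le> l \<omega>" unfolding l_def
      using Liminf_le_Limsup[of sequentially "\<lambda>k. ereal (a k \<omega>)"] by (simp add: order_trans)
  qed
  have l_inv: "l (\<tau> z \<omega>) = l \<omega>" if \<omega>: "\<omega> \<in> space M" for z \<omega>
  proof -
    have "(\<lambda>k. a k (\<tau> z \<omega>) - a k \<omega>) \<longlonglongrightarrow> 0"
    proof (rule Lim_null_comparison[OF always_eventually])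
      show "\<forall>k. norm (a k (\<tau> z \<omega>) - a k \<omega>) \<le> scale k * (L * norm z)"
      proof
        fix k
        have "a k (\<tau> z \<omega>) - a k \<omega> = scale k * (v p (scale k) \<omega> 0 - v p (scale k) \<omega> z)"
          unfolding a_def macro_solution_stationary[OF scale_pos \<omega> shift_in_space[OF \<omega>]]
          by (simp add: right_diff_distrib)
        moreover have "\<bar>v p (scale k) \<omega> 0 - v p (scale k) \<omega> z\<bar> \<le> L * norm z"
          using lipschitz_onD[OF lip[OF scale_pos \<omega>], of 0 z k] by (simp add: dist_real_def)
        ultimately show "norm (a k (\<tau> z \<omega>) - a k \<omega>) \<le> scale k * (L * norm z)"
          using scale_pos[of k] by (simp add: abs_mult)
      qed
      have "(\<lambda>k. scale k * (L * norm z)) \<longlonglongrightarrow> 0 * (L * norm z)" by (intro tendsto_intros scale_tendsto)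
      then show "(\<lambda>k. scale k * (L * norm z)) \<longlonglongrightarrow> 0" by simp
    qed
    then have "(\<lambda>k. ereal (a k (\<tau> z \<omega>) - a k \<omega>)) \<longlonglongrightarrow> ereal 0" by simp
    from ereal_limsup_lim_add[OF this, of "\<lambda>k. ereal (a k \<omega>)"]
    show ?thesis unfolding l_def by simp
  qed
  define g where "g = (\<lambda>\<omega>. real_of_ereal (l \<omega>))"
  have l_g: "l \<omega> = ereal (g \<omega>)" if "\<omega> \<in> space M" for \<omega>
    using l_bound[OF that] unfolding g_def by (cases "l \<omega>") auto
  have "AE \<omega> in M. g \<omega> = expectation g"
  proof (rule invariant_AE_constant)
    show "g \<in> borel_measurable M" unfolding g_def using l_meas by measurable
    show "\<bar>g \<omega>\<bar> \<le> C" if "\<omega> \<in> space M" for \<omega>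
      using l_bound[OF that] l_g[OF that] by (simp add: abs_le_iff)
    show "g (\<tau> z \<omega>) = g \<omega>" if "\<omega> \<in> space M" for z \<omega>
      unfolding g_def l_inv[OF that] ..
  qed
  then have "AE \<omega> in M. ((\<lambda>\<delta>. - \<delta> * v p \<delta> \<omega> 0) \<longlongrightarrow> expectation g) (at_right 0)"
    using AE_limit_exists AE_space
  proof eventually_elim
    case (elim \<omega>)
    then obtain K where K: "((\<lambda>\<delta>. - \<delta> * v p \<delta> \<omega> 0) \<longlongrightarrow> K) (at_right 0)" by blast
    have "(\<lambda>k. a k \<omega>) \<longlonglongrightarrow> K"
      unfolding a_def using filterlim_compose[OF K scale_at_right] .
    then have "(\<lambda>k. ereal (a k \<omega>)) \<longlonglongrightarrow> ereal K" by simp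
    then have "l \<omega> = ereal K" unfolding l_def by (intro lim_imp_Limsup) auto
    then have "K = expectation g" using l_g elim by simp
    then show ?case using K by simp
  qed
  then show ?thesis by blast
qed

definition Hbar :: "real^'d \<Rightarrow> real" where
  "Hbar p = (SOME c. AE \<omega> in M. ((\<lambda>\<delta>. - \<delta> * v p \<delta> \<omega> 0) \<longlongrightarrow> c) (at_right 0))"

lemma AE_tendsto_Hbar: "AE \<omega> in M. ((\<lambda>\<delta>. - \<delta> * v p \<delta> \<omega> 0) \<longlongrightarrow> Hbar p) (at_right 0)"
  unfolding Hbar_def by (rule someI_ex) (rule limit_deterministic)

lemma limit_lipschitz:
  assumes K: "\<And>\<delta>. \<delta> > 0 \<Longrightarrow> \<bar>\<delta> * v p \<delta> \<omega> 0 - \<delta> * v p' \<delta> \<omega> 0\<bar> \<le> B"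
    and a: "((\<lambda>\<delta>. - \<delta> * v p \<delta> \<omega> 0) \<longlongrightarrow> a) (at_right 0)"
    and b: "((\<lambda>\<delta>. - \<delta> * v p' \<delta> \<omega> 0) \<longlongrightarrow> b) (at_right 0)"
  shows "\<bar>a - b\<bar> \<le> B"
proof (rule tendsto_upperbound)
  show "((\<lambda>\<delta>. \<bar>- \<delta> * v p \<delta> \<omega> 0 - - \<delta> * v p' \<delta> \<omega> 0\<bar>) \<longlongrightarrow> \<bar>a - b\<bar>) (at_right 0)"
    by (intro tendsto_intros a b)
  show "eventually (\<lambda>\<delta>. \<bar>- \<delta> * v p \<delta> \<omega> 0 - - \<delta> * v p' \<delta> \<omega> 0\<bar> \<le> B) (at_right 0)"
    using eventually_at_right_less[of "0::real"]
  proof eventually_elim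
    case (elim \<delta>)
    then show ?case using K[of \<delta>] by simp
  qed
qed simp

lemma Hbar_lipschitz:
  assumes K: "\<And>\<delta> \<omega>. \<delta> > 0 \<Longrightarrow> \<omega> \<in> space M \<Longrightarrow> \<bar>\<delta> * v p \<delta> \<omega> 0 - \<delta> * v p' \<delta> \<omega> 0\<bar> \<le> B"
  shows "\<bar>Hbar p - Hbar p'\<bar> \<le> B"
proof -
  have "AE \<omega> in M. ((\<lambda>\<delta>. - \<delta> * v p \<delta> \<omega> 0) \<longlongrightarrow> Hbar p) (at_right 0) \<and>
      ((\<lambda>\<delta>. - \<delta> * v p' \<delta> \<omega> 0) \<longlongrightarrow> Hbar p') (at_right 0)"
    using AE_tendsto_Hbar[of p] AE_tendsto_Hbar[of p'] by eventually_elim blast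
  from AE_exists[OF this] obtain \<omega> where "\<omega> \<in> space M"
    "((\<lambda>\<delta>. - \<delta> * v p \<delta> \<omega> 0) \<longlongrightarrow> Hbar p) (at_right 0)"
    "((\<lambda>\<delta>. - \<delta> * v p' \<delta> \<omega> 0) \<longlongrightarrow> Hbar p') (at_right 0)" by blast
  then show ?thesis using limit_lipschitz[of p \<omega> p' B] K by blast
qed

lemma countable_dense:
  obtains D :: "(real^'d) set" where "countable D" "closure D = UNIV"
proof -
  obtain D :: "(real^'d) set" where D: "countable D" "\<And>X. open X \<Longrightarrow> X \<noteq> {} \<Longrightarrow> \<exists>d\<in>D. d \<in> X"
    by (rule countable_dense_setE) blast
  have "x \<in> closure D" for x
    unfolding closure_approachable
  proof (intro allI impI)
    fix e :: real assume "e > 0"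
    then show "\<exists>y\<in>D. dist y x < e" using D(2)[of "ball x e"] by (auto simp: dist_commute)
  qed
  then show ?thesis using that D(1) by blast
qed

text \<open>A single null set serves all \<open>p\<close>: take countably many, dense \<open>p\<close>, and use that both sides are Lipschitz in \<open>p\<close>.\<close>

lemma AE_tendsto_Hbar_all: "AE \<omega> in M. \<forall>p. ((\<lambda>\<delta>. - \<delta> * v p \<delta> \<omega> 0) \<longlongrightarrow> Hbar p) (at_right 0)"
proof -
  obtain D :: "(real^'d) set" where D: "countable D" "closure D = UNIV" by (rule countable_dense)
  have "AE \<omega> in M. \<forall>p\<in>D. ((\<lambda>\<delta>. - \<delta> * v p \<delta> \<omega> 0) \<longlongrightarrow> Hbar p) (at_right 0)"
    using AE_tendsto_Hbar by (subst AE_ball_countable[OF D(1)]) blast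
  then show ?thesis
    using AE_limit_exists AE_space
  proof eventually_elim
    case (elim \<omega>)
    show ?case
    proof
      fix p
      obtain l where l: "((\<lambda>\<delta>. - \<delta> * v p \<delta> \<omega> 0) \<longlongrightarrow> l) (at_right 0)" using elim by blast
      have "norm p + 1 > 0" by (simp add: add_nonneg_pos)
      from macro_solution_bounds[OF this] obtain K where K: "K \<ge> 0"
        "\<And>p' \<delta> \<omega> x. norm p' \<le> norm p + 1 \<Longrightarrow> \<delta> > 0 \<Longrightarrow> \<omega> \<in> space M \<Longrightarrow>
          \<bar>\<delta> * v p \<delta> \<omega> x - \<delta> * v p' \<delta> \<omega> x\<bar> \<le> K * norm (p - p')"
        by (metis norm_plus_one(1))
      have "\<bar>l - Hbar p\<bar> \<le> 0"
      proof (rule field_le_epsilon)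
        fix e :: real assume e: "e > 0"
        define r where "r = min 1 (e / (2 * (K + 1)))"
        have r: "r > 0" "r \<le> 1" unfolding r_def using e K by auto
        have "K * r \<le> e / 2"
        proof -
          have "K * r \<le> (K + 1) * (e / (2 * (K + 1)))" unfolding r_def using K e by (intro mult_mono) auto
          also have "\<dots> = e / 2" using K by (simp add: field_simps)
          finally show ?thesis .
        qed
        obtain p' where p': "p' \<in> D" "dist p' p < r" using D(2) r closure_approachable by blast
        have "norm p' \<le> norm p + 1"
          using p'(2) r norm_triangle_ineq2[of p' p] by (simp add: dist_norm)
        note Kp = K(2)[OF this]
        have "norm (p - p') \<le> r" using p' by (simp add: dist_norm norm_minus_commute)
        then have Kr: "K * norm (p - p') \<le> K * r" using K(1) by (rule mult_left_mono)
        have "\<bar>l - Hbar p'\<bar> \<le> K * norm (p - p')"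
          using elim p'(1) Kp by (intro limit_lipschitz[OF _ l]) auto
        moreover have "\<bar>Hbar p - Hbar p'\<bar> \<le> K * norm (p - p')" using Kp by (intro Hbar_lipschitz)
        ultimately show "\<bar>l - Hbar p\<bar> \<le> 0 + e" using Kr \<open>K * r \<le> e / 2\<close> by linarith
      qed
      then show "((\<lambda>\<delta>. - \<delta> * v p \<delta> \<omega> 0) \<longlongrightarrow> Hbar p) (at_right 0)" using l by simp
    qed
  qed
qed

lemma effective_hamiltonian_eq: "effective_hamiltonian M H = Hbar"
  unfolding effective_hamiltonian_def
proof (rule the_equality)
  obtain A where A: "full_probability M A"
    "\<forall>\<omega>\<in>A. \<omega> \<in> space M \<and> (\<forall>p. ((\<lambda>\<delta>. - \<delta> * v p \<delta> \<omega> 0) \<longlongrightarrow> Hbar p) (at_right 0))"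
    using full_probability_of_AE[OF AE_tendsto_Hbar_all] by blast
  have "Limsup (at_right 0) (\<lambda>\<delta>. ereal (- \<delta> * v p \<delta> \<omega> 0)) = ereal (Hbar p)" if "\<omega> \<in> A" for \<omega> p
  proof (rule lim_imp_Limsup)
    show "((\<lambda>\<delta>. ereal (- \<delta> * v p \<delta> \<omega> 0)) \<longlongrightarrow> ereal (Hbar p)) (at_right 0)"
      using A that by (intro tendsto_ereal) blast
  qed simp
  then show ex: "\<exists>\<Omega>1. full_probability M \<Omega>1 \<and> (\<forall>p. \<forall>\<omega>\<in>\<Omega>1.
      Limsup (at_right 0) (\<lambda>\<delta>. ereal (- \<delta> * v p \<delta> \<omega> 0)) = ereal (Hbar p))"
    using A(1) by blast
  fix h' assume "\<exists>\<Omega>1. full_probability M \<Omega>1 \<and> (\<forall>p. \<forall>\<omega>\<in>\<Omega>1.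
      Limsup (at_right 0) (\<lambda>\<delta>. ereal (- \<delta> * v p \<delta> \<omega> 0)) = ereal (h' p))"
  then obtain A' where A': "full_probability M A'" "\<And>p \<omega>. \<omega> \<in> A' \<Longrightarrow>
      Limsup (at_right 0) (\<lambda>\<delta>. ereal (- \<delta> * v p \<delta> \<omega> 0)) = ereal (h' p)" by blast
  from ex obtain B where B: "full_probability M B" "\<And>p \<omega>. \<omega> \<in> B \<Longrightarrow>
      Limsup (at_right 0) (\<lambda>\<delta>. ereal (- \<delta> * v p \<delta> \<omega> 0)) = ereal (Hbar p)" by blast
  have "AE \<omega> in M. \<omega> \<in> A'" by (rule AE_of_full_probability[OF A'(1)])
  moreover have "AE \<omega> in M. \<omega> \<in> B" by (rule AE_of_full_probability[OF B(1)])
  ultimately have "AE \<omega> in M. \<omega> \<in> A' \<and> \<omega> \<in> B" by eventually_elim blast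
  from AE_exists[OF this] obtain \<omega> where "\<omega> \<in> A'" "\<omega> \<in> B" by blast
  then show "h' = Hbar" using A'(2) B(2) by (intro ext) (metis ereal.inject)
qed

section \<open>Convergence on large balls\<close>

definition bad :: "real^'d \<Rightarrow> real \<Rightarrow> nat \<Rightarrow> 'a set" where
  "bad p \<eta> n = {\<omega> \<in> space M. \<exists>k\<ge>n. \<bar>Hbar p + scale k * v p (scale k) \<omega> 0\<bar> > \<eta>}"

lemma bad_events: "bad p \<eta> n \<in> events"
proof -
  have "(\<lambda>\<omega>. v p (scale k) \<omega> 0) \<in> borel_measurable M" for k by (rule macro_solution_measurable[OF scale_pos])
  then show ?thesis unfolding bad_def by measurable
qed

lemma bad_tendsto_0:
  assumes \<eta>: "\<eta> > 0"
  shows "(\<lambda>n. prob (bad p \<eta> n)) \<longlonglongrightarrow> 0"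
proof -
  have "decseq (bad p \<eta>)" unfolding bad_def decseq_def by (auto intro: order_trans)
  then have "(\<lambda>n. prob (bad p \<eta> n)) \<longlonglongrightarrow> prob (\<Inter>n. bad p \<eta> n)"
    using bad_events by (intro finite_Lim_measure_decseq) auto
  moreover have "prob (\<Inter>n. bad p \<eta> n) = 0"
  proof (rule prob_eq_0[THEN iffD2])
    show "(\<Inter>n. bad p \<eta> n) \<in> events" using bad_events by auto
    show "AE \<omega> in M. \<omega> \<notin> (\<Inter>n. bad p \<eta> n)"
      using AE_tendsto_Hbar[of p]
    proof eventually_elim
      case (elim \<omega>)
      have "(\<lambda>k. - scale k * v p (scale k) \<omega> 0) \<longlonglongrightarrow> Hbar p" using filterlim_compose[OF elim scale_at_right] .
      from tendstoD[OF this \<eta>] obtain n where "\<And>k. k \<ge> n \<Longrightarrow> dist (- scale k * v p (scale k) \<omega> 0) (Hbar p) < \<eta>"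
        unfolding eventually_sequentially by blast
      then have "\<And>k. k \<ge> n \<Longrightarrow> \<bar>Hbar p + scale k * v p (scale k) \<omega> 0\<bar> < \<eta>"
        by (force simp: dist_real_def abs_less_iff)
      then have "\<omega> \<notin> bad p \<eta> n" unfolding bad_def by (auto simp: not_less intro: less_imp_le)
      then show ?case by blast
    qed
  qed
  ultimately show ?thesis by simp
qed

lemma shift_power: "\<omega> \<in> space M \<Longrightarrow> (\<tau> e ^^ j) \<omega> = \<tau> (real j *\<^sub>R e) \<omega>"
proof (induction j)
  case 0
  then show ?case by (simp add: group_zero)
next
  case (Suc j)
  then show ?case using group_add[of \<omega> e "real j *\<^sub>R e"] by (simp add: algebra_simps)
qed

text \<open>Environments for which, at every accuracy, the bad ones are rarely visited along the multiples of \<open>e\<close>.\<close>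

definition generic :: "real^'d \<Rightarrow> real^'d \<Rightarrow> 'a \<Rightarrow> bool" where
  "generic p e \<omega> \<longleftrightarrow> (\<forall>m. \<exists>n. \<forall>k. visits (\<tau> e) (bad p (1 / real (m + 2)) n) k \<omega> \<le> 1 / real (m + 2) * k)"

lemma AE_generic: "AE \<omega> in M. generic p e \<omega>"
  unfolding generic_def
  by (subst AE_all_countable)
     (intro allI AE_rare_visits measurable_shift measure_preserving bad_events bad_tendsto_0; simp)

text \<open>
  At the scale \<open>1/N\<close> with \<open>N = k + 1\<close> there is a multiple \<open>j e\<close> with \<open>N \<le> j \<le> N + 2 \<theta> N\<close> where the environment is not
  bad. Going from \<open>j e\<close> to \<open>N e\<close> costs at most \<open>L \<bar>e\<bar> 2 \<theta> N\<close>, and the factor \<open>1/N\<close> turns this into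
  \<open>2 \<theta> L \<bar>e\<bar>\<close>.
\<close>

lemma rescaled_limit:
  assumes gen: "generic p e \<omega>" and \<omega>: "\<omega> \<in> space M"
  shows "(\<lambda>k. scale k * v p (scale k) \<omega> (real (Suc k) *\<^sub>R e)) \<longlonglongrightarrow> - Hbar p"
proof -
  obtain L where L: "L \<ge> 0" and lip: "\<And>\<delta>. \<delta> > 0 \<Longrightarrow> L-lipschitz_on UNIV (v p \<delta> \<omega>)"
    using macro_solution_bounds[OF norm_plus_one(2)[of p]] norm_plus_one(1)[of p] \<omega> by metis
  define Q where "Q = 1 + 2 * L * norm e"
  have Q: "Q > 0" unfolding Q_def using L by (simp add: add_pos_nonneg)
  show ?thesis
  proof (rule tendstoI)
    fix \<epsilon> :: real assume \<epsilon>: "\<epsilon> > 0"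
    obtain m :: nat where m: "Q / \<epsilon> < real m" using reals_Archimedean2 by blast
    define \<theta> where "\<theta> = 1 / real (m + 2)"
    have \<theta>: "0 < \<theta>" "\<theta> \<le> 1 / 2" unfolding \<theta>_def by (auto simp: field_simps)
    have "Q < \<epsilon> * real (m + 2)" using m \<epsilon> by (simp add: field_simps)
    then have Q\<theta>: "\<theta> * Q < \<epsilon>" unfolding \<theta>_def by (simp add: field_simps)
    obtain n where n: "\<And>k. visits (\<tau> e) (bad p \<theta> n) k \<omega> \<le> \<theta> * k"
      using gen unfolding generic_def \<theta>_def by blast
    have "dist (scale k * v p (scale k) \<omega> (real (Suc k) *\<^sub>R e)) (- Hbar p) < \<epsilon>" if k: "k \<ge> n" for k
    proof -
      obtain j where j: "Suc k \<le> j" "real j \<le> Suc k + 2 * \<theta> * Suc k" "(\<tau> e ^^ j) \<omega> \<notin> bad p \<theta> n"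
        using exists_non_visit[OF n \<theta>] by blast
      have "\<tau> (real j *\<^sub>R e) \<omega> \<notin> bad p \<theta> n" using j(3) unfolding shift_power[OF \<omega>] .
      then have "\<bar>Hbar p + scale k * v p (scale k) (\<tau> (real j *\<^sub>R e) \<omega>) 0\<bar> \<le> \<theta>"
        using k shift_in_space[OF \<omega>] unfolding bad_def by (auto simp: not_less)
      then have 1: "\<bar>Hbar p + scale k * v p (scale k) \<omega> (real j *\<^sub>R e)\<bar> \<le> \<theta>"
        unfolding macro_solution_stationary[OF scale_pos \<omega> shift_in_space[OF \<omega>]] by simp
      have "\<bar>v p (scale k) \<omega> (real (Suc k) *\<^sub>R e) - v p (scale k) \<omega> (real j *\<^sub>R e)\<bar>
          \<le> L * norm (real (Suc k) *\<^sub>R e - real j *\<^sub>R e)"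
        using lipschitz_onD[OF lip[OF scale_pos], of "real (Suc k) *\<^sub>R e" "real j *\<^sub>R e" k]
        by (simp add: dist_real_def dist_norm)
      also have "real (Suc k) *\<^sub>R e - real j *\<^sub>R e = (real (Suc k) - real j) *\<^sub>R e"
        by (simp only: scaleR_diff_left)
      also have "L * norm ((real (Suc k) - real j) *\<^sub>R e) = L * (\<bar>real (Suc k) - real j\<bar> * norm e)" by simp
      also have "\<dots> \<le> L * ((2 * \<theta> * Suc k) * norm e)"
        using j(1,2) L by (intro mult_left_mono mult_right_mono) (auto simp: abs_if)
      finally have "scale k * \<bar>v p (scale k) \<omega> (real (Suc k) *\<^sub>R e) - v p (scale k) \<omega> (real j *\<^sub>R e)\<bar>
          \<le> scale k * (L * ((2 * \<theta> * Suc k) * norm e))"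
        using scale_pos[of k] by (intro mult_left_mono) auto
      also have "\<dots> = (scale k * real (Suc k)) * (2 * \<theta> * L * norm e)" by (simp only: mult_ac)
      also have "scale k * real (Suc k) = 1" unfolding scale_def by simp
      finally have "\<bar>scale k * (v p (scale k) \<omega> (real (Suc k) *\<^sub>R e) - v p (scale k) \<omega> (real j *\<^sub>R e))\<bar>
          \<le> 2 * \<theta> * L * norm e"
        using scale_pos[of k] by (simp add: abs_mult)
      with 1 have "\<bar>Hbar p + scale k * v p (scale k) \<omega> (real (Suc k) *\<^sub>R e)\<bar> \<le> \<theta> + 2 * \<theta> * L * norm e"
        unfolding right_diff_distrib by linarith
      also have "\<dots> = \<theta> * Q" unfolding Q_def by (simp add: algebra_simps)
      finally show ?thesis using Q\<theta> by (simp add: dist_real_def add.commute)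
    qed
    then show "eventually (\<lambda>k. dist (scale k * v p (scale k) \<omega> (real (Suc k) *\<^sub>R e)) (- Hbar p) < \<epsilon>) sequentially"
      unfolding eventually_sequentially by blast
  qed
qed

lemma uniform_limit_along_scales:
  assumes D: "closure D = UNIV" and gen: "\<And>e. e \<in> D \<Longrightarrow> generic p e \<omega>"
    and \<omega>: "\<omega> \<in> space M" and \<epsilon>: "\<epsilon> > 0"
  shows "eventually (\<lambda>k. \<forall>y\<in>cball 0 R. \<bar>Hbar p + scale k * v p (scale k) \<omega> (real (Suc k) *\<^sub>R y)\<bar> < \<epsilon>) sequentially"
proof -
  obtain L where L: "L \<ge> 0" and lip: "\<And>\<delta>. \<delta> > 0 \<Longrightarrow> L-lipschitz_on UNIV (v p \<delta> \<omega>)"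
    using macro_solution_bounds[OF norm_plus_one(2)[of p]] norm_plus_one(1)[of p] \<omega> by metis
  define w where "w = (\<lambda>k y. scale k * v p (scale k) \<omega> (real (Suc k) *\<^sub>R y))"
  have w_diff: "\<bar>w k x - w k y\<bar> \<le> L * norm (x - y)" for k x y
  proof -
    have "\<bar>v p (scale k) \<omega> (real (Suc k) *\<^sub>R x) - v p (scale k) \<omega> (real (Suc k) *\<^sub>R y)\<bar>
        \<le> L * norm (real (Suc k) *\<^sub>R x - real (Suc k) *\<^sub>R y)"
      using lipschitz_onD[OF lip[OF scale_pos], of "real (Suc k) *\<^sub>R x" "real (Suc k) *\<^sub>R y" k]
      by (simp only: dist_real_def dist_norm UNIV_I)
    also have "norm (real (Suc k) *\<^sub>R x - real (Suc k) *\<^sub>R y) = real (Suc k) * norm (x - y)"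
      unfolding scaleR_diff_right[symmetric] by simp
    finally have "scale k * \<bar>v p (scale k) \<omega> (real (Suc k) *\<^sub>R x) - v p (scale k) \<omega> (real (Suc k) *\<^sub>R y)\<bar>
        \<le> scale k * (L * (real (Suc k) * norm (x - y)))"
      using scale_pos[of k] by (intro mult_left_mono) auto
    also have "\<dots> = (scale k * real (Suc k)) * (L * norm (x - y))" by (simp only: mult_ac)
    also have "scale k * real (Suc k) = 1" unfolding scale_def by simp
    finally show ?thesis unfolding w_def right_diff_distrib[symmetric] using scale_pos[of k] by (simp add: abs_mult)
  qed
  have w_lip: "L-lipschitz_on UNIV (w k)" "L-lipschitz_on UNIV (\<lambda>y. - w k y)" for k
    using w_diff[of k] L by (auto intro!: lipschitz_onI simp: dist_real_def dist_norm abs_minus_commute)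
  have c_lip: "L-lipschitz_on UNIV (\<lambda>y::real^'d. c)" for c :: real
    using L by (simp add: lipschitz_on_def)
  have lim: "(\<lambda>k. w k e) \<longlonglongrightarrow> - Hbar p" if "e \<in> D" for e
    unfolding w_def by (rule rescaled_limit[OF gen[OF that] \<omega>])
  have "eventually (\<lambda>k. \<forall>y\<in>cball 0 R. w k y < - Hbar p + \<epsilon>) sequentially"
    by (rule eventually_uniformly_below[OF w_lip(1) c_lip D _ \<epsilon>])
       (use lim in \<open>auto intro!: order_tendstoD(2)\<close>)
  moreover have "eventually (\<lambda>k. \<forall>y\<in>cball 0 R. - w k y < Hbar p + \<epsilon>) sequentially"
    by (rule eventually_uniformly_below[OF w_lip(2) c_lip D _ \<epsilon>])
       (use tendsto_minus[OF lim] in \<open>auto intro!: order_tendstoD(2)\<close>)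
  ultimately show ?thesis
  proof eventually_elim
    case (elim k)
    show ?case
    proof
      fix y :: "real^'d" assume "y \<in> cball 0 R"
      then have "w k y < - Hbar p + \<epsilon>" "- w k y < Hbar p + \<epsilon>" using elim by blast+
      then show "\<bar>Hbar p + scale k * v p (scale k) \<omega> (real (Suc k) *\<^sub>R y)\<bar> < \<epsilon>"
        unfolding w_def by linarith
    qed
  qed
qed

text \<open>
  Given \<open>\<delta>\<close>, choose \<open>N\<close> with \<open>1/(N+1) < \<delta> \<le> 1/N\<close>. Changing the scale from \<open>1/N\<close> to \<open>\<delta>\<close> costs at most \<open>2 C \<delta>\<close>, and
  the ball of radius \<open>R/\<delta>\<close> lies in the one of radius \<open>2 R N\<close>.
\<close>

lemma uniform_limit_generic:
  assumes D: "closure D = UNIV" and gen: "\<And>e. e \<in> D \<Longrightarrow> generic p e \<omega>"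
    and \<omega>: "\<omega> \<in> space M" and \<epsilon>: "\<epsilon> > 0"
  shows "eventually (\<lambda>\<delta>. \<forall>x\<in>ball 0 (R / \<delta>). \<bar>Hbar p + \<delta> * v p \<delta> \<omega> x\<bar> < \<epsilon>) (at_right 0)"
proof -
  obtain C where C: "C \<ge> 0"
    and interp: "\<And>\<delta> \<delta>' x. 0 < \<delta>' \<Longrightarrow> \<delta>' \<le> \<delta> \<Longrightarrow> \<bar>\<delta> * v p \<delta> \<omega> x - \<delta>' * v p \<delta>' \<omega> x\<bar> \<le> 2 * C * (\<delta> - \<delta>') / \<delta>"
    using macro_solution_bounds[OF norm_plus_one(2)[of p]] norm_plus_one(1)[of p] \<omega> by metis
  obtain k0 where k0: "\<And>k y. k \<ge> k0 \<Longrightarrow> y \<in> cball 0 (2 * \<bar>R\<bar>) \<Longrightarrow>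
      \<bar>Hbar p + scale k * v p (scale k) \<omega> (real (Suc k) *\<^sub>R y)\<bar> < \<epsilon> / 2"
    using uniform_limit_along_scales[OF D gen \<omega>, of "\<epsilon> / 2" "2 * \<bar>R\<bar>"] \<epsilon>
    unfolding eventually_sequentially by fastforce
  define \<delta>0 where "\<delta>0 = min (1 / real (k0 + 2)) (\<epsilon> / (4 * (C + 1)))"
  have \<delta>0: "\<delta>0 > 0" unfolding \<delta>0_def using \<epsilon> C by simp
  have "\<bar>Hbar p + \<delta> * v p \<delta> \<omega> x\<bar> < \<epsilon>" if \<delta>: "0 < \<delta>" "\<delta> < \<delta>0" and x: "x \<in> ball 0 (R / \<delta>)" for \<delta> x
  proof -
    define N where "N = nat \<lfloor>1 / \<delta>\<rfloor>"
    have inv: "real (k0 + 2) < 1 / \<delta>" using \<delta> unfolding \<delta>0_def by (simp add: field_simps)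
    have N: "real N \<le> 1 / \<delta>" "1 / \<delta> < real N + 1"
    proof -
      have "1 / \<delta> \<ge> 0" using \<delta> by simp
      then show "real N \<le> 1 / \<delta>" "1 / \<delta> < real N + 1" unfolding N_def by linarith+
    qed
    have Nk: "N \<ge> k0 + 2" using inv N(2) by linarith
    define k where "k = N - 1"
    have k: "Suc k = N" "k \<ge> k0" unfolding k_def using Nk by auto
    have dk: "scale k = 1 / real N" unfolding scale_def k(1) ..
    have N0: "real N \<ge> 1" using Nk by simp
    have \<delta>N: "\<delta> * real N \<le> 1" "1 < \<delta> * real N + \<delta>"
      using N \<delta> by (auto simp: field_simps)
    have le: "\<delta> \<le> scale k" unfolding dk using \<delta>N(1) N0 by (simp add: field_simps)
    have "(scale k - \<delta>) / scale k = 1 - \<delta> * real N" unfolding dk using N0 by (simp add: field_simps)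
    then have frac: "(scale k - \<delta>) / scale k \<le> \<delta>" using \<delta>N by simp
    have "\<bar>scale k * v p (scale k) \<omega> x - \<delta> * v p \<delta> \<omega> x\<bar> \<le> 2 * C * ((scale k - \<delta>) / scale k)"
      using interp[OF \<delta>(1) le, of x] by simp
    also have "\<dots> \<le> 2 * C * \<delta>" using frac C by (intro mult_left_mono) auto
    also have "\<dots> < \<epsilon> / 2"
    proof -
      have "2 * C * \<delta> \<le> 2 * (C + 1) * \<delta>" using \<delta> by (simp add: algebra_simps)
      also have "\<dots> < 2 * (C + 1) * (\<epsilon> / (4 * (C + 1)))"
        using \<delta> C unfolding \<delta>0_def by (intro mult_strict_left_mono) auto
      also have "\<dots> = \<epsilon> / 2" using C by (simp add: field_simps)
      finally show ?thesis .
    qed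
    finally have 1: "\<bar>scale k * v p (scale k) \<omega> x - \<delta> * v p \<delta> \<omega> x\<bar> < \<epsilon> / 2" .
    define y where "y = (1 / real N) *\<^sub>R x"
    have xy: "x = real (Suc k) *\<^sub>R y" unfolding y_def k(1) using N0 by simp
    have "norm x < R / \<delta>" using x by simp
    also have "\<dots> \<le> \<bar>R\<bar> * (1 / \<delta>)" using \<delta> by (simp add: divide_right_mono)
    also have "\<dots> \<le> \<bar>R\<bar> * (2 * real N)" using N(2) N0 by (intro mult_left_mono) auto
    finally have "norm x \<le> 2 * \<bar>R\<bar> * real N" by simp
    then have "norm y \<le> 2 * \<bar>R\<bar>" unfolding y_def using N0 by (simp add: field_simps)
    then have "\<bar>Hbar p + scale k * v p (scale k) \<omega> x\<bar> < \<epsilon> / 2" using k0[OF k(2), of y] unfolding xy by simp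
    then show ?thesis using 1 by linarith
  qed
  then show ?thesis unfolding eventually_at_right_field using \<delta>0 by blast
qed

text \<open>Countably many pairs \<open>(p, e)\<close> determine the null set; other \<open>p\<close> follow by Lipschitz dependence.\<close>

lemma AE_uniform_limit:
  "AE \<omega> in M. \<forall>p R \<epsilon>. \<epsilon> > 0 \<longrightarrow>
     eventually (\<lambda>\<delta>. \<forall>x\<in>ball 0 (R / \<delta>). \<bar>Hbar p + \<delta> * v p \<delta> \<omega> x\<bar> < \<epsilon>) (at_right 0)"
proof -
  obtain D :: "(real^'d) set" where D: "countable D" "closure D = UNIV" by (rule countable_dense)
  have "AE \<omega> in M. \<forall>p\<in>D. \<forall>e\<in>D. generic p e \<omega>"
    using AE_generic by (simp add: AE_ball_countable[OF D(1)])
  then show ?thesis using AE_space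
  proof eventually_elim
    case (elim \<omega>)
    show ?case
    proof (intro allI impI)
      fix p :: "real^'d" and R \<epsilon> :: real assume \<epsilon>: "\<epsilon> > 0"
      have "norm p + 1 > 0" by (simp add: add_nonneg_pos)
      from macro_solution_bounds[OF this] obtain K where K: "K \<ge> 0"
        "\<And>p' \<delta> \<omega> x. norm p' \<le> norm p + 1 \<Longrightarrow> \<delta> > 0 \<Longrightarrow> \<omega> \<in> space M \<Longrightarrow>
          \<bar>\<delta> * v p \<delta> \<omega> x - \<delta> * v p' \<delta> \<omega> x\<bar> \<le> K * norm (p - p')"
        by (metis norm_plus_one(1))
      define r where "r = min 1 (\<epsilon> / (4 * (K + 1)))"
      have r: "r > 0" "r \<le> 1" unfolding r_def using \<epsilon> K by auto
      have Kr: "K * r \<le> \<epsilon> / 4"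
      proof -
        have "K * r \<le> (K + 1) * (\<epsilon> / (4 * (K + 1)))" unfolding r_def using K \<epsilon> by (intro mult_mono) auto
        also have "\<dots> = \<epsilon> / 4" using K by (simp add: field_simps)
        finally show ?thesis .
      qed
      obtain p' where p': "p' \<in> D" "dist p' p < r" using D(2) r closure_approachable by blast
      have "norm p' \<le> norm p + 1"
        using p'(2) r norm_triangle_ineq2[of p' p] by (simp add: dist_norm)
      note Kp = K(2)[OF this]
      have "norm (p - p') \<le> r" using p' by (simp add: dist_norm norm_minus_commute)
      then have "K * norm (p - p') \<le> K * r" using K(1) by (rule mult_left_mono)
      then have K4: "K * norm (p - p') \<le> \<epsilon> / 4" using Kr by simp
      have hh: "\<bar>Hbar p - Hbar p'\<bar> \<le> K * norm (p - p')" using Kp by (intro Hbar_lipschitz)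
      have "eventually (\<lambda>\<delta>. \<forall>x\<in>ball 0 (R / \<delta>). \<bar>Hbar p' + \<delta> * v p' \<delta> \<omega> x\<bar> < \<epsilon> / 2) (at_right 0)"
        by (rule uniform_limit_generic[OF D(2)]) (use elim p'(1) \<epsilon> in auto)
      then show "eventually (\<lambda>\<delta>. \<forall>x\<in>ball 0 (R / \<delta>). \<bar>Hbar p + \<delta> * v p \<delta> \<omega> x\<bar> < \<epsilon>) (at_right 0)"
        using eventually_at_right_less[of "0::real"]
      proof eventually_elim
        case (elim \<delta>)
        show ?case
        proof
          fix x :: "real^'d" assume "x \<in> ball 0 (R / \<delta>)"
          then have "\<bar>Hbar p' + \<delta> * v p' \<delta> \<omega> x\<bar> < \<epsilon> / 2" using elim by blast
          moreover have "\<bar>\<delta> * v p \<delta> \<omega> x - \<delta> * v p' \<delta> \<omega> x\<bar> \<le> K * norm (p - p')"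
            using Kp elim(2) \<open>\<omega> \<in> space M\<close> by blast
          ultimately show "\<bar>Hbar p + \<delta> * v p \<delta> \<omega> x\<bar> < \<epsilon>" using hh K4 by linarith
        qed
      qed
    qed
  qed
qed

end

lemma SUP_tendsto_0:
  fixes f :: "real \<Rightarrow> real^'d \<Rightarrow> real"
  assumes R: "R > 0"
    and f: "\<And>\<epsilon>. \<epsilon> > 0 \<Longrightarrow> eventually (\<lambda>\<delta>. \<forall>x\<in>ball 0 (R / \<delta>). \<bar>f \<delta> x\<bar> < \<epsilon>) (at_right 0)"
  shows "((\<lambda>\<delta>. SUP x\<in>ball 0 (R / \<delta>). ereal \<bar>f \<delta> x\<bar>) \<longlongrightarrow> 0) (at_right 0)"
proof (rule order_tendstoI)
  fix a :: ereal assume a: "a < 0"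
  show "eventually (\<lambda>\<delta>. a < (SUP x\<in>ball 0 (R / \<delta>). ereal \<bar>f \<delta> x\<bar>)) (at_right 0)"
    using eventually_at_right_less[of "0::real"]
  proof eventually_elim
    case (elim \<delta>)
    have "(0::real^'d) \<in> ball 0 (R / \<delta>)" using R elim by simp
    moreover have "a < ereal \<bar>f \<delta> 0\<bar>" using a by (rule less_le_trans) simp
    ultimately show ?case by (meson less_SUP_iff)
  qed
next
  fix a :: ereal assume "0 < a"
  then obtain \<epsilon> where \<epsilon>: "0 < ereal \<epsilon>" "ereal \<epsilon> < a" using ereal_dense2 by blast
  then have "\<epsilon> > 0" by simp
  from f[OF this]
  show "eventually (\<lambda>\<delta>. (SUP x\<in>ball 0 (R / \<delta>). ereal \<bar>f \<delta> x\<bar>) < a) (at_right 0)"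
  proof eventually_elim
    case (elim \<delta>)
    have "(SUP x\<in>ball 0 (R / \<delta>). ereal \<bar>f \<delta> x\<bar>) \<le> ereal \<epsilon>"
      by (rule SUP_least) (use elim in \<open>auto intro: less_imp_le\<close>)
    then show ?case using \<epsilon>(2) by simp
  qed
qed

theorem proposition9p2:
  fixes M :: "'a measure"
    and \<tau> :: "real^'d \<Rightarrow> 'a \<Rightarrow> 'a"
    and H :: "real^'d \<Rightarrow> real^'d \<Rightarrow> 'a \<Rightarrow> real"
  assumes "ergodic_environment M \<tau>"
    and "stationary_hamiltonian M \<tau> H"
    and "\<And>H' :: real^'d \<Rightarrow> real^'d \<Rightarrow> 'a \<Rightarrow> real.
           stationary_hamiltonian M \<tau> H' \<Longrightarrow> convex_outside_bounded_set M \<tau> H' \<Longrightarrow>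
           \<exists>\<Omega>8. full_probability M \<Omega>8 \<and>
             (\<forall>\<omega>\<in>\<Omega>8. \<forall>p. \<exists>L::real.
                ((\<lambda>\<delta>. - \<delta> * macro_solution H' p \<delta> \<omega> 0) \<longlongrightarrow> L) (at_right 0))"
  shows "\<exists>\<Omega>9. full_probability M \<Omega>9 \<and>
           (\<forall>\<omega>\<in>\<Omega>9. \<forall>p. \<forall>R>0.
              ((\<lambda>\<delta>. SUP x\<in>ball 0 (R / \<delta>).
                  ereal \<bar>effective_hamiltonian M H p + \<delta> * macro_solution H p \<delta> \<omega> x\<bar>) \<longlongrightarrow> 0)
                (at_right 0))"
proof -
  have setting: "homogenization_setting M \<tau> H"
    by (intro homogenization_setting.intro homogenization_setting_axioms.intro assms)
  interpret homogenization_setting M \<tau> H by (rule setting)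
  from full_probability_of_AE[OF AE_uniform_limit]
  obtain A where A: "full_probability M A"
    and lim: "\<forall>\<omega>\<in>A. \<omega> \<in> space M \<and> (\<forall>p R \<epsilon>. \<epsilon> > 0 \<longrightarrow>
      eventually (\<lambda>\<delta>. \<forall>x\<in>ball 0 (R / \<delta>). \<bar>Hbar p + \<delta> * macro_solution H p \<delta> \<omega> x\<bar> < \<epsilon>) (at_right 0))"
    by (elim exE conjE)
  show ?thesis
    unfolding effective_hamiltonian_eq
  proof (intro exI[of _ A] conjI ballI allI impI A SUP_tendsto_0)
    fix \<omega> p and R \<epsilon> :: real assume "\<omega> \<in> A" "\<epsilon> > 0"
    then show "eventually (\<lambda>\<delta>. \<forall>x\<in>ball 0 (R / \<delta>). \<bar>Hbar p + \<delta> * macro_solution H p \<delta> \<omega> x\<bar> < \<epsilon>) (at_right 0)"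
      using lim by blast
  qed
qed

end
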